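(* Let $q$ be a power of $2$ and let $k\ge1$ be an integer. Assume that, as $g\to\infty$, \[ \sum_{u\in\mathcal{I}_{g+1}}L\left(\tfrac12,\chi_u\right)^k=\sum_{u\in\mathcal{I}_{g+1}}Q_k(2g+1)\,(1+o(1)), \] where $Q_k$ is as defined in the context. Then, as $g\to\infty$, \[ \sum_{u\in\mathcal{I}_{g+1}}L\left(\tfrac12,\chi_u\right)^k\sim 2^{\frac{k(k+1)}{2}+1}\,\frac{q^{2g+1}}{\zeta_{\mathbb{A}}(2)}\,g^{\frac{k(k+1)}{2}}\,A\left(\tfrac12;0,\dots,0\right)\prod_{j=1}^k\frac{j!}{(2j)!}. \]
   Context: Setting: $q$ is a power of $2$, $\mathbb{A}=\mathbb{F}_q[T]$, $k_0=\mathbb{F}_q(T)$, and $|f|=q^{\deg f}$. Monic irreducible polynomials are denoted $P$, and $\mathfrak{v}_P(M)$ is the exponent of $P$ in $M$. The zeta function is $\zeta_{\mathbb{A}}(s)=\sum_{f \text{ monic}}|f|^{-s}=(1-q^{1-s})^{-1}$. Fix $\xi\in\mathbb{F}_q\setminus\{x^2+x:x\in\mathbb{F}_q\}$. Let $\mathcal{B}$ be the set of monic $M$ such that $\mathfrak{v}_P(M)$ is $0$ or odd for all $P$. For $P\mid M$, put $\ell_P=\tfrac12(\mathfrak{v}_P(M)+1)$. Let $t(M)=M\prod_{P\mid M}P$ and $\mathcal{B}_n=\{M\in\mathcal{B}:\deg t(M)=2n\}$. Let $\mathcal{F}_n$ ($n\ge1$) be the set of rational functions $\sum_{P\mid M}\sum_{i=1}^{\ell_P}A_{P,i}/P^{2i-1}$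 with $M\in\mathcal{B}_n$, $A_{P,i}\in\mathbb{A}$, $\deg A_{P,i}<\deg P$, and $A_{P,\ell_P}\ne0$ for all $P\mid M$. Let $\mathcal{F}_0=\{0\}$. Let $\mathcal{G}_s$ ($s\ge1$) be the set of polynomials $\alpha+\sum_{i=1}^s\alpha_iT^{2i-1}$ with $\alpha\in\{0,\xi\}$, $\alpha_i\in\mathbb{F}_q$ and $\alpha_s\ne0$. Set $\mathcal{I}_n=\bigcup_{r\ge0,\,s\ge1,\,r+s=n}\{u+F:u\in\mathcal{F}_r,\ F\in\mathcal{G}_s\}$. Hasse symbol: for $u\in k_0$ with denominator prime to $P$, $[u,P)=0$ if $X^2+X\equiv u\pmod P$ is solvable in $\mathbb{A}$, and $1$ otherwise. Extend additively, $[u,N)=\sum e_i[u,P_i)$ for $N=\mathrm{sgn}(N)\prod P_i^{e_i}$. Then $\chi_u(f)=(-1)^{[u,f)}$ if the monic $f$ is prime to the denominator of $u$, and $\chi_u(f)=0$ otherwise. The L-function is $L(s,\chi_u)=\sum_{f\text{ monic}}\chi_u(f)|f|^{-s}$ for $\Re s>1$; for $u\in\mathcal{I}_{g+1}$ it is a polynomial in $q^{-s}$, which gives the value at $s=\tfrac12$. The Euler product $A$ is defined, for $|\Re z_j|$ small, by \begin{align*} A\left(\tfrac12;z_1,\dots,z_k\right)=\prod_P&\prod_{1\le i\le j\le k}\left(1-|P|^{-1-z_i-z_j}\right)\\ &\times\left(\tfrac12\left(\prod_{j=1}^k\left(1-|P|^{-\frac12-z_j}\right)^{-1}+\prod_{j=1}^k\left(1+|P|^{-\frac12-z_j}\right)^{-1}\right)+\frac{1}{|P|}\right)\left(1+\frac1{|P|}\right)^{-1}.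 \end{align*} Let $X(s)=q^{s-\frac12}$, so that $X(\tfrac12+z)^{-1/2}=q^{-z/2}$. Define \[ G(z_1,\dots,z_k)=A\left(\tfrac12;z_1,\dots,z_k\right)\prod_{j=1}^kX\left(\tfrac12+z_j\right)^{-1/2}\prod_{1\le i\le j\le k}\zeta_{\mathbb{A}}(1+z_i+z_j). \] Let $\Delta(w_1,\dots,w_k)=\prod_{1\le i<j\le k}(w_j-w_i)$ be the Vandermonde product. Define \[ Q_k(x)=\frac{(-1)^{\frac{k(k-1)}{2}}2^k}{k!}\frac{1}{(2\pi i)^k}\oint\cdots\oint\frac{G(z_1,\dots,z_k)\,\Delta(z_1^2,\dots,z_k^2)^2}{\prod_{j=1}^kz_j^{2k-1}}\,q^{\frac{x}{2}\sum_{j=1}^kz_j}\,dz_1\cdots dz_k, \] where the contours are small circles around $0$. This $Q_k$ is a polynomial of degree $\tfrac12k(k+1)$. *)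

theory Defs
  imports
    "HOL-Complex_Analysis.Complex_Analysis"
    "HOL-Computational_Algebra.Computational_Algebra"
    "HOL-Library.Landau_Symbols"
begin

text \<open>
  The type \<open>'a :: {finite, field_gcd}\<close> is the finite field with \<open>q = CARD('a)\<close> elements;
  \<open>'a poly\<close> is the polynomial ring over it and \<open>'a poly fract\<close> its field of rational functions.
  The class \<open>field_gcd\<close> adds to \<open>field\<close> only the trivial gcd structure that every field carries;
  the library needs it to treat \<open>'a poly\<close> as a factorial ring (\<open>multiplicity\<close>,
  \<open>quot_of_fract\<close>).
\<close>

definition pabs :: "'a::{finite,field_gcd} poly \<Rightarrow> real" where
  "pabs f = real CARD('a) ^ degree f"

definition monics :: "'a::field_gcd poly set" where
  "monics = {f. lead_coeff f = 1}"

definition mon_irr :: "'a::field_gcd poly set" where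
  "mon_irr = {P. lead_coeff P = 1 \<and> irreducible P}"

definition mon_irr_divisors :: "'a::field_gcd poly \<Rightarrow> 'a poly set" where
  "mon_irr_divisors M = {P \<in> mon_irr. P dvd M}"

text \<open>
  The closed form of \<open>\<Sum>f\<in>monics. |f| powr (-s)\<close>, which is also its continuation to
  \<open>Re s \<le> 1\<close>.
\<close>
definition zetaA :: "'a::{finite,field_gcd} itself \<Rightarrow> complex \<Rightarrow> complex" where
  "zetaA _ s = inverse (1 - of_nat CARD('a) powr (1 - s))"


subsection \<open>The families of rational functions\<close>

definition setB :: "'a::field_gcd poly set" where
  "setB = {M. lead_coeff M = 1 \<and>
     (\<forall>P\<in>mon_irr. multiplicity P M = 0 \<or> odd (multiplicity P M))}"

definition ell :: "'a::field_gcd poly \<Rightarrow> 'a poly \<Rightarrow> nat" where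
  "ell M P = (multiplicity P M + 1) div 2"

definition tpoly :: "'a::field_gcd poly \<Rightarrow> 'a poly" where
  "tpoly M = M * \<Prod>(mon_irr_divisors M)"

definition setBn :: "nat \<Rightarrow> 'a::field_gcd poly set" where
  "setBn n = {M \<in> setB. degree (tpoly M) = 2 * n}"

definition setF :: "nat \<Rightarrow> 'a::field_gcd poly fract set" where
  "setF n = (if n = 0 then {0} else
     {(\<Sum>P\<in>mon_irr_divisors M. \<Sum>i=1..ell M P. Fraction_Field.Fract (A P i) (P ^ (2 * i - 1)))
       | M A. M \<in> setBn n \<and>
           (\<forall>P\<in>mon_irr_divisors M.
              (\<forall>i\<in>{1..ell M P}. degree (A P i) < degree P) \<and> A P (ell M P) \<noteq> 0)})"

definition setG :: "'a::field_gcd \<Rightarrow> nat \<Rightarrow> 'a poly set" where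
  "setG \<xi> s = {[:\<alpha>:] + (\<Sum>i=1..s. monom (a i) (2 * i - 1)) | \<alpha> a. \<alpha> \<in> {0, \<xi>} \<and> a s \<noteq> 0}"

definition setI :: "'a::field_gcd \<Rightarrow> nat \<Rightarrow> 'a poly fract set" where
  "setI \<xi> n = {u + to_fract F | u F r s.
     s \<ge> 1 \<and> r + s = n \<and> u \<in> setF r \<and> F \<in> setG \<xi> s}"


subsection \<open>Hasse symbol, quadratic characters and L-functions\<close>

definition denom_prime_to :: "'a::field_gcd poly fract \<Rightarrow> 'a poly \<Rightarrow> bool" where
  "denom_prime_to u f \<longleftrightarrow> coprime (snd (quot_of_fract u)) f"

text \<open>
  Congruence modulo \<open>P\<close> of rational functions: the difference is \<open>P\<close> times a rational function
  whose denominator is prime to \<open>P\<close>.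
\<close>
definition rat_cong :: "'a::field_gcd poly \<Rightarrow> 'a poly fract \<Rightarrow> 'a poly fract \<Rightarrow> bool" where
  "rat_cong P u v \<longleftrightarrow> (\<exists>w. denom_prime_to w P \<and> u - v = to_fract P * w)"

definition hasse_prime :: "'a::field_gcd poly fract \<Rightarrow> 'a poly \<Rightarrow> nat" where
  "hasse_prime u P =
     (if \<exists>X. rat_cong P (to_fract (X\<^sup>2 + X)) u then 0 else 1)"

definition hasse :: "'a::field_gcd poly fract \<Rightarrow> 'a poly \<Rightarrow> nat" where
  "hasse u N = (\<Sum>P\<in>mon_irr_divisors N. multiplicity P N * hasse_prime u P)"

definition chi :: "'a::field_gcd poly fract \<Rightarrow> 'a poly \<Rightarrow> complex" where
  "chi u f = (if denom_prime_to u f then (-1) ^ hasse u f else 0)"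

text \<open>
  The polynomial in \<open>q powr (-s)\<close> that represents the Dirichlet series of \<open>chi u\<close> on
  \<open>Re s > 1\<close>; it is unique, and it exists for \<open>u \<in> setI \<xi> (g + 1)\<close>.
\<close>
definition Lpoly :: "'a::{finite,field_gcd} poly fract \<Rightarrow> complex poly" where
  "Lpoly u = (THE p. \<forall>s. Re s > 1 \<longrightarrow>
     ((\<lambda>f. chi u f * complex_of_real (pabs f) powr (-s)) has_sum
        poly p (of_nat CARD('a) powr (-s))) monics)"

definition Lfun :: "complex \<Rightarrow> 'a::{finite,field_gcd} poly fract \<Rightarrow> complex" where
  "Lfun s u = poly (Lpoly u) (of_nat CARD('a) powr (-s))"


subsection \<open>The Euler product and the polynomial \<open>Q\<close>\<close>

text \<open>Tuples \<open>(z\<^sub>1, \<dots>, z\<^sub>k)\<close> are functions \<open>z\<close>, of which only \<open>z 1, \<dots>, z k\<close> are used.\<close>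

definition euler_factor :: "nat \<Rightarrow> (nat \<Rightarrow> complex) \<Rightarrow> 'a::{finite,field_gcd} poly \<Rightarrow> complex" where
  "euler_factor k z P =
     (\<Prod>j=1..k. \<Prod>i=1..j. 1 - complex_of_real (pabs P) powr (-1 - z i - z j)) *
     ((1/2) * ((\<Prod>j=1..k. inverse (1 - complex_of_real (pabs P) powr (-1/2 - z j))) +
               (\<Prod>j=1..k. inverse (1 + complex_of_real (pabs P) powr (-1/2 - z j)))) +
        1 / complex_of_real (pabs P)) *
     inverse (1 + 1 / complex_of_real (pabs P))"

text \<open>The product over all monic irreducible polynomials, taken in order of increasing degree.\<close>
definition eulerA :: "'a::{finite,field_gcd} itself \<Rightarrow> nat \<Rightarrow> (nat \<Rightarrow> complex) \<Rightarrow> complex" where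
  "eulerA _ k z =
     prodinf (\<lambda>n. \<Prod>P\<in>{P \<in> mon_irr. degree P = n}. euler_factor k z (P :: 'a poly))"

definition Xfac :: "'a::{finite,field_gcd} itself \<Rightarrow> complex \<Rightarrow> complex" where
  "Xfac _ s = of_nat CARD('a) powr (s - 1/2)"

definition Gfun :: "'a::{finite,field_gcd} itself \<Rightarrow> nat \<Rightarrow> (nat \<Rightarrow> complex) \<Rightarrow> complex" where
  "Gfun T k z = eulerA T k z * (\<Prod>j=1..k. Xfac T (1/2 + z j) powr (-1/2)) *
     (\<Prod>j=1..k. \<Prod>i=1..j. zetaA T (1 + z i + z j))"

definition vandermonde :: "nat \<Rightarrow> (nat \<Rightarrow> complex) \<Rightarrow> complex" where
  "vandermonde k w = (\<Prod>j=1..k. \<Prod>i=1..<j. w j - w i)"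

primrec iter_circle_integral ::
    "real \<Rightarrow> nat \<Rightarrow> ((nat \<Rightarrow> complex) \<Rightarrow> complex) \<Rightarrow> complex" where
  "iter_circle_integral r 0 f = f (\<lambda>_. 0)"
| "iter_circle_integral r (Suc k) f =
     contour_integral (circlepath 0 r)
       (\<lambda>w. iter_circle_integral r k (\<lambda>z. f (z(Suc k := w))))"

definition Q_radius :: "'a::{finite,field_gcd} itself \<Rightarrow> nat \<Rightarrow> real \<Rightarrow> real \<Rightarrow> complex" where
  "Q_radius T k r x =
     (-1) ^ (k * (k - 1) div 2) * 2 ^ k / fact k * (1 / (2 * complex_of_real pi * \<i>) ^ k) *
     iter_circle_integral r k (\<lambda>z.
       Gfun T k z * (vandermonde k (\<lambda>j. (z j)\<^sup>2))\<^sup>2 / (\<Prod>j=1..k. z j ^ (2 * k - 1)) *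
       of_nat CARD('a) powr (complex_of_real x / 2 * (\<Sum>j=1..k. z j)))"

text \<open>
  ``Small circles'': the common value of the integrals over all circles of sufficiently small
  radius. The poles of the zeta factors at \<open>z i + z j = 0\<close> with \<open>i < j\<close> are cancelled by the squared
  Vandermonde product; at these points the integrand as written evaluates to \<open>0\<close>, which changes
  each of the iterated integrands at finitely many points only.
\<close>
definition Qpol :: "'a::{finite,field_gcd} itself \<Rightarrow> nat \<Rightarrow> real \<Rightarrow> complex" where
  "Qpol T k x = (THE c. \<forall>\<^sub>F r in at_right 0. Q_radius T k r x = c)"

end

theory Submission
  imports Defs "Jordan_Normal_Form.Determinant" "HOL-Real_Asymp.Real_Asymp"
begin

text \<open>
  The family \<open>\<I>\<^sub>g\<^sub>+\<^sub>1\<close> has exactly \<open>2 (q - 1) q\<^sup>2\<^sup>g = 2 q\<^sup>2\<^sup>g\<^sup>+\<^sup>1 / \<zeta>(2)\<close> elements: by uniqueness of partial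
  fractions an element of \<open>\<F>\<^sub>r\<close> amounts to a monic \<open>N\<close> of degree \<open>r\<close> together with one of \<open>\<phi>(N)\<close>
  choices of numerators, and \<open>\<phi>\<close> is summed through \<open>\<Sum> \<phi>(D) = |N|\<close> over \<open>D | N\<close>.

  On a small torus the integrand of \<open>Q\<^sub>k\<close> equals
  \<open>2\<^sup>-\<^sup>k g(z) \<Delta>(z\<^sup>2) \<Delta>(z) exp(c \<Sum> z\<^sub>j) / \<Prod> z\<^sub>j\<^sup>2\<^sup>k\<close> with \<open>c = x log q / 2\<close> and \<open>g\<close> analytic near \<open>0\<close>, so
  its iterated integral does not depend on the radius. On the torus of radius \<open>1 / x\<close> the factor
  \<open>g(z)\<close> is \<open>g(0) + o(1)\<close> and the rest of the integrand is bounded by the expected power of \<open>x\<close>. With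
  \<open>g(0)\<close> in place of \<open>g(z)\<close> the integral is \<open>k!\<close> times a determinant with entries
  \<open>1 / (2k - 1 - 2i - j)!\<close>, which is a Vandermonde determinant in the basis of falling factorials.

  Analyticity in several variables only enters as uniform approximability by polynomials on a
  polydisc: on monomials the iterated integral is visibly independent of the radius.
\<close>

subsection \<open>Monic irreducible factors\<close>

text \<open>Since \<open>Qpol\<close> is the eventual common value over small circles, independence
  of the radius has to be settled before the radius may be tied to \<open>x\<close>. The radius
  \<open>1 / x\<close> is natural because \<open>exp(c \<Sum> z)\<close> stays bounded there while
  shrinking tori force \<open>g(z)\<close> towards \<open>g(0)\<close>. Approximability of the Euler
  product near \<open>0\<close> rests on a cancellation: the terms of order two in the pair product,
  in the average over both signs and in the last factor add up to zero, so each factor is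
  \<open>1 + O(|P|^(-5/4))\<close> once the radius is \<open>1/12\<close>. The constants balance as
  follows, with \<open>n = k (k + 1) / 2\<close>. The \<open>n\<close> zeta factors contribute
  \<open>(log q)^(-n)\<close> to \<open>g(0)\<close>, the integral contributes
  \<open>c^n = (x log q / 2)^n\<close>, and the determinant contributes \<open>2^n\<close>. Hence
  \<open>Q_k(x)\<close> is asymptotic to \<open>A x^n\<close> times the product of the
  \<open>j! / (2j)!\<close>. The power \<open>2^n\<close> in the result comes from
  \<open>x = 2 g + 1\<close>, and the additional factor 2 from the two constant terms
  \<open>0\<close> and \<open>\<xi>\<close>.\<close>

lemma normalize_monic: "lead_coeff (p :: 'a::field_gcd poly) = 1 \<Longrightarrow> normalize p = p"
  by (simp add: normalize_poly_def flip: one_pCons)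

text \<open>\<open>prime\<close> includes being normalized, and a normalized nonzero polynomial over
  a field is monic. This gives access to \<open>prime_factors\<close> and the theory of
  \<open>multiplicity\<close>.\<close>

lemma mon_irr_iff_prime: "(P :: 'a::field_gcd poly) \<in> mon_irr \<longleftrightarrow> prime P"
proof
  assume "P \<in> mon_irr"
  thus "prime P"
    by (auto simp: mon_irr_def prime_def normalize_monic irreducible_imp_prime_elem)
next
  assume P: "prime P"
  hence "P \<noteq> 0" "normalize P = P" by (auto simp: normalize_prime)
  hence "unit_factor P = 1"
    by (metis mult_cancel_right1 unit_factor_mult_normalize)
  hence "unit_factor (lead_coeff P) = 1"
    by (simp add: unit_factor_poly_def one_pCons)
  moreover have "unit_factor (lead_coeff P) = lead_coeff P"
    using \<open>P \<noteq> 0\<close> by (intro is_unit_unit_factor) (auto simp: dvd_field_iff)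
  ultimately show "P \<in> mon_irr"
    using P by (simp add: mon_irr_def prime_elem_imp_irreducible)
qed

lemma mon_irr_degree_pos: "(P :: 'a::field_gcd poly) \<in> mon_irr \<Longrightarrow> degree P > 0"
  by (auto simp: mon_irr_def irreducible_def is_unit_iff_degree)

lemma mon_irr_nonzero: "(P :: 'a::field_gcd poly) \<in> mon_irr \<Longrightarrow> P \<noteq> 0"
  by (auto simp: mon_irr_def)

lemma mon_irr_divisors_eq:
  "(M :: 'a::field_gcd poly) \<noteq> 0 \<Longrightarrow> mon_irr_divisors M = prime_factors M"
  by (auto simp: mon_irr_divisors_def mon_irr_iff_prime in_prime_factors_iff)

lemma monic_factorization:
  assumes "lead_coeff (M :: 'a::field_gcd poly) = 1"
  shows "M = (\<Prod>P\<in>mon_irr_divisors M. P ^ multiplicity P M)"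
proof -
  have "M \<noteq> 0" using assms by auto
  have "(\<Prod>P\<in>prime_factors M. P ^ multiplicity P M) = normalize M"
    using \<open>M \<noteq> 0\<close> by (rule prod_prime_factors)
  thus ?thesis
    using normalize_monic[OF assms] mon_irr_divisors_eq[OF \<open>M \<noteq> 0\<close>] by simp
qed

lemma lead_coeff_prod_powers:
  assumes "\<And>P. P \<in> S \<Longrightarrow> (P :: 'a::field_gcd poly) \<in> mon_irr"
  shows "lead_coeff (\<Prod>P\<in>S. P ^ f P) = 1"
  using assms by (simp add: lead_coeff_prod lead_coeff_power mon_irr_def)

lemma degree_prod_powers:
  assumes "\<And>P. P \<in> S \<Longrightarrow> (P :: 'a::field_gcd poly) \<in> mon_irr"
  shows "degree (\<Prod>P\<in>S. P ^ f P) = (\<Sum>P\<in>S. f P * degree P)"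
  using assms mon_irr_nonzero by (subst degree_prod_eq_sum_degree) (auto simp: degree_power_eq)

subsection \<open>Counting polynomials\<close>

text \<open>Stated by coefficients so that \<open>n = 0\<close> gives \<open>{0}\<close>; with
  \<open>degree p < 0\<close> the set would be empty and the count \<open>q ^ 0\<close> would
  fail.\<close>

definition polys_below :: "nat \<Rightarrow> 'a::zero poly set" where
  "polys_below n = {p. \<forall>i\<ge>n. coeff p i = 0}"

lemma polys_below_iff_degree: "n > 0 \<Longrightarrow> p \<in> polys_below n \<longleftrightarrow> degree p < n"
proof
  assume "n > 0" "p \<in> polys_below n"
  thus "degree p < n"
    by (cases "p = 0") (auto simp: polys_below_def not_less[symmetric] dest: leading_coeff_neq_0)
qed (auto simp: polys_below_def coeff_eq_0)

lemma polys_below_Suc: "polys_below (Suc n) = (\<lambda>(a, p). pCons a p) ` (UNIV \<times> polys_below n)"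
proof (intro equalityI subsetI)
  fix p :: "'a poly" assume p: "p \<in> polys_below (Suc n)"
  obtain a p' where "p = pCons a p'" by (cases p)
  moreover have "coeff p' i = 0" if "i \<ge> n" for i
    using p that \<open>p = pCons a p'\<close> by (auto simp: polys_below_def dest: spec[of _ "Suc i"])
  ultimately show "p \<in> (\<lambda>(a, p). pCons a p) ` (UNIV \<times> polys_below n)"
    by (auto simp: polys_below_def)
qed (auto simp: polys_below_def coeff_pCons split: nat.splits)

lemma finite_card_polys_below:
  "finite (polys_below n :: 'a::{finite,zero} poly set) \<and> card (polys_below n :: 'a poly set) = CARD('a) ^ n"
proof (induction n)
  case 0
  have "polys_below 0 = {0 :: 'a poly}" by (auto simp: polys_below_def poly_eq_iff)
  thus ?case by simp
next
  case (Suc n)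
  have "inj_on (\<lambda>(a, p). pCons a p) (UNIV \<times> polys_below n :: ('a \<times> 'a poly) set)"
    by (auto simp: inj_on_def)
  thus ?case
    using Suc by (simp add: polys_below_Suc card_image card_cartesian_product)
qed

definition monics_deg :: "nat \<Rightarrow> 'a::field_gcd poly set" where
  "monics_deg n = {f. lead_coeff f = 1 \<and> degree f = n}"

lemma monics_deg_eq: "monics_deg n = (\<lambda>p. monom 1 n + p) ` polys_below n"
proof (intro equalityI subsetI)
  fix f :: "'a poly" assume "f \<in> monics_deg n"
  hence "f - monom 1 n \<in> polys_below n"
    by (auto simp: monics_deg_def polys_below_def coeff_eq_0 le_less)
  thus "f \<in> (\<lambda>p. monom 1 n + p) ` polys_below n"
    by (intro image_eqI[of _ _ "f - monom 1 n"]) auto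
next
  fix f :: "'a poly" assume "f \<in> (\<lambda>p. monom 1 n + p) ` polys_below n"
  then obtain p where p: "f = monom 1 n + p" "\<And>i. i \<ge> n \<Longrightarrow> coeff p i = 0"
    by (auto simp: polys_below_def)
  have c: "coeff f n = 1" using p by simp
  have "degree f \<le> n" using p by (intro degree_le) auto
  moreover have "degree f \<ge> n" using c by (intro le_degree) auto
  ultimately show "f \<in> monics_deg n" using c by (auto simp: monics_deg_def)
qed

lemma finite_monics_deg: "finite (monics_deg n :: 'a::{finite,field_gcd} poly set)"
  and card_monics_deg: "card (monics_deg n :: 'a::{finite,field_gcd} poly set) = CARD('a) ^ n"
  using finite_card_polys_below[of n, where ?'a = 'a] unfolding monics_deg_eq
  by (auto simp: card_image)

text \<open>Restriction to \<open>I\<close> is a bijection onto \<open>PiE I B\<close>. The default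
  \<open>d\<close> replaces \<open>undefined\<close>, because partial fraction data are total
  functions that are \<open>0\<close> off their support.\<close>

lemma card_functions_default:
  assumes "finite I" "\<And>x. x \<in> I \<Longrightarrow> finite (B x)"
  shows "finite {f. (\<forall>x\<in>I. f x \<in> B x) \<and> (\<forall>x. x \<notin> I \<longrightarrow> f x = d)}"
    and "card {f. (\<forall>x\<in>I. f x \<in> B x) \<and> (\<forall>x. x \<notin> I \<longrightarrow> f x = d)} = (\<Prod>x\<in>I. card (B x))"
proof -
  have "bij_betw (\<lambda>f. restrict f I) {f. (\<forall>x\<in>I. f x \<in> B x) \<and> (\<forall>x. x \<notin> I \<longrightarrow> f x = d)} (PiE I B)"
    by (rule bij_betwI[where g = "\<lambda>f x. if x \<in> I then f x else d"]) (auto simp: fun_eq_iff)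
  thus "finite {f. (\<forall>x\<in>I. f x \<in> B x) \<and> (\<forall>x. x \<notin> I \<longrightarrow> f x = d)}"
    "card {f. (\<forall>x\<in>I. f x \<in> B x) \<and> (\<forall>x. x \<notin> I \<longrightarrow> f x = d)} = (\<Prod>x\<in>I. card (B x))"
    using assms by (auto dest: bij_betw_finite bij_betw_same_card simp: finite_PiE card_PiE)
qed

subsection \<open>Partial fraction data\<close>

text \<open>\<open>A (P, i)\<close> is the numerator over \<open>P ^ (2 * i - 1)\<close>. One
  finitely supported function replaces the pair \<open>(M, A)\<close> in \<open>setF\<close>, whose
  \<open>A\<close> is arbitrary where the sum does not read it; uniqueness can then be equality of
  functions.\<close>

definition pf_data :: "('a::field_gcd poly \<times> nat \<Rightarrow> 'a poly) set" where
  "pf_data = {A. finite {x. A x \<noteq> 0} \<and>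
     (\<forall>P i. A (P, i) \<noteq> 0 \<longrightarrow> P \<in> mon_irr \<and> i \<ge> 1 \<and> degree (A (P, i)) < degree P)}"

definition pf_primes :: "('a::field_gcd poly \<times> nat \<Rightarrow> 'a poly) \<Rightarrow> 'a poly set" where
  "pf_primes A = {P. \<exists>i. A (P, i) \<noteq> 0}"

text \<open>The inserted \<open>0\<close> gives the maximum a value at primes that do not
  occur.\<close>

definition pf_level :: "('a::field_gcd poly \<times> nat \<Rightarrow> 'a poly) \<Rightarrow> 'a poly \<Rightarrow> nat" where
  "pf_level A P = Max (insert 0 {i. A (P, i) \<noteq> 0})"

text \<open>The denominator after lowering each exponent \<open>2 * i - 1\<close> to
  \<open>i\<close>. Its square is \<open>t(M)\<close> for the corresponding \<open>M\<close>, so its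
  degree is the index \<open>n\<close> of \<open>setF n\<close>.\<close>

definition pf_denom :: "('a::field_gcd poly \<times> nat \<Rightarrow> 'a poly) \<Rightarrow> 'a poly" where
  "pf_denom A = (\<Prod>P\<in>pf_primes A. P ^ pf_level A P)"

definition pf_value :: "('a::field_gcd poly \<times> nat \<Rightarrow> 'a poly) \<Rightarrow> 'a poly fract" where
  "pf_value A = (\<Sum>x | A x \<noteq> 0. Fraction_Field.Fract (A x) (fst x ^ (2 * snd x - 1)))"

lemma pf_data_finite_level: "A \<in> pf_data \<Longrightarrow> finite {i. A (P, i) \<noteq> 0}"
proof -
  assume "A \<in> pf_data"
  hence "finite {x. A x \<noteq> 0}" by (simp add: pf_data_def)
  hence "finite (snd ` {x. A x \<noteq> 0})" by blast
  thus ?thesis by (rule rev_finite_subset) force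
qed

lemma pf_primes_finite: "A \<in> pf_data \<Longrightarrow> finite (pf_primes A)"
proof -
  assume "A \<in> pf_data"
  hence "finite {x. A x \<noteq> 0}" by (simp add: pf_data_def)
  hence "finite (fst ` {x. A x \<noteq> 0})" by blast
  thus ?thesis by (rule rev_finite_subset) (force simp: pf_primes_def)
qed

lemma pf_primes_mon_irr: "A \<in> pf_data \<Longrightarrow> P \<in> pf_primes A \<Longrightarrow> P \<in> mon_irr"
  by (auto simp: pf_data_def pf_primes_def)

lemma pf_level_ge: "A \<in> pf_data \<Longrightarrow> A (P, i) \<noteq> 0 \<Longrightarrow> i \<le> pf_level A P"
  unfolding pf_level_def using pf_data_finite_level[of A P] by (intro Max_ge) auto

lemma pf_level_le_iff: "A \<in> pf_data \<Longrightarrow> pf_level A P \<le> n \<longleftrightarrow> (\<forall>i. A (P, i) \<noteq> 0 \<longrightarrow> i \<le> n)"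
  unfolding pf_level_def using pf_data_finite_level[of A P] by (subst Max_le_iff) auto

lemma pf_level_nonzero:
  assumes "A \<in> pf_data" "P \<in> pf_primes A"
  shows "A (P, pf_level A P) \<noteq> 0" "pf_level A P \<ge> 1"
proof -
  obtain i where i: "A (P, i) \<noteq> 0" using assms(2) by (auto simp: pf_primes_def)
  hence "i \<ge> 1" using assms(1) by (auto simp: pf_data_def)
  thus ge: "pf_level A P \<ge> 1" using pf_level_ge[OF assms(1) i] by simp
  have "Max (insert 0 {i. A (P, i) \<noteq> 0}) \<in> insert 0 {i. A (P, i) \<noteq> 0}"
    using pf_data_finite_level[OF assms(1)] by (intro Max_in) auto
  thus "A (P, pf_level A P) \<noteq> 0" using ge by (auto simp: pf_level_def)
qed

lemma pf_level_unique:
  assumes "A \<in> pf_data" "A (P, n) \<noteq> 0" "\<And>i. A (P, i) \<noteq> 0 \<Longrightarrow> i \<le> n"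
  shows "pf_level A P = n"
  using pf_level_ge[OF assms(1,2)] pf_level_le_iff[OF assms(1), of P n] assms(3) by (simp add: le_antisym)

text \<open>Compares multiplicities prime by prime. Divisibility becomes a separate condition at
  every position \<open>(P, i)\<close>, which makes the data with denominator dividing
  \<open>N\<close> a product set.\<close>

lemma pf_denom_dvd_iff:
  assumes "A \<in> pf_data" "N \<noteq> 0"
  shows "pf_denom A dvd N \<longleftrightarrow> (\<forall>P i. A (P, i) \<noteq> 0 \<longrightarrow> i \<le> multiplicity P N)"
proof -
  have prime: "prime P" if "P \<in> pf_primes A" for P
    using pf_primes_mon_irr[OF assms(1) that] by (simp add: mon_irr_iff_prime)
  have mult: "multiplicity P (pf_denom A) = (if P \<in> pf_primes A then pf_level A P else 0)" if "prime P" for P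
    unfolding pf_denom_def using pf_primes_finite[OF assms(1)] prime that
    by (intro multiplicity_prod_prime_powers) auto
  have "pf_denom A dvd N \<longleftrightarrow> (\<forall>P\<in>pf_primes A. pf_level A P \<le> multiplicity P N)"
  proof (intro iffI ballI)
    fix P assume "pf_denom A dvd N" "P \<in> pf_primes A"
    thus "pf_level A P \<le> multiplicity P N"
      using dvd_imp_multiplicity_le[of "pf_denom A" N P] mult[OF prime] assms(2) by simp
  next
    assume *: "\<forall>P\<in>pf_primes A. pf_level A P \<le> multiplicity P N"
    have "pf_denom A \<noteq> 0"
      using prime not_prime_0 pf_primes_finite[OF assms(1)] by (fastforce simp: pf_denom_def)
    thus "pf_denom A dvd N"
      using * mult by (intro multiplicity_le_imp_dvd) auto
  qed
  thus ?thesis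
    using pf_level_le_iff[OF assms(1)] by (auto simp: pf_primes_def)
qed

lemma pf_denom_monic: "A \<in> pf_data \<Longrightarrow> lead_coeff (pf_denom A) = 1"
  unfolding pf_denom_def using pf_primes_mon_irr by (intro lead_coeff_prod_powers)

lemma pf_denom_degree: "A \<in> pf_data \<Longrightarrow> degree (pf_denom A) = (\<Sum>P\<in>pf_primes A. pf_level A P * degree P)"
  unfolding pf_denom_def using pf_primes_mon_irr by (intro degree_prod_powers)

text \<open>Such data are free choices of a polynomial of degree below \<open>degree P\<close> at
  each position \<open>(P, i)\<close> with \<open>1 \<le> i \<le> multiplicity P N\<close>. The
  exponents of \<open>q\<close> add up to the degree of the factored \<open>N\<close>, so there are
  as many as residues modulo \<open>N\<close>.\<close>

lemma card_pf_data_dvd: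
  fixes N :: "'a::{finite,field_gcd} poly"
  assumes N: "lead_coeff N = 1"
  shows "finite {A \<in> pf_data. pf_denom A dvd N}"
    and "card {A \<in> pf_data. pf_denom A dvd N} = CARD('a) ^ degree N"
proof -
  have N0: "N \<noteq> 0" using N by auto
  define I where "I = (SIGMA P:mon_irr_divisors N. {1..multiplicity P N})"
  define B where "B x = (polys_below (degree (fst x)) :: 'a poly set)" for x :: "'a poly \<times> nat"
  have fin: "finite (mon_irr_divisors N)" by (simp add: mon_irr_divisors_eq N0)
  hence finI: "finite I" by (simp add: I_def)
  have in_I: "(P, i) \<in> I \<longleftrightarrow> P \<in> mon_irr \<and> 1 \<le> i \<and> i \<le> multiplicity P N" for P i
  proof -
    have "P dvd N" if "P \<in> mon_irr" "1 \<le> i" "i \<le> multiplicity P N"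
      using that N0 prime_multiplicity_gt_zero_iff[of P N] by (auto simp: mon_irr_iff_prime prime_def)
    thus ?thesis by (auto simp: I_def mon_irr_divisors_def)
  qed
  have eq: "{A \<in> pf_data. pf_denom A dvd N} = {A. (\<forall>x\<in>I. A x \<in> B x) \<and> (\<forall>x. x \<notin> I \<longrightarrow> A x = 0)}"
  proof (intro equalityI subsetI)
    fix A assume A: "A \<in> {A \<in> pf_data. pf_denom A dvd N}"
    hence le: "i \<le> multiplicity P N" if "A (P, i) \<noteq> 0" for P i
      using pf_denom_dvd_iff[of A N] N0 that by auto
    have "A x \<in> B x" if "x \<in> I" for x
    proof (cases "A x = 0")
      case True thus ?thesis by (auto simp: B_def polys_below_def)
    next
      case False
      hence "degree (A x) < degree (fst x)" using A by (cases x) (auto simp: pf_data_def)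
      thus ?thesis by (auto simp: B_def polys_below_def coeff_eq_0)
    qed
    moreover have "A x = 0" if "x \<notin> I" for x
    proof (rule ccontr)
      assume nz: "A x \<noteq> 0"
      obtain P i where x: "x = (P, i)" by (cases x)
      have "P \<in> mon_irr" "i \<ge> 1" using A nz by (auto simp: pf_data_def x)
      thus False using le[of P i] nz that by (simp add: x in_I)
    qed
    ultimately show "A \<in> {A. (\<forall>x\<in>I. A x \<in> B x) \<and> (\<forall>x. x \<notin> I \<longrightarrow> A x = 0)}" by blast
  next
    fix A assume A: "A \<in> {A. (\<forall>x\<in>I. A x \<in> B x) \<and> (\<forall>x. x \<notin> I \<longrightarrow> A x = 0)}"
    hence I: "(P, i) \<in> I" if "A (P, i) \<noteq> 0" for P i using that by blast
    have "finite {x. A x \<noteq> 0}" by (rule finite_subset[OF _ finI]) (use A in blast)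
    moreover have "degree (A (P, i)) < degree P" if "A (P, i) \<noteq> 0" for P i
    proof -
      have "P \<in> mon_irr" using I[OF that] in_I by blast
      moreover have "A (P, i) \<in> B (P, i)" using I[OF that] A by blast
      ultimately show ?thesis
        using mon_irr_degree_pos[of P] by (simp add: B_def polys_below_iff_degree)
    qed
    ultimately have "A \<in> pf_data" using I in_I by (auto simp: pf_data_def)
    thus "A \<in> {A \<in> pf_data. pf_denom A dvd N}"
      using I in_I N0 by (auto simp: pf_denom_dvd_iff)
  qed
  have finB: "finite (B x)" and cardB: "card (B x) = CARD('a) ^ degree (fst x)" for x
    using finite_card_polys_below[where ?'a = 'a] by (auto simp: B_def)
  show "finite {A \<in> pf_data. pf_denom A dvd N}"
    unfolding eq by (rule card_functions_default) (use finI finB in auto)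
  have "card {A \<in> pf_data. pf_denom A dvd N} = (\<Prod>x\<in>I. CARD('a) ^ degree (fst x))"
    unfolding eq using finI finB by (subst card_functions_default) (auto simp: cardB)
  also have "\<dots> = CARD('a) ^ (\<Sum>x\<in>I. degree (fst x))"
    by (simp add: power_sum)
  also have "(\<Sum>x\<in>I. degree (fst x)) = (\<Sum>P\<in>mon_irr_divisors N. multiplicity P N * degree P)"
    unfolding I_def using fin
      sum.Sigma[of "mon_irr_divisors N" "\<lambda>P. {1..multiplicity P N}" "\<lambda>P _. degree P"]
    by (simp add: case_prod_beta)
  also have "\<dots> = degree (\<Prod>P\<in>mon_irr_divisors N. P ^ multiplicity P N)"
    by (rule degree_prod_powers[symmetric]) (auto simp: mon_irr_divisors_def)
  also have "\<dots> = degree N"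
    using monic_factorization[OF N] by simp
  finally show "card {A \<in> pf_data. pf_denom A dvd N} = CARD('a) ^ degree N" .
qed

section \<open>Counting partial fraction data by the degree of the denominator\<close>

definition pf_weight :: "nat \<Rightarrow> ('a::field_gcd poly \<times> nat \<Rightarrow> 'a poly) set" where
  "pf_weight d = {A \<in> pf_data. degree (pf_denom A) = d}"

lemma finite_pf_weight: "finite (pf_weight d :: ('a::{finite,field_gcd} poly \<times> nat \<Rightarrow> 'a poly) set)"
proof (rule finite_subset)
  show "pf_weight d \<subseteq> (\<Union>N\<in>monics_deg d. {A \<in> pf_data. pf_denom A dvd (N :: 'a poly)})"
    by (auto simp: pf_weight_def monics_deg_def intro!: bexI[of _ "pf_denom _"] pf_denom_monic)
  show "finite (\<Union>N\<in>monics_deg d. {A \<in> pf_data. pf_denom A dvd (N :: 'a poly)})"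
    using card_pf_data_dvd(1) by (intro finite_UN_I finite_monics_deg) (auto simp: monics_deg_def)
qed

lemma card_monic_multiples:
  fixes D :: "'a::{finite,field_gcd} poly"
  assumes D: "lead_coeff D = 1" "degree D \<le> r"
  shows "card {N \<in> monics_deg r. D dvd N} = CARD('a) ^ (r - degree D)"
proof -
  have D0: "D \<noteq> 0" using D by auto
  have "{N \<in> monics_deg r. D dvd N} = (\<lambda>E. D * E) ` monics_deg (r - degree D)"
  proof (intro equalityI subsetI)
    fix N assume N: "N \<in> {N \<in> monics_deg r. D dvd N}"
    then obtain E where E: "N = D * E" by auto
    have "E \<noteq> 0" using N E by (auto simp: monics_deg_def)
    thus "N \<in> (\<lambda>E. D * E) ` monics_deg (r - degree D)"
      using N D D0 unfolding E
      by (intro imageI) (auto simp: monics_deg_def degree_mult_eq coeff_mult_degree_sum)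
  next
    fix N assume "N \<in> (\<lambda>E. D * E) ` monics_deg (r - degree D)"
    then obtain E where "E \<in> monics_deg (r - degree D)" "N = D * E" by blast
    hence E: "N = D * E" "lead_coeff E = 1" "degree E = r - degree D"
      unfolding monics_deg_def by blast+
    have "E \<noteq> 0" using E by auto
    hence "degree N = r" using D(2) D0 E by (simp add: degree_mult_eq)
    moreover have "lead_coeff N = 1" unfolding E(1) lead_coeff_mult D(1) E(2) by simp
    moreover have "D dvd N" unfolding E(1) by simp
    ultimately show "N \<in> {N \<in> monics_deg r. D dvd N}"
      unfolding monics_deg_def by blast
  qed
  moreover have "inj_on (\<lambda>E. D * E) X" for X using D0 by (auto simp: inj_on_def)
  ultimately show ?thesis by (simp add: card_image card_monics_deg)
qed

text \<open>
  Both sides count the pairs \<open>(A, N)\<close> with \<open>N\<close> monic of degree \<open>r\<close> divisible by the reduced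
  denominator of \<open>A\<close>; this is \<open>\<Sum> \<phi>(D) = |N|\<close> over the divisors \<open>D\<close> of \<open>N\<close>, summed over all \<open>N\<close>.
\<close>
lemma sum_card_pf_weight:
  "(\<Sum>d\<le>r. card (pf_weight d :: ('a::{finite,field_gcd} poly \<times> nat \<Rightarrow> 'a poly) set) * CARD('a) ^ (r - d)) =
     CARD('a) ^ (2 * r)"
proof -
  let ?W = "pf_weight :: nat \<Rightarrow> ('a poly \<times> nat \<Rightarrow> 'a poly) set"
  define U where "U = (\<Union>d\<le>r. ?W d)"
  have finU: "finite U" by (auto simp: U_def finite_pf_weight)
  have "(\<Sum>d\<le>r. card (?W d) * CARD('a) ^ (r - d)) = (\<Sum>d\<le>r. \<Sum>A\<in>?W d. card {N \<in> monics_deg r. pf_denom A dvd N})"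
  proof (rule sum.cong[OF refl])
    fix d assume d: "d \<in> {..r}"
    have "(\<Sum>A\<in>?W d. card {N \<in> monics_deg r. pf_denom A dvd N}) = (\<Sum>A\<in>?W d. CARD('a) ^ (r - d))"
    proof (rule sum.cong[OF refl])
      fix A assume "A \<in> ?W d"
      thus "card {N \<in> monics_deg r. pf_denom A dvd N} = CARD('a) ^ (r - d)"
        using card_monic_multiples[OF pf_denom_monic, of A r] d by (auto simp: pf_weight_def)
    qed
    thus "card (?W d) * CARD('a) ^ (r - d) = (\<Sum>A\<in>?W d. card {N \<in> monics_deg r. pf_denom A dvd N})"
      by simp
  qed
  also have "\<dots> = (\<Sum>A\<in>U. card {N \<in> monics_deg r. pf_denom A dvd N})"
    unfolding U_def by (rule sum.UNION_disjoint[symmetric]) (auto simp: finite_pf_weight, auto simp: pf_weight_def)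
  also have "\<dots> = (\<Sum>A\<in>U. \<Sum>N\<in>monics_deg r. if pf_denom A dvd N then 1 else 0)"
    using finite_monics_deg[of r, where ?'a = 'a] by (simp add: sum.If_cases Int_def)
  also have "\<dots> = (\<Sum>N\<in>monics_deg r. \<Sum>A\<in>U. if pf_denom A dvd N then 1 else 0)"
    by (rule sum.swap)
  also have "\<dots> = (\<Sum>N\<in>(monics_deg r :: 'a poly set). CARD('a) ^ r)"
  proof (rule sum.cong[OF refl])
    fix N :: "'a poly" assume N: "N \<in> monics_deg r"
    hence N1: "lead_coeff N = 1" "degree N = r" "N \<noteq> 0" by (auto simp: monics_deg_def)
    have "(\<Sum>A\<in>U. if pf_denom A dvd N then 1 else 0) = card {A \<in> U. pf_denom A dvd N}"
      using finU by (simp add: sum.If_cases Int_def)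
    also have "{A \<in> U. pf_denom A dvd N} = {A \<in> pf_data. pf_denom A dvd N}"
      using N1 dvd_imp_degree_le[of _ N] by (auto simp: U_def pf_weight_def)
    also have "card \<dots> = CARD('a) ^ r"
      using card_pf_data_dvd(2)[OF N1(1)] N1(2) by simp
    finally show "(\<Sum>A\<in>U. if pf_denom A dvd N then 1 else 0) = CARD('a) ^ r" .
  qed
  also have "\<dots> = CARD('a) ^ (2 * r)"
    by (simp add: card_monics_deg mult_2 power_add)
  finally show ?thesis .
qed


subsection \<open>Uniqueness of the partial fraction expansion\<close>

lemma Fract_mult_to_fract:
  "b \<noteq> 0 \<Longrightarrow> Fraction_Field.Fract a b * to_fract (b * c) = to_fract (a * c)"
  by (simp add: to_fract_def eq_fract)

text \<open>At a pole \<open>P\<close> of top level \<open>L\<close>, multiply by a common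
  denominator containing exactly \<open>P ^ (2 * L - 1)\<close>. Every term except the top one keeps
  a factor \<open>P\<close>, so \<open>P\<close> divides the top numerator, which is nonzero of
  smaller degree.\<close>

lemma partial_fractions_eq_poly:
  assumes C: "C \<in> pf_data" and eq: "pf_value C = to_fract F"
  shows "C = (\<lambda>_. 0)"
proof (rule ccontr)
  assume "C \<noteq> (\<lambda>_. 0)"
  then obtain P where P: "P \<in> pf_primes C" by (force simp: pf_primes_def)
  define L where "L = pf_level C P"
  have L: "C (P, L) \<noteq> 0" "L \<ge> 1" using pf_level_nonzero[OF C P] by (auto simp: L_def)
  have P_prime: "prime P" using pf_primes_mon_irr[OF C P] by (simp add: mon_irr_iff_prime)
  define X where "X = {x. C x \<noteq> 0}"
  define den where "den x = fst x ^ (2 * snd x - 1)" for x :: "'a poly \<times> nat"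
  \<comment> \<open>The plain product of the denominators away from \<open>P\<close>: what counts is
    that it is a multiple of each of them and prime to \<open>P\<close>.\<close>
  define D where "D = (\<Prod>x\<in>{x \<in> X. fst x \<noteq> P}. den x)"
  define E where "E = D * P ^ (2 * L - 1)"
  have finX: "finite X" using C by (simp add: X_def pf_data_def)
  have prime: "prime (fst x)" if "x \<in> X" for x
    using that C by (cases x) (auto simp: X_def pf_data_def mon_irr_iff_prime)
  have den0: "den x \<noteq> 0" if "x \<in> X" for x
    using prime[OF that] by (auto simp: den_def)
  have "\<exists>c. E = den x * c \<and> (x \<noteq> (P, L) \<longrightarrow> P dvd c)" if x: "x \<in> X" for x
  proof (cases "fst x = P")
    case True
    define i where "i = snd x"
    have xi: "x = (P, i)" using True by (simp add: i_def prod_eq_iff)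
    have i: "i \<ge> 1" "i \<le> L"
      using x C pf_level_ge[OF C, of P i] by (auto simp: X_def xi pf_data_def L_def)
    \<comment> \<open>\<open>2 * L - 1 = (2 * i - 1) + 2 * (L - i)\<close>; the surplus power is
      trivial only for the top term \<open>i = L\<close>.\<close>
    have "P ^ (2 * L - 1) = P ^ (2 * i - 1) * P ^ (2 * (L - i))"
      unfolding power_add[symmetric] using i by (intro arg_cong[where f = "(^) P"]) auto
    moreover have "P dvd P ^ (2 * (L - i))" if "x \<noteq> (P, L)"
      using that i xi by (intro dvd_power) auto
    ultimately show ?thesis
      by (intro exI[of _ "D * P ^ (2 * (L - i))"]) (auto simp: E_def den_def xi mult_ac)
  next
    case False
    have "den x dvd D"
      unfolding D_def using finX x False by (intro dvd_prodI) auto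
    then obtain c where "D = den x * c" by auto
    thus ?thesis using L(2)
      by (intro exI[of _ "c * P ^ (2 * L - 1)"]) (auto simp: E_def mult_ac intro!: dvd_mult dvd_power)
  qed
  then obtain c where c: "\<And>x. x \<in> X \<Longrightarrow> E = den x * c x" "\<And>x. x \<in> X \<Longrightarrow> x \<noteq> (P, L) \<Longrightarrow> P dvd c x"
    by metis
  have x0: "(P, L) \<in> X" using L by (simp add: X_def)
  have c0: "c (P, L) = D"
  proof -
    have "den (P, L) * c (P, L) = den (P, L) * D"
      using c(1)[OF x0] by (simp only: E_def den_def fst_conv snd_conv mult.commute)
    thus ?thesis using den0[OF x0] by (simp only: mult_cancel_left) blast
  qed
  have "to_fract (F * E) = (\<Sum>x\<in>X. Fraction_Field.Fract (C x) (den x) * to_fract E)"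
    unfolding sum_distrib_right[symmetric] to_fract_mult eq[symmetric] pf_value_def X_def den_def ..
  also have "\<dots> = (\<Sum>x\<in>X. to_fract (C x * c x))"
  proof (rule sum.cong[OF refl])
    fix x assume x: "x \<in> X"
    show "Fraction_Field.Fract (C x) (den x) * to_fract E = to_fract (C x * c x)"
      unfolding c(1)[OF x] by (rule Fract_mult_to_fract[OF den0[OF x]])
  qed
  also have "\<dots> = to_fract (\<Sum>x\<in>X. C x * c x)" by simp
  finally have "F * E = (\<Sum>x\<in>X. C x * c x)" by (simp only: to_fract_eq_iff)
  also have "\<dots> = C (P, L) * D + (\<Sum>x\<in>X - {(P, L)}. C x * c x)"
    using finX x0 by (simp add: sum.remove c0)
  finally have "C (P, L) * D = F * E - (\<Sum>x\<in>X - {(P, L)}. C x * c x)" by simp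
  moreover have "P dvd F * E"
    using L(2) by (auto simp: E_def intro!: dvd_mult dvd_power)
  moreover have "P dvd (\<Sum>x\<in>X - {(P, L)}. C x * c x)"
    using c(2) by (intro dvd_sum dvd_mult) auto
  ultimately have "P dvd C (P, L) * D" by simp
  moreover have "\<not> P dvd D"
  proof
    assume "P dvd D"
    then obtain x where x: "x \<in> X" "fst x \<noteq> P" "P dvd den x"
      using finX P_prime by (auto simp: D_def prime_dvd_prod_iff)
    have "P dvd fst x"
      using x(3) P_prime prime_dvd_power by (auto simp: den_def)
    thus False using primes_dvd_imp_eq[OF P_prime prime[OF x(1)]] x(2) by simp
  qed
  ultimately have "P dvd C (P, L)"
    using P_prime by (simp add: prime_dvd_mult_iff)
  hence "degree P \<le> degree (C (P, L))" using L(1) by (intro dvd_imp_degree_le)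
  moreover have "degree (C (P, L)) < degree P" using L(1) C by (auto simp: pf_data_def)
  ultimately show False by simp
qed

lemma pf_data_diff:
  assumes "A \<in> pf_data" "A' \<in> pf_data"
  shows "(\<lambda>x. A x - A' x) \<in> pf_data" "pf_value (\<lambda>x. A x - A' x) = pf_value A - pf_value A'"
proof -
  let ?X = "{x. A x \<noteq> 0} \<union> {x. A' x \<noteq> 0}"
  have fin: "finite ?X" using assms by (auto simp: pf_data_def)
  have sub: "{x. A x - A' x \<noteq> 0} \<subseteq> ?X" by auto
  have deg: "degree (A (P, i) - A' (P, i)) < degree P"
    if nz: "A (P, i) \<noteq> 0 \<or> A' (P, i) \<noteq> 0" for P i
  proof -
    have P: "degree P > 0" using nz assms mon_irr_degree_pos by (auto simp: pf_data_def)
    have "degree (A (P, i)) < degree P"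
      using assms(1) P by (cases "A (P, i) = 0") (auto simp: pf_data_def)
    moreover have "degree (A' (P, i)) < degree P"
      using assms(2) P by (cases "A' (P, i) = 0") (auto simp: pf_data_def)
    ultimately show ?thesis by (rule degree_diff_less)
  qed
  have nz: "A (P, i) \<noteq> 0 \<or> A' (P, i) \<noteq> 0" if "A (P, i) - A' (P, i) \<noteq> 0" for P i
    using that by auto
  show "(\<lambda>x. A x - A' x) \<in> pf_data"
    unfolding pf_data_def mem_Collect_eq
  proof (intro conjI allI impI)
    show "finite {x. A x - A' x \<noteq> 0}" by (rule finite_subset[OF sub fin])
    fix P i assume "A (P, i) - A' (P, i) \<noteq> 0"
    note nz[OF this]
    thus "P \<in> mon_irr" "1 \<le> i" "degree (A (P, i) - A' (P, i)) < degree P"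
      using assms deg by (auto simp: pf_data_def)
  qed
  \<comment> \<open>\<open>A\<close>, \<open>A'\<close> and their difference have different
    supports; padding with zero terms puts all three sums on the common set
    \<open>?X\<close>.\<close>
  have ext: "pf_value B = (\<Sum>x\<in>?X. Fraction_Field.Fract (B x) (fst x ^ (2 * snd x - 1)))"
    if "{x. B x \<noteq> 0} \<subseteq> ?X" for B
    unfolding pf_value_def using fin that
    by (intro sum.mono_neutral_left) (auto simp: Fract_conv_to_fract)
  have "pf_value (\<lambda>x. A x - A' x) = (\<Sum>x\<in>?X. Fraction_Field.Fract (A x - A' x) (fst x ^ (2 * snd x - 1)))"
    by (rule ext[OF sub])
  also have "\<dots> = (\<Sum>x\<in>?X. Fraction_Field.Fract (A x) (fst x ^ (2 * snd x - 1))) -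
      (\<Sum>x\<in>?X. Fraction_Field.Fract (A' x) (fst x ^ (2 * snd x - 1)))"
    by (simp add: Fract_conv_to_fract diff_divide_distrib sum_subtractf)
  also have "\<dots> = pf_value A - pf_value A'"
    using ext[of A] ext[of A'] by simp
  finally show "pf_value (\<lambda>x. A x - A' x) = pf_value A - pf_value A'" .
qed

text \<open>The polynomial summand is present because members of \<open>setI\<close> have the form
  \<open>u + F\<close>. Subtraction reduces the claim to data whose value is a polynomial.\<close>

lemma pf_value_plus_poly_inj:
  assumes "A \<in> pf_data" "A' \<in> pf_data" "pf_value A + to_fract F = pf_value A' + to_fract F'"
  shows "A = A'" "F = F'"
proof -
  have "pf_value (\<lambda>x. A x - A' x) = to_fract (F' - F)"
    using assms(3) by (simp add: pf_data_diff(2)[OF assms(1,2)] algebra_simps)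
  hence "(\<lambda>x. A x - A' x) = (\<lambda>_. 0)"
    by (rule partial_fractions_eq_poly[OF pf_data_diff(1)[OF assms(1,2)]])
  thus "A = A'" by (simp add: fun_eq_iff)
  thus "F = F'" using assms(3) by simp
qed

subsection \<open>The families as sets of values\<close>

lemma pf_value_eq_levels:
  assumes "A \<in> pf_data"
  shows "pf_value A = (\<Sum>P\<in>pf_primes A. \<Sum>i=1..pf_level A P. Fraction_Field.Fract (A (P, i)) (P ^ (2 * i - 1)))"
proof -
  have "(\<Sum>P\<in>pf_primes A. \<Sum>i=1..pf_level A P. Fraction_Field.Fract (A (P, i)) (P ^ (2 * i - 1))) =
      (\<Sum>x\<in>(SIGMA P:pf_primes A. {1..pf_level A P}). Fraction_Field.Fract (A x) (fst x ^ (2 * snd x - 1)))"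
    using pf_primes_finite[OF assms] by (subst sum.Sigma) (auto simp: case_prod_beta)
  also have "\<dots> = pf_value A"
    unfolding pf_value_def
  proof (rule sum.mono_neutral_right)
    show "finite (SIGMA P:pf_primes A. {1..pf_level A P})"
      using pf_primes_finite[OF assms] by auto
    show "{x. A x \<noteq> 0} \<subseteq> (SIGMA P:pf_primes A. {1..pf_level A P})"
      using assms pf_level_ge[OF assms] by (force simp: pf_primes_def pf_data_def)
  qed (auto simp: Fract_conv_to_fract)
  finally show ?thesis by simp
qed

text \<open>Makes the separate convention for \<open>setF 0\<close> a case of the general
  parametrization: each prime that occurs adds at least \<open>degree P > 0\<close> to the
  weight.\<close>

lemma pf_weight_0: "pf_weight 0 = {\<lambda>_. 0 :: 'a::field_gcd poly}"
proof -
  have "A = (\<lambda>_. 0)" if "A \<in> pf_weight 0" for A :: "'a poly \<times> nat \<Rightarrow> 'a poly"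
  proof -
    have A: "A \<in> pf_data" and 0: "(\<Sum>P\<in>pf_primes A. pf_level A P * degree P) = 0"
      using that by (auto simp: pf_weight_def pf_denom_degree)
    have "pf_level A P * degree P \<noteq> 0" if "P \<in> pf_primes A" for P
      using pf_level_nonzero(2)[OF A that] mon_irr_degree_pos[OF pf_primes_mon_irr[OF A that]] by simp
    moreover have "pf_level A P * degree P = 0" if "P \<in> pf_primes A" for P
      using 0 that pf_primes_finite[OF A] by simp
    ultimately have "pf_primes A = {}" by blast
    thus ?thesis by (auto simp: pf_primes_def fun_eq_iff)
  qed
  moreover have "(\<lambda>_. 0) \<in> (pf_weight 0 :: ('a poly \<times> nat \<Rightarrow> 'a poly) set)"
    by (simp add: pf_weight_def pf_data_def pf_denom_def pf_primes_def)
  ultimately show ?thesis by blast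
qed

text \<open>Since \<open>v_P(M) = 2 l_P - 1\<close>, \<open>t(M)\<close> is the product of the
  \<open>P^(2 l_P)\<close> and has twice the degree of \<open>pf_denom\<close>. The levels determine
  \<open>M\<close>, so the quantifier over \<open>M\<close> disappears.\<close>

lemma setF_eq: "setF n = pf_value ` (pf_weight n :: ('a::field_gcd poly \<times> nat \<Rightarrow> 'a poly) set)"
proof (cases "n = 0")
  case True
  thus ?thesis by (simp add: setF_def pf_weight_0 pf_value_def)
next
  case False
  show ?thesis
  proof (intro equalityI subsetI)
    fix u :: "'a poly fract" assume "u \<in> setF n"
    hence "\<exists>M A. u = (\<Sum>P\<in>mon_irr_divisors M. \<Sum>i=1..ell M P. Fraction_Field.Fract (A P i) (P ^ (2 * i - 1))) \<and>
        M \<in> setBn n \<and> (\<forall>P\<in>mon_irr_divisors M. (\<forall>i\<in>{1..ell M P}. degree (A P i) < degree P) \<and> A P (ell M P) \<noteq> 0)"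
      using False by (simp add: setF_def)
    then obtain M A where M: "M \<in> setBn n"
      and A: "\<And>P i. P \<in> mon_irr_divisors M \<Longrightarrow> i \<in> {1..ell M P} \<Longrightarrow> degree (A P i) < degree P"
        "\<And>P. P \<in> mon_irr_divisors M \<Longrightarrow> A P (ell M P) \<noteq> 0"
      and u: "u = (\<Sum>P\<in>mon_irr_divisors M. \<Sum>i=1..ell M P. Fraction_Field.Fract (A P i) (P ^ (2 * i - 1)))"
      by blast
    have lcM: "lead_coeff M = 1" and M0: "M \<noteq> 0" using M by (auto simp: setBn_def setB_def)
    have fin: "finite (mon_irr_divisors M)" by (simp add: mon_irr_divisors_eq M0)
    \<comment> \<open>Exponents in \<open>setB\<close> are odd at the primes dividing
      \<open>M\<close>, so the halving in \<open>ell\<close> is exact.\<close>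
    have two_ell: "2 * ell M P = multiplicity P M + 1" if "P \<in> mon_irr_divisors M" for P
    proof -
      have "multiplicity P M > 0"
        using that M0 prime_multiplicity_gt_zero_iff[of P M]
        by (auto simp: mon_irr_divisors_def mon_irr_iff_prime prime_def)
      moreover have "P \<in> mon_irr" using that by (simp add: mon_irr_divisors_def)
      ultimately have "odd (multiplicity P M)" using M by (auto simp: setBn_def setB_def)
      thus ?thesis by (simp add: ell_def)
    qed
    \<comment> \<open>Numerators are reset to \<open>0\<close> at the positions that the sum never
      reads, as \<open>pf_data\<close> demands.\<close>
    define B where "B x = (if fst x \<in> mon_irr_divisors M \<and> snd x \<in> {1..ell M (fst x)}
        then A (fst x) (snd x) else 0)" for x
    have B: "B \<in> pf_data"
    proof -
      have "finite {x. B x \<noteq> 0}"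
        by (rule finite_subset[of _ "SIGMA P:mon_irr_divisors M. {1..ell M P}"])
           (use fin in \<open>auto simp: B_def split: if_splits\<close>)
      thus ?thesis
        using A(1) by (auto simp: pf_data_def B_def mon_irr_divisors_def split: if_splits)
    qed
    have ell1: "ell M P \<ge> 1" if "P \<in> mon_irr_divisors M" for P
      using two_ell[OF that] by linarith
    have primes: "pf_primes B = mon_irr_divisors M"
      using A(2) ell1 by (fastforce simp: pf_primes_def B_def split: if_splits)
    have level: "pf_level B P = ell M P" if "P \<in> mon_irr_divisors M" for P
      using A(2) ell1 that by (intro pf_level_unique[OF B]) (auto simp: B_def split: if_splits)
    have "2 * degree (pf_denom B) = (\<Sum>P\<in>mon_irr_divisors M. 2 * ell M P * degree P)"
      unfolding pf_denom_degree[OF B] primes sum_distrib_left by (intro sum.cong) (auto simp: level)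
    also have "\<dots> = (\<Sum>P\<in>mon_irr_divisors M. multiplicity P M * degree P) + (\<Sum>P\<in>mon_irr_divisors M. 1 * degree P)"
      unfolding sum.distrib[symmetric] by (intro sum.cong) (auto simp: two_ell)
    also have "\<dots> = degree (\<Prod>P\<in>mon_irr_divisors M. P ^ multiplicity P M) + degree (\<Prod>P\<in>mon_irr_divisors M. P ^ 1)"
      by (intro arg_cong2[where f = "(+)"] degree_prod_powers[symmetric]) (auto simp: mon_irr_divisors_def)
    also have "\<dots> = degree (tpoly M)"
    proof -
      have "\<Prod>(mon_irr_divisors M) \<noteq> 0"
        using fin mon_irr_nonzero by (auto simp: mon_irr_divisors_def)
      thus ?thesis
        using monic_factorization[OF lcM] M0 by (simp add: tpoly_def degree_mult_eq)
    qed
    also have "\<dots> = 2 * n" using M by (simp add: setBn_def)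
    finally have "B \<in> pf_weight n" using B by (simp add: pf_weight_def)
    moreover have "u = pf_value B"
      unfolding pf_value_eq_levels[OF B] primes u
      by (intro sum.cong refl) (auto simp: level B_def)
    ultimately show "u \<in> pf_value ` pf_weight n" by blast
  next
    fix u :: "'a poly fract" assume "u \<in> pf_value ` pf_weight n"
    then obtain A where A: "A \<in> pf_data" "degree (pf_denom A) = n" and u: "u = pf_value A"
      by (auto simp: pf_weight_def)
    note irr = pf_primes_mon_irr[OF A(1)] and fin = pf_primes_finite[OF A(1)]
    \<comment> \<open>The member of \<open>setB\<close> whose \<open>ell\<close> at every pole is
      the level of \<open>A\<close>.\<close>
    define M where "M = (\<Prod>P\<in>pf_primes A. P ^ (2 * pf_level A P - 1))"
    have lcM: "lead_coeff M = 1"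
      unfolding M_def by (rule lead_coeff_prod_powers[OF irr])
    hence M0: "M \<noteq> 0" by auto
    have mult: "multiplicity P M = (if P \<in> pf_primes A then 2 * pf_level A P - 1 else 0)" if "prime P" for P
      unfolding M_def using fin irr that
      by (intro multiplicity_prod_prime_powers) (auto simp: mon_irr_iff_prime)
    have divs: "mon_irr_divisors M = pf_primes A"
    proof (intro equalityI subsetI)
      fix P assume P: "P \<in> mon_irr_divisors M"
      hence "prime P" "multiplicity P M > 0"
        using M0 prime_multiplicity_gt_zero_iff[of P M]
        by (auto simp: mon_irr_divisors_def mon_irr_iff_prime prime_def)
      thus "P \<in> pf_primes A" using mult[of P] by (auto split: if_splits)
    next
      fix P assume P: "P \<in> pf_primes A"
      hence "prime P" using irr by (simp add: mon_irr_iff_prime)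
      moreover have "multiplicity P M > 0"
        using mult[OF calculation] P pf_level_nonzero(2)[OF A(1) P] by simp
      ultimately show "P \<in> mon_irr_divisors M"
        using M0 prime_multiplicity_gt_zero_iff[of P M]
        by (auto simp: mon_irr_divisors_def mon_irr_iff_prime prime_def)
    qed
    have ell: "ell M P = pf_level A P" if "P \<in> pf_primes A" for P
      using mult[of P] irr[OF that] that pf_level_nonzero(2)[OF A(1) that]
      by (simp add: ell_def mon_irr_iff_prime)
    have "tpoly M = (\<Prod>P\<in>pf_primes A. P ^ (2 * pf_level A P - 1) * P)"
      by (simp add: tpoly_def divs prod.distrib) (simp add: M_def)
    also have "\<dots> = (\<Prod>P\<in>pf_primes A. P ^ (2 * pf_level A P))"
    proof (rule prod.cong[OF refl])
      fix P assume "P \<in> pf_primes A"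
      hence "2 * pf_level A P = Suc (2 * pf_level A P - 1)" using pf_level_nonzero(2)[OF A(1)] by fastforce
      thus "P ^ (2 * pf_level A P - 1) * P = P ^ (2 * pf_level A P)" by (metis power_Suc2)
    qed
    finally have "degree (tpoly M) = (\<Sum>P\<in>pf_primes A. 2 * pf_level A P * degree P)"
      using degree_prod_powers[OF irr] by simp
    also have "\<dots> = 2 * n"
      using A(2) unfolding pf_denom_degree[OF A(1)] by (simp add: sum_distrib_left[symmetric] mult.assoc)
    finally have "degree (tpoly M) = 2 * n" .
    moreover have "M \<in> setB"
      using lcM mult pf_level_nonzero(2)[OF A(1)] by (auto simp: setB_def mon_irr_iff_prime)
    ultimately have M: "M \<in> setBn n" by (simp add: setBn_def)
    have deg: "degree (A (P, i)) < degree P" if "P \<in> pf_primes A" for P i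
      using A(1) mon_irr_degree_pos[OF irr[OF that]] by (cases "A (P, i) = 0") (auto simp: pf_data_def)
    have "u = (\<Sum>P\<in>mon_irr_divisors M. \<Sum>i=1..ell M P. Fraction_Field.Fract (A (P, i)) (P ^ (2 * i - 1)))"
      unfolding u pf_value_eq_levels[OF A(1)] divs by (intro sum.cong) (auto simp: ell)
    moreover have "\<forall>P\<in>mon_irr_divisors M. (\<forall>i\<in>{1..ell M P}. degree (A (P, i)) < degree P) \<and> A (P, ell M P) \<noteq> 0"
      using deg pf_level_nonzero(1)[OF A(1)] by (auto simp: divs ell)
    ultimately have "\<exists>M A. u = (\<Sum>P\<in>mon_irr_divisors M. \<Sum>i=1..ell M P. Fraction_Field.Fract (A P i) (P ^ (2 * i - 1))) \<and>
        M \<in> setBn n \<and> (\<forall>P\<in>mon_irr_divisors M. (\<forall>i\<in>{1..ell M P}. degree (A P i) < degree P) \<and> A P (ell M P) \<noteq> 0)"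
      using M by (intro exI[of _ M] exI[of _ "\<lambda>P i. A (P, i)"]) blast
    thus "u \<in> setF n" using False by (simp add: setF_def)
  qed
qed

section \<open>Cardinalities of the polynomial parts and of the whole family\<close>

lemma card_setG:
  fixes \<xi> :: "'a::{finite,field_gcd}"
  assumes "\<xi> \<noteq> 0" "s \<ge> 1"
  shows "finite (setG \<xi> s)" "card (setG \<xi> s) = 2 * (CARD('a) - 1) * CARD('a) ^ (s - 1)"
proof -
  define B where "B i = (if i = s then UNIV - {0} else UNIV :: 'a set)" for i
  define f where "f = (\<lambda>(\<alpha>, a). [:\<alpha>:] + (\<Sum>i=1..s. monom (a i) (2 * i - 1)) :: 'a poly)"
  have eq: "setG \<xi> s = f ` ({0, \<xi>} \<times> PiE {1..s} B)"
  proof (intro equalityI subsetI)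
    fix F assume "F \<in> setG \<xi> s"
    then obtain \<alpha> a where "F = [:\<alpha>:] + (\<Sum>i=1..s. monom (a i) (2 * i - 1))" "\<alpha> \<in> {0, \<xi>}" "a s \<noteq> 0"
      by (auto simp: setG_def)
    thus "F \<in> f ` ({0, \<xi>} \<times> PiE {1..s} B)"
      by (intro image_eqI[of _ _ "(\<alpha>, restrict a {1..s})"]) (auto simp: f_def B_def)
  next
    fix F assume "F \<in> f ` ({0, \<xi>} \<times> PiE {1..s} B)"
    then obtain \<alpha> a where "F = [:\<alpha>:] + (\<Sum>i=1..s. monom (a i) (2 * i - 1))" "\<alpha> \<in> {0, \<xi>}"
      and a: "a \<in> PiE {1..s} B" by (auto simp: f_def)
    moreover have "a s \<noteq> 0" using PiE_mem[OF a, of s] assms(2) by (simp add: B_def)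
    ultimately show "F \<in> setG \<xi> s" unfolding setG_def by blast
  qed
  \<comment> \<open>The constant term and the coefficients of odd degree recover the parameters;
    \<open>2 * i - 1\<close> is never \<open>0\<close> for \<open>i \<ge> 1\<close>, so they do not
    interfere.\<close>
  have coeff0: "coeff (f (\<alpha>, a)) 0 = \<alpha>" for \<alpha> a
    by (auto simp: f_def coeff_sum intro!: sum.neutral)
  have coeffi: "coeff (f (\<alpha>, a)) (2 * i - 1) = a i" if "i \<in> {1..s}" for \<alpha> a i
  proof -
    have "coeff [:\<alpha>:] (2 * i - 1) = 0"
      using that by (intro coeff_eq_0) auto
    moreover have "(\<Sum>j=1..s. coeff (monom (a j) (2 * j - 1)) (2 * i - 1)) = (\<Sum>j=1..s. if j = i then a i else 0)"
      using that by (intro sum.cong) auto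
    ultimately have "coeff (f (\<alpha>, a)) (2 * i - 1) = (\<Sum>j=1..s. if j = i then a i else 0)"
      by (simp add: f_def coeff_sum)
    thus ?thesis using that by simp
  qed
  have inj: "inj_on f ({0, \<xi>} \<times> PiE {1..s} B)"
  proof (rule inj_onI)
    fix x y assume x: "x \<in> {0, \<xi>} \<times> PiE {1..s} B" and y: "y \<in> {0, \<xi>} \<times> PiE {1..s} B" and fxy: "f x = f y"
    obtain \<alpha> a \<beta> b where xy: "x = (\<alpha>, a)" "y = (\<beta>, b)" by (cases x, cases y)
    have "\<alpha> = \<beta>" using fxy coeff0[of \<alpha> a] coeff0[of \<beta> b] by (simp add: xy)
    moreover have "a = b"
    proof (rule PiE_ext)
      show "a \<in> PiE {1..s} B" "b \<in> PiE {1..s} B" using x y by (auto simp: xy)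
      show "a i = b i" if "i \<in> {1..s}" for i
        using fxy coeffi[OF that, of \<alpha> a] coeffi[OF that, of \<beta> b] by (simp add: xy)
    qed
    ultimately show "x = y" by (simp add: xy)
  qed
  have fin: "finite (PiE {1..s} B)" by (intro finite_PiE) auto
  thus "finite (setG \<xi> s)" by (simp add: eq)
  have "card (PiE {1..s} B) = (\<Prod>i=1..s. card (B i))" by (rule card_PiE) simp
  also have "\<dots> = (\<Prod>i\<in>{1..s} - {s}. card (B i)) * card (B s)"
    using assms(2) by (subst prod.remove[of _ s]) (auto simp: mult.commute)
  also have "(\<Prod>i\<in>{1..s} - {s}. card (B i)) = (\<Prod>i\<in>{1..s} - {s}. CARD('a))"
    by (intro prod.cong) (auto simp: B_def)
  also have "\<dots> = CARD('a) ^ (s - 1)" using assms(2) by simp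
  also have "card (B s) = CARD('a) - 1" by (simp add: B_def card_Diff_singleton)
  finally show "card (setG \<xi> s) = 2 * (CARD('a) - 1) * CARD('a) ^ (s - 1)"
    using assms(1) unfolding eq card_image[OF inj] card_cartesian_product by simp
qed

text \<open>With \<open>s = g + 1 - d\<close> the polynomial parts number
  \<open>2 (q - 1) q^(g - d)\<close>. These are exactly the weights in
  \<open>sum_card_pf_weight\<close>, so the sum closes up without a formula for each
  \<open>card (pf_weight d)\<close>.\<close>

lemma card_setI:
  fixes \<xi> :: "'a::{finite,field_gcd}"
  assumes "\<xi> \<noteq> 0"
  shows "card (setI \<xi> (g + 1)) = 2 * (CARD('a) - 1) * CARD('a) ^ (2 * g)"
proof -
  let ?W = "pf_weight :: nat \<Rightarrow> ('a poly \<times> nat \<Rightarrow> 'a poly) set"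
  define h where "h = (\<lambda>(A, F). pf_value A + to_fract F :: 'a poly fract)"
  have eq: "setI \<xi> (g + 1) = h ` (\<Union>d\<le>g. ?W d \<times> setG \<xi> (Suc (g - d)))"
  proof (intro equalityI subsetI)
    fix u assume "u \<in> setI \<xi> (g + 1)"
    then obtain v F r s where *: "u = v + to_fract F" "s \<ge> 1" "r + s = g + 1" "v \<in> setF r" "F \<in> setG \<xi> s"
      by (auto simp: setI_def)
    then obtain A where A: "A \<in> ?W r" "v = pf_value A" by (auto simp: setF_eq)
    have "r \<le> g" "s = Suc (g - r)" using * by auto
    thus "u \<in> h ` (\<Union>d\<le>g. ?W d \<times> setG \<xi> (Suc (g - d)))"
      using * A by (intro image_eqI[of _ _ "(A, F)"]) (auto simp: h_def)
  next
    fix u assume "u \<in> h ` (\<Union>d\<le>g. ?W d \<times> setG \<xi> (Suc (g - d)))"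
    then obtain d A F where *: "d \<le> g" "A \<in> ?W d" "F \<in> setG \<xi> (Suc (g - d))" "u = pf_value A + to_fract F"
      by (auto simp: h_def)
    thus "u \<in> setI \<xi> (g + 1)"
      unfolding setI_def mem_Collect_eq setF_eq
      by (intro exI[of _ "pf_value A"] exI[of _ F] exI[of _ d] exI[of _ "Suc (g - d)"]) auto
  qed
  have inj: "inj_on h (\<Union>d\<le>g. ?W d \<times> setG \<xi> (Suc (g - d)))"
  proof (rule inj_onI)
    fix x y assume xy: "x \<in> (\<Union>d\<le>g. ?W d \<times> setG \<xi> (Suc (g - d)))"
      "y \<in> (\<Union>d\<le>g. ?W d \<times> setG \<xi> (Suc (g - d)))" "h x = h y"
    obtain A F A' F' where *: "x = (A, F)" "y = (A', F')" by (cases x, cases y)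
    have "A \<in> pf_data" "A' \<in> pf_data" using xy by (auto simp: * pf_weight_def)
    thus "x = y" using pf_value_plus_poly_inj[of A A' F F'] xy(3) by (simp add: * h_def)
  qed
  have "card (setI \<xi> (g + 1)) = card (\<Union>d\<le>g. ?W d \<times> setG \<xi> (Suc (g - d)))"
    unfolding eq by (rule card_image[OF inj])
  also have "\<dots> = (\<Sum>d\<le>g. card (?W d \<times> setG \<xi> (Suc (g - d))))"
  proof (rule card_UN_disjoint)
    show "\<forall>d\<in>{..g}. finite (?W d \<times> setG \<xi> (Suc (g - d)))"
      by (intro ballI finite_cartesian_product finite_pf_weight card_setG(1)[OF assms]) simp
  qed (auto simp: pf_weight_def)
  also have "\<dots> = 2 * (CARD('a) - 1) * (\<Sum>d\<le>g. card (?W d) * CARD('a) ^ (g - d))"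
    by (simp add: card_cartesian_product card_setG(2)[OF assms] sum_distrib_left mult_ac)
  also have "\<dots> = 2 * (CARD('a) - 1) * CARD('a) ^ (2 * g)"
    unfolding sum_card_pf_weight ..
  finally show ?thesis .
qed

subsection \<open>Iterated circle integrals\<close>

definition torus :: "nat \<Rightarrow> real \<Rightarrow> (nat \<Rightarrow> complex) set" where
  "torus k r = {z. \<forall>j\<in>{1..k}. norm (z j) = r}"

text \<open>A relation beside the total function \<open>iter_circle_integral\<close>: it records
  that every one-variable integral exists, without which additivity could fail. Only values on the
  circles matter. The base case starts from the zero tuple, whose first \<open>k\<close> coordinates
  the recursion has overwritten.\<close>

primrec has_iter_integral ::
    "real \<Rightarrow> nat \<Rightarrow> ((nat \<Rightarrow> complex) \<Rightarrow> complex) \<Rightarrow> complex \<Rightarrow> bool" where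
  "has_iter_integral r 0 f v \<longleftrightarrow> f (\<lambda>_. 0) = v"
| "has_iter_integral r (Suc k) f v \<longleftrightarrow>
     (\<exists>h. (\<forall>w\<in>sphere 0 r. has_iter_integral r k (\<lambda>z. f (z(Suc k := w))) (h w)) \<and>
          (h has_contour_integral v) (circlepath 0 r))"

lemma torus_Suc_upd: "w \<in> sphere 0 r \<Longrightarrow> z \<in> torus k r \<Longrightarrow> z(Suc k := w) \<in> torus (Suc k) r"
  by (auto simp: torus_def)

lemma iter_circle_integral_unique:
  assumes "r > 0" "has_iter_integral r k f v"
  shows "iter_circle_integral r k f = v"
  using assms
proof (induction k arbitrary: f v)
  case (Suc k)
  then obtain h where h: "\<And>w. w \<in> sphere 0 r \<Longrightarrow> has_iter_integral r k (\<lambda>z. f (z(Suc k := w))) (h w)"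
    and v: "(h has_contour_integral v) (circlepath 0 r)"
    unfolding has_iter_integral.simps by blast
  have "iter_circle_integral r k (\<lambda>z. f (z(Suc k := w))) = h w" if "w \<in> sphere 0 r" for w
    by (rule Suc.IH[OF Suc.prems(1) h[OF that]])
  hence "((\<lambda>w. iter_circle_integral r k (\<lambda>z. f (z(Suc k := w)))) has_contour_integral v) (circlepath 0 r)"
    using Suc.prems(1) by (intro has_contour_integral_eq[OF v]) simp
  thus ?case
    by (simp add: contour_integral_unique)
qed simp

lemma has_iter_integral_cong:
  assumes "r > 0" "has_iter_integral r k f v" "\<And>z. z \<in> torus k r \<Longrightarrow> f z = g z"
  shows "has_iter_integral r k g v"
  using assms(2,3)
proof (induction k arbitrary: f g v)
  case 0
  thus ?case by (auto simp: torus_def)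
next
  case (Suc k)
  then obtain h where h: "\<And>w. w \<in> sphere 0 r \<Longrightarrow> has_iter_integral r k (\<lambda>z. f (z(Suc k := w))) (h w)"
    and v: "(h has_contour_integral v) (circlepath 0 r)"
    unfolding has_iter_integral.simps by blast
  have "has_iter_integral r k (\<lambda>z. g (z(Suc k := w))) (h w)" if "w \<in> sphere 0 r" for w
    using that by (intro Suc.IH[OF h] Suc.prems torus_Suc_upd) auto
  thus ?case
    using v unfolding has_iter_integral.simps by blast
qed

lemma has_iter_integral_add:
  assumes "has_iter_integral r k f v" "has_iter_integral r k g w"
  shows "has_iter_integral r k (\<lambda>z. f z + g z) (v + w)"
  using assms
proof (induction k arbitrary: f g v w)
  case (Suc k)
  from Suc.prems obtain h h' where
    "\<And>u. u \<in> sphere 0 r \<Longrightarrow> has_iter_integral r k (\<lambda>z. f (z(Suc k := u))) (h u)"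
    "\<And>u. u \<in> sphere 0 r \<Longrightarrow> has_iter_integral r k (\<lambda>z. g (z(Suc k := u))) (h' u)"
    "(h has_contour_integral v) (circlepath 0 r)" "(h' has_contour_integral w) (circlepath 0 r)"
    unfolding has_iter_integral.simps by blast
  thus ?case
    unfolding has_iter_integral.simps
    by (intro exI[of _ "\<lambda>u. h u + h' u"] conjI ballI has_contour_integral_add Suc.IH)
qed simp

lemma has_iter_integral_cmult:
  assumes "has_iter_integral r k f v"
  shows "has_iter_integral r k (\<lambda>z. c * f z) (c * v)"
  using assms
proof (induction k arbitrary: f v)
  case (Suc k)
  from Suc.prems obtain h where
    "\<And>u. u \<in> sphere 0 r \<Longrightarrow> has_iter_integral r k (\<lambda>z. f (z(Suc k := u))) (h u)"
    "(h has_contour_integral v) (circlepath 0 r)"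
    unfolding has_iter_integral.simps by blast
  thus ?case
    unfolding has_iter_integral.simps
    by (intro exI[of _ "\<lambda>u. c * h u"] conjI ballI has_contour_integral_lmul Suc.IH)
qed simp

lemma has_iter_integral_diff:
  assumes "has_iter_integral r k f v" "has_iter_integral r k g w"
  shows "has_iter_integral r k (\<lambda>z. f z - g z) (v - w)"
  using has_iter_integral_add[OF assms(1) has_iter_integral_cmult[OF assms(2), of "-1"]] by simp

lemma has_iter_integral_0: "has_iter_integral r k (\<lambda>_. 0) 0"
  by (induction k) (auto intro!: exI[of _ "\<lambda>_. 0"] has_contour_integral_0)

lemma has_iter_integral_sum:
  assumes "\<And>a. a \<in> S \<Longrightarrow> has_iter_integral r k (f a) (v a)"
  shows "has_iter_integral r k (\<lambda>z. \<Sum>a\<in>S. f a z) (\<Sum>a\<in>S. v a)"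
  using assms by (induction S rule: infinite_finite_induct)
    (auto intro!: has_iter_integral_add has_iter_integral_0)

lemma has_iter_integral_prod:
  assumes "\<And>j. j \<in> {1..k} \<Longrightarrow> (\<phi> j has_contour_integral a j) (circlepath 0 r)"
  shows "has_iter_integral r k (\<lambda>z. \<Prod>j=1..k. \<phi> j (z j)) (\<Prod>j=1..k. a j)"
  using assms
proof (induction k)
  case (Suc k)
  have IH: "has_iter_integral r k (\<lambda>z. \<Prod>j=1..k. \<phi> j (z j)) (\<Prod>j=1..k. a j)"
    using Suc by auto
  have eq: "(\<Prod>j=1..Suc k. \<phi> j ((z(Suc k := w)) j)) = \<phi> (Suc k) w * (\<Prod>j=1..k. \<phi> j (z j))" for z w
    by (simp add: mult.commute)
  show ?case
    unfolding has_iter_integral.simps eq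
  proof (intro exI[of _ "\<lambda>w. \<phi> (Suc k) w * (\<Prod>j=1..k. a j)"] conjI ballI)
    show "has_iter_integral r k (\<lambda>z. \<phi> (Suc k) w * (\<Prod>j=1..k. \<phi> j (z j)))
        (\<phi> (Suc k) w * (\<Prod>j=1..k. a j))" for w
      by (rule has_iter_integral_cmult[OF IH])
    show "((\<lambda>w. \<phi> (Suc k) w * (\<Prod>j=1..k. a j)) has_contour_integral (\<Prod>j=1..Suc k. a j)) (circlepath 0 r)"
      using has_contour_integral_rmul[OF Suc.prems[of "Suc k"], of "\<Prod>j=1..k. a j"] by (simp add: mult.commute)
  qed
qed simp

lemma has_iter_integral_bound:
  assumes "r > 0" "B \<ge> 0" "has_iter_integral r k f v" "\<And>z. z \<in> torus k r \<Longrightarrow> norm (f z) \<le> B"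
  shows "norm v \<le> B * (2 * pi * r) ^ k"
  using assms(3,4)
proof (induction k arbitrary: f v)
  case 0
  thus ?case by (auto simp: torus_def)
next
  case (Suc k)
  then obtain h where h: "\<And>w. w \<in> sphere 0 r \<Longrightarrow> has_iter_integral r k (\<lambda>z. f (z(Suc k := w))) (h w)"
    and v: "(h has_contour_integral v) (circlepath 0 r)"
    unfolding has_iter_integral.simps by blast
  have "norm (h w) \<le> B * (2 * pi * r) ^ k" if "w \<in> sphere 0 r" for w
    using that by (intro Suc.IH[OF h] Suc.prems torus_Suc_upd) auto
  hence "norm v \<le> B * (2 * pi * r) ^ k * (2 * pi * r)"
    using assms by (intro has_contour_integral_bound_circlepath[OF v]) auto
  thus ?case by (simp add: mult_ac)
qed

text \<open>For a fixed last coordinate the inner integrals converge by induction.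
  \<open>has_iter_integral_bound\<close> makes this uniform in that coordinate, and the one-variable
  limit theorem then gives integrability of the limit.\<close>

lemma has_iter_integral_uniform_limit:
  assumes "r > 0" "\<And>n. has_iter_integral r k (p n) (v n)" "uniform_limit (torus k r) p f sequentially"
  shows "\<exists>V. v \<longlonglongrightarrow> V \<and> has_iter_integral r k f V"
  using assms(2,3)
proof (induction k arbitrary: p f v)
  case 0
  have "(\<lambda>n. p n (\<lambda>_. 0)) \<longlonglongrightarrow> f (\<lambda>_. 0)"
    by (rule tendsto_uniform_limitI[OF 0(2)]) (auto simp: torus_def)
  thus ?case using 0(1) by auto
next
  case (Suc k)
  have "\<forall>n. \<exists>h. (\<forall>w\<in>sphere 0 r. has_iter_integral r k (\<lambda>z. p n (z(Suc k := w))) (h w)) \<and>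
          (h has_contour_integral v n) (circlepath 0 r)"
    using Suc.prems(1) by simp
  then obtain h where h: "\<And>n w. (w :: complex) \<in> sphere 0 r \<Longrightarrow> has_iter_integral r k (\<lambda>z. p n (z(Suc k := w))) (h n w)"
    and v: "\<And>n. (h n has_contour_integral v n) (circlepath 0 r)"
    by metis
  have unif: "uniform_limit (torus k r) (\<lambda>n z. p n (z(Suc k := w))) (\<lambda>z. f (z(Suc k := w))) sequentially"
    if "w \<in> sphere 0 r" for w
  proof (rule uniform_limitI)
    fix e :: real assume "e > 0"
    from uniform_limitD[OF Suc.prems(2) this]
    show "\<forall>\<^sub>F n in sequentially. \<forall>z\<in>torus k r. dist (p n (z(Suc k := w))) (f (z(Suc k := w))) < e"
      by (rule eventually_mono) (use torus_Suc_upd[OF that] in blast)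
  qed
  have "\<forall>w\<in>sphere 0 r. \<exists>H. has_iter_integral r k (\<lambda>z. f (z(Suc k := w))) H"
    using Suc.IH[OF h unif] by blast
  then obtain H where H: "\<And>w. w \<in> sphere 0 r \<Longrightarrow> has_iter_integral r k (\<lambda>z. f (z(Suc k := w))) (H w)"
    by metis
  have lim: "uniform_limit (sphere 0 r) h H sequentially"
  proof (rule uniform_limitI)
    fix e :: real assume e: "e > 0"
    \<comment> \<open>The product of the \<open>k\<close> circle lengths, by which the bound
      multiplies the sup norm; the 2 in \<open>e / (2 * K)\<close> yields a strict
      inequality.\<close>
    define K where "K = (2 * pi * r) ^ k"
    have K: "K > 0" using assms(1) by (simp add: K_def)
    have "\<forall>\<^sub>F n in sequentially. \<forall>z\<in>torus (Suc k) r. dist (p n z) (f z) < e / (2 * K)"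
      using uniform_limitD[OF Suc.prems(2)] e K by simp
    thus "\<forall>\<^sub>F n in sequentially. \<forall>w\<in>sphere 0 r. dist (h n w) (H w) < e"
    proof (rule eventually_mono, intro ballI)
      fix n w assume n: "\<forall>z\<in>torus (Suc k) r. dist (p n z) (f z) < e / (2 * K)" and w: "(w :: complex) \<in> sphere 0 r"
      have "norm (h n w - H w) \<le> e / (2 * K) * (2 * pi * r) ^ k"
        using n assms(1) e K torus_Suc_upd[OF w]
        by (intro has_iter_integral_bound[OF _ _ has_iter_integral_diff[OF h[OF w, of n] H[OF w]]])
           (auto simp: dist_norm less_imp_le)
      also have "\<dots> = e / 2" using K by (simp flip: K_def)
      finally show "dist (h n w) (H w) < e" using e by (simp add: dist_norm)
    qed
  qed
  have "\<forall>\<^sub>F n in sequentially. h n contour_integrable_on circlepath 0 r"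
    using v unfolding contour_integrable_on_def by (intro always_eventually) blast
  from contour_integral_uniform_limit_circlepath[OF this lim _ assms(1)]
  have "H contour_integrable_on circlepath 0 r"
    "v \<longlonglongrightarrow> contour_integral (circlepath 0 r) H"
    using contour_integral_unique[OF v] by auto
  thus ?case
    unfolding has_iter_integral.simps using H has_contour_integral_integral by blast
qed

text \<open>For \<open>e < m\<close> the residue is the coefficient of \<open>z^(m - 1 - e)\<close>
  in \<open>exp(c z)\<close>; otherwise the integrand agrees on the circle with an entire function.
  The case \<open>c = 0\<close> covers plain monomials.\<close>

lemma has_contour_integral_power_exp:
  assumes "r > 0"
  shows "((\<lambda>z. z ^ e * exp (c * z) / z ^ m) has_contour_integral
    (2 * of_real pi * \<i> * (if e < m then c ^ (m - 1 - e) * inverse (fact (m - 1 - e)) else 0))) (circlepath 0 r)"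
proof (cases "e < m")
  case True
  define n where "n = m - 1 - e"
  have m: "m = e + Suc n" using True by (simp add: n_def)
  have "(deriv ^^ n) (\<lambda>u. exp (c * u)) = (\<lambda>u. c ^ n * exp (c * u))" for n
  proof (induction n)
    case (Suc n)
    have "deriv (\<lambda>u. c ^ n * exp (c * u)) = (\<lambda>u. c ^ Suc n * exp (c * u))"
      by (intro ext DERIV_imp_deriv) (auto intro!: derivative_eq_intros)
    thus ?case using Suc by simp
  qed simp
  hence d: "(deriv ^^ n) (\<lambda>u. exp (c * u)) 0 = c ^ n" for n
    by simp
  have "((\<lambda>u. exp (c * u) / (u - 0) ^ Suc n) has_contour_integral
      ((2 * of_real pi * \<i>) / fact n * (deriv ^^ n) (\<lambda>u. exp (c * u)) 0)) (circlepath 0 r)"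
  proof -
    have "continuous_on (cball 0 r) (\<lambda>u. exp (c * u))" "(\<lambda>u. exp (c * u)) holomorphic_on ball 0 r"
      by (intro continuous_intros holomorphic_intros)+
    from Cauchy_has_contour_integral_higher_derivative_circlepath[OF this, of 0 n] show ?thesis
      using assms by simp
  qed
  hence "((\<lambda>z. z ^ e * exp (c * z) / z ^ m) has_contour_integral
      ((2 * of_real pi * \<i>) / fact n * c ^ n)) (circlepath 0 r)"
    unfolding d
  proof (rule has_contour_integral_eq)
    fix z assume "z \<in> path_image (circlepath 0 r)"
    hence "z \<noteq> 0" using assms by auto
    thus "exp (c * z) / (z - 0) ^ Suc n = z ^ e * exp (c * z) / z ^ m"
      by (simp add: m power_add)
  qed
  thus ?thesis using True by (simp add: n_def field_simps)
next
  case False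
  have "((\<lambda>z. z ^ (e - m) * exp (c * z)) has_contour_integral 0) (circlepath 0 r)"
    by (rule Cauchy_theorem_convex_simple[of _ UNIV]) (auto intro!: holomorphic_intros)
  hence "((\<lambda>z. z ^ e * exp (c * z) / z ^ m) has_contour_integral 0) (circlepath 0 r)"
  proof (rule has_contour_integral_eq)
    fix z assume "z \<in> path_image (circlepath 0 r)"
    hence "z \<noteq> 0" using assms by auto
    thus "z ^ (e - m) * exp (c * z) = z ^ e * exp (c * z) / z ^ m"
      using False by (simp add: power_diff)
  qed
  thus ?thesis using False by simp
qed

subsection \<open>Uniform limits of polynomials on a polydisc\<close>

definition polydisc :: "nat \<Rightarrow> real \<Rightarrow> (nat \<Rightarrow> complex) set" where
  "polydisc k \<rho> = {z. \<forall>j\<in>{1..k}. norm (z j) \<le> \<rho>}"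

inductive_set mpolys :: "nat \<Rightarrow> ((nat \<Rightarrow> complex) \<Rightarrow> complex) set" for k where
  monomial: "(\<lambda>z. c * (\<Prod>j=1..k. z j ^ e j)) \<in> mpolys k"
| add: "p \<in> mpolys k \<Longrightarrow> p' \<in> mpolys k \<Longrightarrow> (\<lambda>z. p z + p' z) \<in> mpolys k"

definition poly_approx :: "nat \<Rightarrow> real \<Rightarrow> ((nat \<Rightarrow> complex) \<Rightarrow> complex) \<Rightarrow> bool" where
  "poly_approx k \<rho> f \<longleftrightarrow> (\<forall>\<epsilon>>0. \<exists>p\<in>mpolys k. \<forall>z\<in>polydisc k \<rho>. norm (f z - p z) < \<epsilon>)"

lemma poly_approxE:
  assumes "poly_approx k \<rho> f" "\<epsilon> > 0"
  obtains p where "p \<in> mpolys k" "\<And>z. z \<in> polydisc k \<rho> \<Longrightarrow> norm (f z - p z) < \<epsilon>"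
proof -
  have "\<exists>p\<in>mpolys k. \<forall>z\<in>polydisc k \<rho>. norm (f z - p z) < \<epsilon>"
    using assms unfolding poly_approx_def by simp
  thus ?thesis using that by blast
qed

lemma mpolys_const: "(\<lambda>_. c) \<in> mpolys k"
  using monomial[of c "\<lambda>_. 0" k] by simp

lemma mpolys_coord: "i \<in> {1..k} \<Longrightarrow> (\<lambda>z. z i) \<in> mpolys k"
  using monomial[of 1 "\<lambda>j. if j = i then 1 else 0" k]
  by (simp add: if_distrib[of "power _"] prod.delta cong: if_cong)

lemma mpolys_mult:
  assumes "p \<in> mpolys k" "p' \<in> mpolys k"
  shows "(\<lambda>z. p z * p' z) \<in> mpolys k"
  using assms
proof (induction rule: mpolys.induct)
  case (monomial c e)
  from monomial show ?case
  proof (induction rule: mpolys.induct)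
    case (monomial c' e')
    have "(\<lambda>z. (c * c') * (\<Prod>j=1..k. z j ^ (e j + e' j))) \<in> mpolys k"
      by (rule mpolys.monomial)
    thus ?case by (simp add: power_add prod.distrib mult_ac)
  next
    case (add p p')
    thus ?case using mpolys.add[OF add.IH] by (simp add: algebra_simps)
  qed
next
  case (add p p'')
  thus ?case using mpolys.add[OF add.IH] by (simp add: algebra_simps)
qed

text \<open>The order of the quantifiers is the point: residues of monomials do not depend on
  \<open>r\<close>, so one value serves every radius.\<close>

lemma mpolys_has_iter_integral:
  assumes "p \<in> mpolys k"
  shows "\<exists>v. \<forall>r>0. has_iter_integral r k (\<lambda>z. p z / (\<Prod>j=1..k. z j ^ m)) v"
  using assms
proof (induction rule: mpolys.induct)
  case (monomial c e)
  show ?case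
  proof (intro exI allI impI)
    fix r :: real assume r: "r > 0"
    have "has_iter_integral r k (\<lambda>z. c * (\<Prod>j=1..k. z j ^ e j * exp (0 * z j) / z j ^ m))
       (c * (\<Prod>j=1..k. 2 * of_real pi * \<i> *
         (if e j < m then 0 ^ (m - 1 - e j) * inverse (fact (m - 1 - e j)) else 0)))"
      by (intro has_iter_integral_cmult has_iter_integral_prod has_contour_integral_power_exp r)
    thus "has_iter_integral r k (\<lambda>z. c * (\<Prod>j=1..k. z j ^ e j) / (\<Prod>j=1..k. z j ^ m))
       (c * (\<Prod>j=1..k. 2 * of_real pi * \<i> *
         (if e j < m then 0 ^ (m - 1 - e j) * inverse (fact (m - 1 - e j)) else 0)))"
      by (simp add: prod_dividef)
  qed
next
  case (add p p')
  then obtain v v' where "\<And>r. r > 0 \<Longrightarrow> has_iter_integral r k (\<lambda>z. p z / (\<Prod>j=1..k. z j ^ m)) v"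
    "\<And>r. r > 0 \<Longrightarrow> has_iter_integral r k (\<lambda>z. p' z / (\<Prod>j=1..k. z j ^ m)) v'" by blast
  hence "\<forall>r>0. has_iter_integral r k (\<lambda>z. (p z + p' z) / (\<Prod>j=1..k. z j ^ m)) (v + v')"
    by (auto simp: add_divide_distrib intro!: has_iter_integral_add)
  thus ?case by blast
qed

lemma poly_approx_sequence:
  assumes "poly_approx k \<rho> f"
  shows "\<exists>p. (\<forall>n. p n \<in> mpolys k) \<and> uniform_limit (polydisc k \<rho>) p f sequentially"
proof -
  have "\<forall>n. \<exists>p\<in>mpolys k. \<forall>z\<in>polydisc k \<rho>. norm (f z - p z) < inverse (real (Suc n))"
    using assms unfolding poly_approx_def by simp
  then obtain p where p: "\<And>n. p n \<in> mpolys k"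
    and pf: "\<And>n z. z \<in> polydisc k \<rho> \<Longrightarrow> norm (f z - p n z) < inverse (real (Suc n))"
    by metis
  have "uniform_limit (polydisc k \<rho>) p f sequentially"
  proof (rule uniform_limitI)
    fix e :: real assume "e > 0"
    hence "\<forall>\<^sub>F n in sequentially. inverse (real (Suc n)) < e"
      using order_tendstoD(2)[OF LIMSEQ_inverse_real_of_nat] by simp
    thus "\<forall>\<^sub>F n in sequentially. \<forall>z\<in>polydisc k \<rho>. dist (p n z) (f z) < e"
    proof (rule eventually_mono, intro ballI)
      fix n z assume "inverse (real (Suc n)) < e" "z \<in> polydisc k \<rho>"
      thus "dist (p n z) (f z) < e"
        using pf[of z n] by (simp add: dist_norm norm_minus_commute)
    qed
  qed
  thus ?thesis using p by blast
qed

text \<open>The integrals of the approximating polynomials form one sequence \<open>v\<close> for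
  all radii, so its limit is common to all radii. Division by the monomial preserves uniform
  convergence on a single torus, where that monomial has constant modulus.\<close>

lemma poly_approx_has_iter_integral:
  assumes "poly_approx k \<rho> f"
  shows "\<exists>v. \<forall>r. 0 < r \<and> r \<le> \<rho> \<longrightarrow> has_iter_integral r k (\<lambda>z. f z / (\<Prod>j=1..k. z j ^ m)) v"
proof -
  obtain p where p: "\<And>n. p n \<in> mpolys k" and pf: "uniform_limit (polydisc k \<rho>) p f sequentially"
    using poly_approx_sequence[OF assms] by blast
  obtain v where v: "\<And>n r. r > 0 \<Longrightarrow> has_iter_integral r k (\<lambda>z. p n z / (\<Prod>j=1..k. z j ^ m)) (v n)"
    using mpolys_has_iter_integral[OF p, of _ m] by metis
  have *: "\<exists>V. v \<longlonglongrightarrow> V \<and> has_iter_integral r k (\<lambda>z. f z / (\<Prod>j=1..k. z j ^ m)) V"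
    if r: "0 < r" "r \<le> \<rho>" for r
  proof (rule has_iter_integral_uniform_limit[OF r(1) v[OF r(1)]], rule uniform_limitI)
    fix e :: real assume e: "e > 0"
    define K where "K = (r ^ m) ^ k"
    have K: "K > 0" using r by (simp add: K_def)
    have "\<forall>\<^sub>F n in sequentially. \<forall>z\<in>polydisc k \<rho>. dist (p n z) (f z) < e * K"
      using uniform_limitD[OF pf, of "e * K"] e K by simp
    thus "\<forall>\<^sub>F n in sequentially. \<forall>z\<in>torus k r.
       dist (p n z / (\<Prod>j=1..k. z j ^ m)) (f z / (\<Prod>j=1..k. z j ^ m)) < e"
    proof (rule eventually_mono, intro ballI)
      fix n z assume n: "\<forall>z\<in>polydisc k \<rho>. dist (p n z) (f z) < e * K" and z: "z \<in> torus k r"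
      have nz: "norm (\<Prod>j=1..k. z j ^ m) = K"
        using z by (simp add: prod_norm[symmetric] norm_power torus_def K_def)
      have "norm (p n z - f z) < e * K"
        using n z r by (simp add: dist_norm torus_def polydisc_def)
      thus "dist (p n z / (\<Prod>j=1..k. z j ^ m)) (f z / (\<Prod>j=1..k. z j ^ m)) < e"
        unfolding dist_norm diff_divide_distrib[symmetric] norm_divide nz
        using K by (simp add: pos_divide_less_eq)
    qed
  qed
  show ?thesis
  proof (cases "\<rho> > 0")
    case True
    then obtain V where V: "v \<longlonglongrightarrow> V" using * by blast
    have "has_iter_integral r k (\<lambda>z. f z / (\<Prod>j=1..k. z j ^ m)) V" if "0 < r" "r \<le> \<rho>" for r
      using *[OF that] LIMSEQ_unique[OF V] by blast
    thus ?thesis by blast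
  qed auto
qed

section \<open>Closure properties of uniform approximability by polynomials\<close>

lemma poly_approx_mpoly: "p \<in> mpolys k \<Longrightarrow> poly_approx k \<rho> p"
  unfolding poly_approx_def by force

lemma poly_approx_const: "poly_approx k \<rho> (\<lambda>_. c)"
  and poly_approx_coord: "i \<in> {1..k} \<Longrightarrow> poly_approx k \<rho> (\<lambda>z. z i)"
  by (auto intro!: poly_approx_mpoly mpolys_const mpolys_coord)

lemma poly_approx_limit:
  assumes "\<And>\<epsilon>. \<epsilon> > 0 \<Longrightarrow> \<exists>g. poly_approx k \<rho> g \<and> (\<forall>z\<in>polydisc k \<rho>. norm (f z - g z) < \<epsilon>)"
  shows "poly_approx k \<rho> f"
  unfolding poly_approx_def
proof (intro allI impI)
  fix \<epsilon> :: real assume \<epsilon>: "\<epsilon> > 0"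
  obtain g where g: "poly_approx k \<rho> g" "\<And>z. z \<in> polydisc k \<rho> \<Longrightarrow> norm (f z - g z) < \<epsilon> / 2"
    using assms[of "\<epsilon> / 2"] \<epsilon> by auto
  obtain p where p: "p \<in> mpolys k" "\<And>z. z \<in> polydisc k \<rho> \<Longrightarrow> norm (g z - p z) < \<epsilon> / 2"
    using poly_approxE[OF g(1), of "\<epsilon> / 2"] \<epsilon> by auto
  have "norm (f z - p z) < \<epsilon>" if "z \<in> polydisc k \<rho>" for z
    using g(2)[OF that] p(2)[OF that] norm_triangle_ineq[of "f z - g z" "g z - p z"] by simp
  thus "\<exists>p\<in>mpolys k. \<forall>z\<in>polydisc k \<rho>. norm (f z - p z) < \<epsilon>"
    using p(1) by blast
qed

lemma poly_approx_mono:
  assumes "poly_approx k \<rho> f" "\<rho>' \<le> \<rho>"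
  shows "poly_approx k \<rho>' f"
proof -
  have "polydisc k \<rho>' \<subseteq> polydisc k \<rho>" using assms(2) by (force simp: polydisc_def)
  thus ?thesis using assms(1) unfolding poly_approx_def by blast
qed

lemma poly_approx_uniform_limit:
  assumes "uniform_limit (polydisc k \<rho>) F f sequentially" "\<And>n :: nat. poly_approx k \<rho> (F n)"
  shows "poly_approx k \<rho> f"
proof (rule poly_approx_limit)
  fix \<epsilon> :: real assume "\<epsilon> > 0"
  hence "\<forall>\<^sub>F n in sequentially. \<forall>z\<in>polydisc k \<rho>. dist (F n z) (f z) < \<epsilon>"
    by (rule uniform_limitD[OF assms(1)])
  then obtain n where "\<forall>z\<in>polydisc k \<rho>. dist (F n z) (f z) < \<epsilon>"
    using eventually_happens by force
  thus "\<exists>g. poly_approx k \<rho> g \<and> (\<forall>z\<in>polydisc k \<rho>. norm (f z - g z) < \<epsilon>)"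
    using assms(2)[of n] by (auto simp: dist_norm norm_minus_commute)
qed

lemma mpolys_bounded:
  assumes "p \<in> mpolys k"
  shows "\<exists>B>0. \<forall>z\<in>polydisc k \<rho>. norm (p z) \<le> B"
  using assms
proof (induction rule: mpolys.induct)
  case (monomial c e)
  have "norm (c * (\<Prod>j=1..k. z j ^ e j)) \<le> norm c * (\<Prod>j=1..k. \<rho> ^ e j)" if "z \<in> polydisc k \<rho>" for z
    unfolding norm_mult prod_norm[symmetric] norm_power using that
    by (intro mult_left_mono prod_mono conjI power_mono) (auto simp: polydisc_def)
  hence "\<forall>z\<in>polydisc k \<rho>. norm (c * (\<Prod>j=1..k. z j ^ e j)) \<le> max 1 (norm c * (\<Prod>j=1..k. \<rho> ^ e j))"
    by (simp add: le_max_iff_disj)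
  thus ?case by (intro exI[of _ "max 1 (norm c * (\<Prod>j=1..k. \<rho> ^ e j))"]) auto
next
  case (add p p')
  then obtain B B' where "B > 0" "B' > 0" "\<And>z. z \<in> polydisc k \<rho> \<Longrightarrow> norm (p z) \<le> B"
    "\<And>z. z \<in> polydisc k \<rho> \<Longrightarrow> norm (p' z) \<le> B'" by blast
  thus ?case by (intro exI[of _ "B + B'"]) (auto intro!: norm_triangle_le add_mono)
qed

lemma poly_approx_bounded:
  assumes "poly_approx k \<rho> f"
  shows "\<exists>B>0. \<forall>z\<in>polydisc k \<rho>. norm (f z) \<le> B"
proof -
  obtain p where p: "p \<in> mpolys k" "\<And>z. z \<in> polydisc k \<rho> \<Longrightarrow> norm (f z - p z) < 1"
    using poly_approxE[OF assms, of 1] by auto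
  obtain B where B: "B > 0" "\<And>z. z \<in> polydisc k \<rho> \<Longrightarrow> norm (p z) \<le> B"
    using mpolys_bounded[OF p(1)] by blast
  have "norm (f z) \<le> B + 1" if "z \<in> polydisc k \<rho>" for z
    using p(2)[OF that] B(2)[OF that] norm_triangle_ineq[of "f z - p z" "p z"] by simp
  thus ?thesis using B(1) by (intro exI[of _ "B + 1"]) auto
qed

lemma poly_approx_add:
  assumes "poly_approx k \<rho> f" "poly_approx k \<rho> g"
  shows "poly_approx k \<rho> (\<lambda>z. f z + g z)"
proof -
  obtain p p' where p: "\<And>n. p n \<in> mpolys k" "uniform_limit (polydisc k \<rho>) p f sequentially"
    and p': "\<And>n. p' n \<in> mpolys k" "uniform_limit (polydisc k \<rho>) p' g sequentially"
    using assms[THEN poly_approx_sequence] by blast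
  show ?thesis
    using uniform_limit_add[OF p(2) p'(2)]
    by (rule poly_approx_uniform_limit) (intro poly_approx_mpoly mpolys.add p p')
qed

lemma poly_approx_mult:
  assumes "poly_approx k \<rho> f" "poly_approx k \<rho> g"
  shows "poly_approx k \<rho> (\<lambda>z. f z * g z)"
proof -
  obtain p p' where p: "\<And>n. p n \<in> mpolys k" "uniform_limit (polydisc k \<rho>) p f sequentially"
    and p': "\<And>n. p' n \<in> mpolys k" "uniform_limit (polydisc k \<rho>) p' g sequentially"
    using assms[THEN poly_approx_sequence] by blast
  have "bounded (f ` polydisc k \<rho>)" "bounded (g ` polydisc k \<rho>)"
    using assms[THEN poly_approx_bounded] by (auto simp: bounded_iff)
  from uniform_lim_mult[OF p(2) p'(2) this] show ?thesis
    by (rule poly_approx_uniform_limit) (intro poly_approx_mpoly mpolys_mult p p')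
qed

lemma poly_approx_diff:
  assumes "poly_approx k \<rho> f" "poly_approx k \<rho> g"
  shows "poly_approx k \<rho> (\<lambda>z. f z - g z)"
  using poly_approx_add[OF assms(1) poly_approx_mult[OF poly_approx_const[of _ _ "-1"] assms(2)]] by simp

lemma poly_approx_sum:
  assumes "\<And>a. a \<in> S \<Longrightarrow> poly_approx k \<rho> (f a)"
  shows "poly_approx k \<rho> (\<lambda>z. \<Sum>a\<in>S. f a z)"
  using assms by (induction S rule: infinite_finite_induct) (auto intro!: poly_approx_add poly_approx_const)

lemma poly_approx_prod:
  assumes "\<And>a. a \<in> S \<Longrightarrow> poly_approx k \<rho> (f a)"
  shows "poly_approx k \<rho> (\<lambda>z. \<Prod>a\<in>S. f a z)"
  using assms by (induction S rule: infinite_finite_induct) (auto intro!: poly_approx_mult poly_approx_const)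

lemma poly_approx_power:
  "poly_approx k \<rho> f \<Longrightarrow> poly_approx k \<rho> (\<lambda>z. f z ^ n)"
  by (induction n) (auto intro!: poly_approx_mult poly_approx_const)

text \<open>Taylor sums of \<open>\<phi>\<close> at \<open>0\<close> converge uniformly on the
  closed disc of radius \<open>R < R'\<close>, and each of them evaluated at \<open>f\<close> is a
  polynomial expression in \<open>f\<close>.\<close>

lemma poly_approx_compose_holomorphic:
  assumes \<phi>: "\<phi> holomorphic_on ball 0 R'" and R: "R < R'"
    and f: "poly_approx k \<rho> f" "\<And>z. z \<in> polydisc k \<rho> \<Longrightarrow> norm (f z) \<le> R"
  shows "poly_approx k \<rho> (\<lambda>z. \<phi> (f z))"
proof -
  define a where "a n = (deriv ^^ n) \<phi> 0 / fact n" for n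
  have sums: "(\<lambda>n. a n * w ^ n) sums \<phi> w" if "w \<in> ball 0 R'" for w
    using holomorphic_power_series[OF \<phi> that] by (simp add: a_def)
  have R_less: "R < conv_radius a" if "R \<ge> 0"
  proof -
    have "ereal R' \<le> conv_radius a"
    proof (rule conv_radius_geI_ex)
      fix r :: real assume "0 < r" "ereal r < ereal R'"
      thus "\<exists>z. norm z = r \<and> summable (\<lambda>n. a n * z ^ n)"
        using sums[of "of_real r"] by (intro exI[of _ "of_real r"]) (auto simp: sums_iff)
    qed
    thus ?thesis using R by (meson ereal_less(2) less_ereal.simps(1) less_le_trans)
  qed
  have lim: "uniform_limit (cball 0 R) (\<lambda>n x. \<Sum>i<n. a i * x ^ i) \<phi> sequentially"
  proof (cases "R \<ge> 0")
    case True
    have "uniform_limit (cball 0 R) (\<lambda>n x. \<Sum>i<n. a i * (x - 0) ^ i)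
        (\<lambda>x. suminf (\<lambda>i. a i * (x - 0) ^ i)) sequentially"
      by (rule powser_uniform_limit[OF R_less[OF True]])
    moreover have "suminf (\<lambda>i. a i * x ^ i) = \<phi> x" if "x \<in> cball 0 R" for x
      using sums[of x] that R by (auto simp: sums_iff)
    ultimately show ?thesis
      unfolding uniform_limit_iff by simp
  qed auto
  have "uniform_limit (polydisc k \<rho>) (\<lambda>n z. \<Sum>i<n. a i * f z ^ i) (\<lambda>z. \<phi> (f z)) sequentially"
  proof (rule uniform_limitI)
    fix e :: real assume "e > 0"
    from uniform_limitD[OF lim this] show "\<forall>\<^sub>F n in sequentially. \<forall>z\<in>polydisc k \<rho>.
        dist (\<Sum>i<n. a i * f z ^ i) (\<phi> (f z)) < e"
      by (rule eventually_mono) (use f(2) in auto)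
  qed
  thus ?thesis
    by (rule poly_approx_uniform_limit)
       (intro poly_approx_sum poly_approx_mult poly_approx_const poly_approx_power f)
qed

lemma poly_approx_exp:
  assumes "poly_approx k \<rho> f"
  shows "poly_approx k \<rho> (\<lambda>z. exp (f z))"
proof -
  obtain B where B: "\<And>z. z \<in> polydisc k \<rho> \<Longrightarrow> norm (f z) \<le> B"
    using poly_approx_bounded[OF assms] by blast
  show ?thesis
    by (rule poly_approx_compose_holomorphic[OF _ _ assms B, of exp "B + 1"])
       (auto intro!: holomorphic_intros)
qed

lemma poly_approx_inverse_1_minus:
  assumes "poly_approx k \<rho> f" "\<And>z. z \<in> polydisc k \<rho> \<Longrightarrow> norm (f z) \<le> R" "R < 1"
  shows "poly_approx k \<rho> (\<lambda>z. inverse (1 - f z))"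
  by (rule poly_approx_compose_holomorphic[OF _ assms(3,1,2)]) (auto intro!: holomorphic_intros)

lemma poly_approx_continuous_0:
  assumes f: "poly_approx k \<rho> f" and \<rho>: "\<rho> > 0" and \<epsilon>: "\<epsilon> > 0"
  shows "\<exists>\<delta>>0. \<forall>z\<in>polydisc k \<delta>. norm (f z - f (\<lambda>_. 0)) < \<epsilon>"
proof -
  \<comment> \<open>Neighbourhoods of \<open>0\<close> in the first \<open>k\<close> coordinates;
    like \<open>polydisc\<close>, this filter ignores all further coordinates.\<close>
  define F where "F = filtercomap (\<lambda>z :: nat \<Rightarrow> complex. \<Sum>j=1..k. norm (z j)) (nhds (0 :: real))"
  have coord: "((\<lambda>z. z j) \<longlongrightarrow> 0) F" if "j \<in> {1..k}" for j
  proof (rule Lim_null_comparison)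
    show "((\<lambda>z. \<Sum>j=1..k. norm (z j)) \<longlongrightarrow> 0) F"
      unfolding F_def by (rule filterlim_filtercomap)
    show "\<forall>\<^sub>F z in F. norm (z j) \<le> (\<Sum>j=1..k. norm (z j))"
      using that by (intro always_eventually allI member_le_sum) auto
  qed
  have cont: "(p \<longlongrightarrow> p (\<lambda>_. 0)) F" if "p \<in> mpolys k" for p
    using that
  proof (induction rule: mpolys.induct)
    case (monomial c e)
    show ?case using coord by (intro tendsto_intros) auto
  qed (auto intro!: tendsto_intros)
  obtain p where p: "p \<in> mpolys k" "\<And>z. z \<in> polydisc k \<rho> \<Longrightarrow> norm (f z - p z) < \<epsilon> / 3"
    using poly_approxE[OF f, of "\<epsilon> / 3"] \<epsilon> by auto
  have "\<forall>\<^sub>F z in F. dist (p z) (p (\<lambda>_. 0)) < \<epsilon> / 3"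
    using tendstoD[OF cont[OF p(1)], of "\<epsilon> / 3"] \<epsilon> by simp
  then obtain d where d: "d > 0"
    "\<And>z. (\<Sum>j=1..k. norm (z j)) < d \<Longrightarrow> dist (p z) (p (\<lambda>_. 0)) < \<epsilon> / 3"
    unfolding F_def eventually_filtercomap eventually_nhds_metric
    by (force simp: dist_norm sum_nonneg)
  \<comment> \<open>\<open>k + 1\<close> keeps the denominator nonzero for \<open>k = 0\<close>, and
    the sum of the moduli stays below \<open>d\<close>; the bound \<open>\<rho>\<close> keeps
    \<open>z\<close> where \<open>p\<close> approximates \<open>f\<close>.\<close>
  define \<delta> where "\<delta> = min \<rho> (d / (2 * (real k + 1)))"
  have \<delta>: "\<delta> > 0" using \<rho> d by (simp add: \<delta>_def)
  have "norm (f z - f (\<lambda>_. 0)) < \<epsilon>" if z: "z \<in> polydisc k \<delta>" for z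
  proof -
    have "(\<Sum>j=1..k. norm (z j)) \<le> (\<Sum>j=1..k. d / (2 * (real k + 1)))"
      using z by (intro sum_mono) (auto simp: polydisc_def \<delta>_def)
    also have "\<dots> = d * (real k / (2 * (real k + 1)))" by simp
    also have "\<dots> < d * 1" using d(1) by (intro mult_strict_left_mono) (auto simp: divide_simps)
    also have "\<dots> = d" by simp
    finally have "norm (p z - p (\<lambda>_. 0)) < \<epsilon> / 3" using d(2) by (simp add: dist_norm)
    moreover have "norm (f z - p z) < \<epsilon> / 3"
      using z by (intro p) (auto simp: polydisc_def \<delta>_def)
    moreover have "norm (f (\<lambda>_. 0) - p (\<lambda>_. 0)) < \<epsilon> / 3"
      using \<rho> by (intro p) (auto simp: polydisc_def)
    ultimately show ?thesis
      using norm_triangle_ineq[of "f z - p z" "p z - f (\<lambda>_. 0)"]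
        norm_triangle_ineq[of "p z - p (\<lambda>_. 0)" "p (\<lambda>_. 0) - f (\<lambda>_. 0)"]
      by (simp add: norm_minus_commute)
  qed
  thus ?thesis using \<delta> by blast
qed

subsection \<open>Expansion of the Euler factors\<close>

text \<open>This is \<open>f = O(\<eta> ^ m)\<close> with a constant uniform on \<open>S\<close>. It
  is applied to pairs \<open>s = (z, P)\<close>, so that the constant depends neither on the tuple
  nor on the prime.\<close>

definition order_ge :: "'s set \<Rightarrow> ('s \<Rightarrow> real) \<Rightarrow> nat \<Rightarrow> ('s \<Rightarrow> complex) \<Rightarrow> bool" where
  "order_ge S \<eta> m f \<longleftrightarrow> (\<exists>C\<ge>0. \<forall>s\<in>S. norm (f s) \<le> C * \<eta> s ^ m)"

context
  fixes S :: "'s set" and \<eta> :: "'s \<Rightarrow> real" and R :: real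
  assumes \<eta>: "\<And>s. s \<in> S \<Longrightarrow> 0 \<le> \<eta> s \<and> \<eta> s \<le> R" and R: "R < 1"
begin

abbreviation ord where "ord \<equiv> order_ge S \<eta>"

lemma ord_add: "ord m f \<Longrightarrow> ord m g \<Longrightarrow> ord m (\<lambda>s. f s + g s)"
proof -
  assume "ord m f" "ord m g"
  then obtain C D where *: "C \<ge> 0" "D \<ge> 0" "\<And>s. s \<in> S \<Longrightarrow> norm (f s) \<le> C * \<eta> s ^ m"
    "\<And>s. s \<in> S \<Longrightarrow> norm (g s) \<le> D * \<eta> s ^ m" unfolding order_ge_def by blast
  have "norm (f s + g s) \<le> (C + D) * \<eta> s ^ m" if "s \<in> S" for s
    using *(3,4)[OF that] norm_triangle_ineq[of "f s" "g s"] by (simp add: distrib_right)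
  thus ?thesis unfolding order_ge_def using * by (intro exI[of _ "C + D"]) auto
qed

lemma ord_mult: "ord m f \<Longrightarrow> ord n g \<Longrightarrow> ord (m + n) (\<lambda>s. f s * g s)"
proof -
  assume "ord m f" "ord n g"
  then obtain C D where *: "C \<ge> 0" "D \<ge> 0" "\<And>s. s \<in> S \<Longrightarrow> norm (f s) \<le> C * \<eta> s ^ m"
    "\<And>s. s \<in> S \<Longrightarrow> norm (g s) \<le> D * \<eta> s ^ n" unfolding order_ge_def by blast
  have "norm (f s * g s) \<le> (C * D) * \<eta> s ^ (m + n)" if "s \<in> S" for s
  proof -
    have "norm (f s) * norm (g s) \<le> (C * \<eta> s ^ m) * (D * \<eta> s ^ n)"
      using *(1,2) \<eta>[OF that] by (intro mult_mono *(3,4)[OF that]) auto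
    thus ?thesis by (simp add: norm_mult power_add mult_ac)
  qed
  thus ?thesis unfolding order_ge_def using * by (intro exI[of _ "C * D"]) auto
qed

lemma ord_mult_11: "ord 1 f \<Longrightarrow> ord 1 g \<Longrightarrow> ord 2 (\<lambda>s. f s * g s)"
  using ord_mult[of 1 f 1 g] by (simp add: numeral_2_eq_2)

lemma ord_mono: "ord n f \<Longrightarrow> m \<le> n \<Longrightarrow> ord m f"
proof -
  assume "ord n f" and mn: "m \<le> n"
  then obtain C where *: "C \<ge> 0" "\<And>s. s \<in> S \<Longrightarrow> norm (f s) \<le> C * \<eta> s ^ n"
    unfolding order_ge_def by blast
  have "norm (f s) \<le> C * \<eta> s ^ m" if "s \<in> S" for s
  proof -
    have "C * \<eta> s ^ n \<le> C * \<eta> s ^ m"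
      using *(1) \<eta>[OF that] R mn by (intro mult_left_mono power_decreasing) auto
    thus ?thesis using *(2)[OF that] by simp
  qed
  thus ?thesis unfolding order_ge_def using * by blast
qed

lemma ord_const: "ord 0 (\<lambda>_. c)"
  unfolding order_ge_def by (intro exI[of _ "norm c"]) auto

lemma ord_cmult: "ord m f \<Longrightarrow> ord m (\<lambda>s. c * f s)"
  using ord_mult[OF ord_const] by simp

lemma ord_diff: "ord m f \<Longrightarrow> ord m g \<Longrightarrow> ord m (\<lambda>s. f s - g s)"
  using ord_add[OF _ ord_cmult[of m g "-1"]] by simp

lemma ord_zero: "ord m (\<lambda>_. 0)"
  unfolding order_ge_def by (intro exI[of _ 0]) auto

lemma ord_sum: "(\<And>a. a \<in> T \<Longrightarrow> ord m (f a)) \<Longrightarrow> ord m (\<lambda>s. \<Sum>a\<in>T. f a s)"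
  by (induction T rule: infinite_finite_induct) (auto intro!: ord_add ord_zero)

lemma ord_inverse_1_minus:
  assumes "\<And>s. s \<in> S \<Longrightarrow> norm (f s) \<le> \<eta> s"
  shows "ord 0 (\<lambda>s. inverse (1 - f s))"
proof -
  have "norm (inverse (1 - f s)) \<le> inverse (1 - R)" if "s \<in> S" for s
  proof -
    have "1 - R \<le> norm (1 - f s)"
      using assms[OF that] \<eta>[OF that] norm_triangle_ineq2[of 1 "f s"] by simp
    thus ?thesis using R by (simp add: norm_inverse le_imp_inverse_le)
  qed
  thus ?thesis unfolding order_ge_def using R by (intro exI[of _ "inverse (1 - R)"]) auto
qed

text \<open>Congruence modulo third order respects products of bounded functions, by
  \<open>f g - f' g' = (f - f') g + f' (g - g')\<close>.\<close>

lemma ord_cong_mult: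
  assumes "ord 3 (\<lambda>s. f s - f' s)" "ord 3 (\<lambda>s. g s - g' s)" "ord 0 g" "ord 0 f'"
  shows "ord 3 (\<lambda>s. f s * g s - f' s * g' s)"
proof -
  have "ord 3 (\<lambda>s. (f s - f' s) * g s + f' s * (g s - g' s))"
    using ord_mult[OF assms(1,3)] ord_mult[OF assms(4,2)] by (intro ord_add) simp_all
  thus ?thesis by (simp add: algebra_simps)
qed

lemma ord_cong_bounded: "ord 3 (\<lambda>s. f s - f' s) \<Longrightarrow> ord 0 f' \<Longrightarrow> ord 0 f"
  using ord_add[OF ord_mono[of 3 "\<lambda>s. f s - f' s" 0], of f'] by simp

lemma ord_cong_trans:
  "ord 3 (\<lambda>s. f s - g s) \<Longrightarrow> ord 3 (\<lambda>s. g s - h s) \<Longrightarrow> ord 3 (\<lambda>s. f s - h s)"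
  using ord_add[of 3 "\<lambda>s. f s - g s" "\<lambda>s. g s - h s"] by simp

text \<open>Products of two of the \<open>g a\<close> have order four and are absorbed.\<close>

lemma ord_prod_1_minus:
  assumes "finite T" "\<And>a. a \<in> T \<Longrightarrow> ord 3 (\<lambda>s. f a s - (1 - g a s))" "\<And>a. a \<in> T \<Longrightarrow> ord 2 (g a)"
  shows "ord 3 (\<lambda>s. (\<Prod>a\<in>T. f a s) - (1 - (\<Sum>a\<in>T. g a s)))"
  using assms
proof (induction T rule: finite_induct)
  case (insert a T)
  have ga: "ord 2 (g a)" and gT: "ord 2 (\<lambda>s. \<Sum>a\<in>T. g a s)"
    using insert.prems by (auto intro!: ord_sum)
  have IH: "ord 3 (\<lambda>s. (\<Prod>a\<in>T. f a s) - (1 - (\<Sum>a\<in>T. g a s)))"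
    using insert by auto
  have b: "ord 0 (\<lambda>s. \<Prod>a\<in>T. f a s)"
    by (rule ord_cong_bounded[OF IH]) (intro ord_diff ord_const ord_mono[OF gT], simp)
  have b': "ord 0 (\<lambda>s. 1 - g a s)"
    by (intro ord_diff ord_const ord_mono[OF ga]) simp
  have 1: "ord 3 (\<lambda>s. f a s * (\<Prod>a\<in>T. f a s) - (1 - g a s) * (1 - (\<Sum>a\<in>T. g a s)))"
    by (rule ord_cong_mult[OF _ IH b b']) (use insert.prems in auto)
  have 2: "ord 3 (\<lambda>s. (1 - g a s) * (1 - (\<Sum>a\<in>T. g a s)) - (1 - (g a s + (\<Sum>a\<in>T. g a s))))"
    using ord_mono[OF ord_mult[OF ga gT], of 3] by (simp add: algebra_simps)
  show ?case
    using ord_cong_trans[OF 1 2] insert.hyps by simp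
qed (simp add: ord_zero)

context
  fixes y :: "nat \<Rightarrow> 's \<Rightarrow> complex" and t :: "'s \<Rightarrow> complex" and k :: nat
  assumes y: "\<And>j s. j \<in> {1..k} \<Longrightarrow> s \<in> S \<Longrightarrow> norm (y j s) \<le> \<eta> s"
    and t: "\<And>s. s \<in> S \<Longrightarrow> norm (t s) \<le> \<eta> s ^ 2"
begin

lemma ord_y: "j \<in> {1..k} \<Longrightarrow> ord 1 (y j)"
  unfolding order_ge_def using y by (intro exI[of _ 1]) auto

lemma ord_t: "ord 2 t"
  unfolding order_ge_def using t by (intro exI[of _ 1]) auto

text \<open>The double sum is the complete homogeneous polynomial of degree 2 in the
  \<open>y j\<close>. Both signs are treated at once: as \<open>e * e = 1\<close>, the sign survives
  only in the linear term.\<close>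

lemma ord_prod_inverse_expansion:
  assumes "e = 1 \<or> e = -1"
  shows "m \<le> k \<Longrightarrow> ord 3 (\<lambda>s. (\<Prod>j=1..m. inverse (1 - e * y j s)) -
    (1 + e * (\<Sum>j=1..m. y j s) + (\<Sum>j=1..m. \<Sum>i=1..j. y i s * y j s)))"
proof (induction m)
  case (Suc m)
  define Y where "Y = y (Suc m)"
  define h1 where "h1 s = (\<Sum>j=1..m. y j s)" for s
  define h2 where "h2 s = (\<Sum>j=1..m. \<Sum>i=1..j. y i s * y j s)" for s
  have e2: "e * e = 1" and ne: "norm e = 1" using assms by auto
  have oY: "ord 1 Y" unfolding Y_def by (rule ord_y) (use Suc.prems in auto)
  have o1: "ord 1 h1" unfolding h1_def using Suc.prems by (intro ord_sum ord_y) auto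
  have o2: "ord 2 h2" unfolding h2_def using Suc.prems
    by (intro ord_sum ord_mult_11 ord_y) auto
  have Y1: "e * Y s \<noteq> 1" if "s \<in> S" for s
  proof
    assume "e * Y s = 1"
    hence "norm (Y s) = 1" using ne by (metis mult_1 norm_mult norm_one)
    moreover have "norm (Y s) \<le> \<eta> s" unfolding Y_def using Suc.prems that by (intro y) auto
    ultimately show False using \<eta>[OF that] R by simp
  qed
  have inv: "ord 0 (\<lambda>s. inverse (1 - e * Y s))"
    using Suc.prems y[of "Suc m"] by (intro ord_inverse_1_minus) (auto simp: norm_mult ne Y_def)
  \<comment> \<open>The tail of the geometric series after the quadratic term, simplified by
    \<open>e * e = 1\<close>.\<close>
  have "ord 3 (\<lambda>s. e * (Y s * Y s * Y s) * inverse (1 - e * Y s))"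
    using ord_mult[OF ord_cmult[OF ord_mult[OF ord_mult[OF oY oY] oY], of e] inv]
    by (simp add: numeral_3_eq_3)
  moreover have "e * (Y s * Y s * Y s) * inverse (1 - e * Y s) =
      inverse (1 - e * Y s) - (1 + e * Y s + Y s * Y s)" if "s \<in> S" for s
  proof -
    have "(1 - e * Y s) * (1 + e * Y s + Y s * Y s) = 1 - e * (Y s * Y s * Y s) + (1 - e * e) * (Y s * Y s)"
      by (simp add: algebra_simps)
    also have "\<dots> = 1 - e * (Y s * Y s * Y s)" by (simp add: e2)
    finally show ?thesis using Y1[OF that] by (simp add: field_simps)
  qed
  ultimately have exp: "ord 3 (\<lambda>s. inverse (1 - e * Y s) - (1 + e * Y s + Y s * Y s))"
    unfolding order_ge_def by simp
  have b: "ord 0 (\<lambda>s. 1 + e * h1 s + h2 s)"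
    by (intro ord_add ord_const ord_cmult ord_mono[OF o1] ord_mono[OF o2]) auto
  have "ord 3 (\<lambda>s. (\<Prod>j=1..m. inverse (1 - e * y j s)) - (1 + e * h1 s + h2 s))"
    using Suc by (auto simp: h1_def h2_def)
  from ord_cong_mult[OF this exp inv b]
  have 1: "ord 3 (\<lambda>s. (\<Prod>j=1..m. inverse (1 - e * y j s)) * inverse (1 - e * Y s) -
      (1 + e * h1 s + h2 s) * (1 + e * Y s + Y s * Y s))" .
  \<comment> \<open>The terms of order at least three in the product of the two expansions.\<close>
  have "ord 3 (\<lambda>s. e * (h1 s * Y s * Y s) + e * (h2 s * Y s) + h2 s * (Y s * Y s))"
    using ord_mult[OF ord_mult[OF o1 oY] oY] ord_mult[OF o2 oY]
      ord_mono[OF ord_mult[OF o2 ord_mult[OF oY oY]], of 3]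
    by (intro ord_add ord_cmult) (simp_all add: numeral_3_eq_3)
  moreover have "(1 + e * h1 s + h2 s) * (1 + e * Y s + Y s * Y s) -
      (1 + e * (h1 s + Y s) + (h2 s + h1 s * Y s + Y s * Y s)) =
      (e * (h1 s * Y s * Y s) + e * (h2 s * Y s) + h2 s * (Y s * Y s)) + (e * e - 1) * (h1 s * Y s)" for s
    by (simp add: algebra_simps)
  ultimately have 2: "ord 3 (\<lambda>s. (1 + e * h1 s + h2 s) * (1 + e * Y s + Y s * Y s) -
      (1 + e * (h1 s + Y s) + (h2 s + h1 s * Y s + Y s * Y s)))"
    by (simp add: e2)
  have eqs: "(\<Sum>j=1..Suc m. y j s) = h1 s + Y s"
    "(\<Sum>j=1..Suc m. \<Sum>i=1..j. y i s * y j s) = h2 s + h1 s * Y s + Y s * Y s"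
    "(\<Prod>j=1..Suc m. inverse (1 - e * y j s)) = (\<Prod>j=1..m. inverse (1 - e * y j s)) * inverse (1 - e * Y s)" for s
    by (simp_all add: h1_def h2_def Y_def sum_distrib_right)
  show ?case unfolding eqs by (rule ord_cong_trans[OF 1 2])
qed (simp add: ord_zero)

text \<open>Averaging over the two signs removes \<open>h1\<close> and leaves
  \<open>1 + h2 + t\<close>; the pair product contributes \<open>1 - h2\<close> and the last factor
  \<open>1 - t\<close>. All terms of order two cancel.\<close>

lemma ord_euler_expansion:
  "ord 3 (\<lambda>s. (\<Prod>j=1..k. \<Prod>i=1..j. 1 - y i s * y j s) *
     ((1/2) * ((\<Prod>j=1..k. inverse (1 - y j s)) + (\<Prod>j=1..k. inverse (1 + y j s))) + t s) *
     inverse (1 + t s) - 1)"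
proof -
  define h1 where "h1 s = (\<Sum>j=1..k. y j s)" for s
  define h2 where "h2 s = (\<Sum>j=1..k. \<Sum>i=1..j. y i s * y j s)" for s
  have o2: "ord 2 h2" unfolding h2_def
    by (intro ord_sum ord_mult_11 ord_y) auto
  have plus: "ord 3 (\<lambda>s. (\<Prod>j=1..k. inverse (1 - y j s)) - (1 + h1 s + h2 s))"
    using ord_prod_inverse_expansion[of 1 k] by (simp add: h1_def h2_def)
  have minus: "ord 3 (\<lambda>s. (\<Prod>j=1..k. inverse (1 + y j s)) - (1 - h1 s + h2 s))"
    using ord_prod_inverse_expansion[of "-1" k] by (simp add: h1_def h2_def)
  have mid: "ord 3 (\<lambda>s. ((1/2) * ((\<Prod>j=1..k. inverse (1 - y j s)) + (\<Prod>j=1..k. inverse (1 + y j s))) + t s) -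
      (1 + h2 s + t s))"
    using ord_cmult[OF ord_add[OF plus minus], of "1/2"] by (simp add: algebra_simps)
  have pairs: "ord 3 (\<lambda>s. (\<Prod>j=1..k. \<Prod>i=1..j. 1 - y i s * y j s) - (1 - h2 s))"
    unfolding h2_def
  proof (rule ord_prod_1_minus)
    fix j assume j: "j \<in> {1..k}"
    have yy: "ord 2 (\<lambda>s. y i s * y j s)" if "i \<in> {1..j}" for i
      using that j by (intro ord_mult_11 ord_y) auto
    thus "ord 2 (\<lambda>s. \<Sum>i=1..j. y i s * y j s)" by (rule ord_sum)
    show "ord 3 (\<lambda>s. (\<Prod>i=1..j. 1 - y i s * y j s) - (1 - (\<Sum>i=1..j. y i s * y j s)))"
      using yy by (intro ord_prod_1_minus) (auto simp: ord_zero)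
  qed simp
  have small: "norm (t s) \<le> \<eta> s" if "s \<in> S" for s
  proof -
    have "\<eta> s ^ 2 \<le> \<eta> s" using \<eta>[OF that] R by (simp add: power2_eq_square mult_left_le)
    thus ?thesis using t[OF that] by simp
  qed
  have inv: "ord 0 (\<lambda>s. inverse (1 + t s))"
    using ord_inverse_1_minus[of "\<lambda>s. - t s"] small by simp
  have "ord 3 (\<lambda>s. t s * t s * inverse (1 + t s))"
    using ord_mono[OF ord_mult[OF ord_mult[OF ord_t ord_t] inv], of 3] by simp
  moreover have "t s * t s * inverse (1 + t s) = inverse (1 + t s) - (1 - t s)" if "s \<in> S" for s
  proof -
    have "1 + t s \<noteq> 0"
    proof
      assume "1 + t s = 0"
      hence "norm (t s) = 1" by (metis add_eq_0_iff norm_minus_cancel norm_one)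
      thus False using small[OF that] \<eta>[OF that] R by simp
    qed
    thus ?thesis by (simp add: field_simps)
  qed
  ultimately have it: "ord 3 (\<lambda>s. inverse (1 + t s) - (1 - t s))"
    unfolding order_ge_def by simp
  have bmid': "ord 0 (\<lambda>s. 1 + h2 s + t s)"
    by (intro ord_add ord_const ord_mono[OF o2] ord_mono[OF ord_t]) auto
  have bpairs': "ord 0 (\<lambda>s. 1 - h2 s)"
    by (intro ord_diff ord_const ord_mono[OF o2]) auto
  note bmid = ord_cong_bounded[OF mid bmid']
  have 1: "ord 3 (\<lambda>s. (\<Prod>j=1..k. \<Prod>i=1..j. 1 - y i s * y j s) *
     ((1/2) * ((\<Prod>j=1..k. inverse (1 - y j s)) + (\<Prod>j=1..k. inverse (1 + y j s))) + t s) - (1 + t s))"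
  proof (rule ord_cong_trans[OF ord_cong_mult[OF pairs mid bmid bpairs']])
    have "ord 3 (\<lambda>s. -1 * (h2 s * h2 s) - h2 s * t s)"
      using ord_mono[OF ord_mult[OF o2 o2], of 3] ord_mono[OF ord_mult[OF o2 ord_t], of 3]
      by (intro ord_diff ord_cmult) auto
    thus "ord 3 (\<lambda>s. (1 - h2 s) * (1 + h2 s + t s) - (1 + t s))"
      by (simp add: algebra_simps)
  qed
  have bt: "ord 0 (\<lambda>s. 1 + t s)"
    by (intro ord_add ord_const ord_mono[OF ord_t]) auto
  show ?thesis
  proof (rule ord_cong_trans[OF ord_cong_mult[OF 1 it inv bt]])
    have "ord 3 (\<lambda>s. -1 * (t s * t s))"
      using ord_mono[OF ord_mult[OF ord_t ord_t], of 3] by (intro ord_cmult) auto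
    thus "ord 3 (\<lambda>s. (1 + t s) * (1 - t s) - 1)"
      by (simp add: algebra_simps)
  qed
qed

end

end

section \<open>A uniform bound for the Euler factors in terms of the norm of the prime\<close>

lemma card_field_ge_2: "CARD('a::{finite,field_gcd}) \<ge> 2"
proof -
  have "card {0, 1 :: 'a} \<le> CARD('a)" by (intro card_mono) auto
  thus ?thesis by simp
qed

lemma pabs_ge_2: "(P :: 'a::{finite,field_gcd} poly) \<in> mon_irr \<Longrightarrow> pabs P \<ge> 2"
proof -
  assume "P \<in> mon_irr"
  hence "degree P \<ge> 1" using mon_irr_degree_pos[of P] by simp
  hence "real CARD('a) ^ 1 \<le> real CARD('a) ^ degree P"
    using card_field_ge_2[where ?'a = 'a] by (intro power_increasing) auto
  moreover have "real CARD('a) \<ge> 2" using card_field_ge_2[where ?'a = 'a] by linarith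
  ultimately show "pabs P \<ge> 2" unfolding pabs_def power_one_right by linarith
qed

text \<open>For \<open>|z j| \<le> 1/12\<close> the powers \<open>|P|^(-1/2 - z j)\<close> have
  modulus at most \<open>|P|^(-5/12)\<close>, with cube \<open>|P|^(-5/4)\<close>. The exponent lies
  below \<open>-1\<close>, as summation over all primes demands; any radius below \<open>1/6\<close>
  achieves this.\<close>

lemma euler_factor_bound:
  "\<exists>C\<ge>0. \<forall>z\<in>polydisc k (1/12). \<forall>P\<in>(mon_irr :: 'a::{finite,field_gcd} poly set).
     norm (euler_factor k z P - 1) \<le> C * pabs P powr (-5/4)"
proof -
  define S where "S = polydisc k (1/12) \<times> (mon_irr :: 'a poly set)"
  define N where "N s = pabs (snd s)" for s :: "(nat \<Rightarrow> complex) \<times> 'a poly"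
  define \<eta> where "\<eta> s = N s powr (-5/12)" for s :: "(nat \<Rightarrow> complex) \<times> 'a poly"
  define y where "y j s = complex_of_real (N s) powr (-1/2 - fst s j)" for j and s :: "(nat \<Rightarrow> complex) \<times> 'a poly"
  define t where "t s = 1 / complex_of_real (N s)" for s :: "(nat \<Rightarrow> complex) \<times> 'a poly"
  have N2: "N s \<ge> 2" if "s \<in> S" for s
    using that pabs_ge_2 by (auto simp: S_def N_def)
  \<comment> \<open>Every \<open>pabs P\<close> is at least 2, which gives one bound below 1 on all
    of \<open>S\<close>.\<close>
  have \<eta>: "0 \<le> \<eta> s \<and> \<eta> s \<le> 2 powr (-5/12)" if "s \<in> S" for s
    unfolding \<eta>_def using N2[OF that] by (auto intro!: powr_mono2')
  have "(2::real) powr (-5/12) < 2 powr 0"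
    by (rule powr_less_mono) auto
  hence R: "(2::real) powr (-5/12) < 1" by simp
  have y: "norm (y j s) \<le> \<eta> s" if "j \<in> {1..k}" "s \<in> S" for j s
  proof -
    have "norm (fst s j) \<le> 1/12" using that by (auto simp: S_def polydisc_def)
    hence "-1/2 - Re (fst s j) \<le> -5/12" using abs_Re_le_cmod[of "fst s j"] by linarith
    moreover have "norm (y j s) = N s powr (-1/2 - Re (fst s j))"
      using N2[OF that(2)] by (simp add: y_def norm_powr_real_powr)
    moreover have "N s \<ge> 1" using N2[OF that(2)] by simp
    ultimately show ?thesis
      unfolding \<eta>_def by (simp only: powr_mono)
  qed
  \<comment> \<open>\<open>t\<close> counts as order two because
    \<open>|P|^(-1) \<le> |P|^(-5/6)\<close>.\<close>
  have t: "norm (t s) \<le> \<eta> s ^ 2" if "s \<in> S" for s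
  proof -
    have "norm (t s) = N s powr (-1)"
      using N2[OF that] by (simp add: t_def norm_divide powr_minus_divide)
    also have "\<dots> \<le> N s powr (-5/12 * 2)"
      using N2[OF that] by (intro powr_mono) auto
    also have "\<dots> = \<eta> s ^ 2"
      using N2[OF that] unfolding \<eta>_def by (simp only: powr_powr[symmetric]) (simp add: powr_numeral)
    finally show ?thesis .
  qed
  have yy: "y i s * y j s = complex_of_real (N s) powr (-1 - fst s i - fst s j)" for i j s
    unfolding y_def powr_add[symmetric] by (simp add: algebra_simps)
  have "order_ge S \<eta> 3 (\<lambda>s. euler_factor k (fst s) (snd s) - 1)"
    using ord_euler_expansion[OF \<eta> R y t]
    unfolding yy by (simp add: euler_factor_def y_def t_def N_def)
  then obtain C where C: "C \<ge> 0" "\<And>s. s \<in> S \<Longrightarrow> norm (euler_factor k (fst s) (snd s) - 1) \<le> C * \<eta> s ^ 3"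
    unfolding order_ge_def by blast
  have "\<eta> s ^ 3 = N s powr (-5/4)" if "s \<in> S" for s
  proof -
    have "N s powr (-5/4) = N s powr (-5/12 * 3)" by simp
    also have "\<dots> = \<eta> s ^ 3"
      using N2[OF that] unfolding \<eta>_def by (simp only: powr_powr[symmetric]) (simp add: powr_numeral)
    finally show ?thesis by simp
  qed
  hence "norm (euler_factor k z P - 1) \<le> C * pabs P powr (-5/4)"
    if "z \<in> polydisc k (1/12)" "P \<in> mon_irr" for z and P :: "'a poly"
    using C(2)[of "(z, P)"] that by (auto simp: S_def N_def)
  thus ?thesis using C(1) by blast
qed

subsection \<open>Convergence of the Euler product\<close>

lemma norm_prod_minus_1_le:
  fixes f :: "'b \<Rightarrow> complex"
  shows "norm ((\<Prod>a\<in>A. 1 + f a) - 1) \<le> (\<Prod>a\<in>A. 1 + norm (f a)) - 1"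
proof (induction A rule: infinite_finite_induct)
  case (insert a A)
  have "(1 + f a) * (\<Prod>a\<in>A. 1 + f a) - 1 = (1 + f a) * ((\<Prod>a\<in>A. 1 + f a) - 1) + f a"
    by (simp add: algebra_simps)
  also have "norm \<dots> \<le> norm (1 + f a) * norm ((\<Prod>a\<in>A. 1 + f a) - 1) + norm (f a)"
    using norm_triangle_ineq[of "(1 + f a) * ((\<Prod>a\<in>A. 1 + f a) - 1)" "f a"] by (simp only: norm_mult)
  also have "\<dots> \<le> (1 + norm (f a)) * ((\<Prod>a\<in>A. 1 + norm (f a)) - 1) + norm (f a)"
    using insert.IH norm_triangle_ineq[of 1 "f a"] by (intro add_right_mono mult_mono) auto
  also have "\<dots> = (1 + norm (f a)) * (\<Prod>a\<in>A. 1 + norm (f a)) - 1"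
    by (simp add: algebra_simps)
  finally show ?case using insert.hyps by simp
qed auto

text \<open>Successive partial products differ by at most \<open>exp (suminf b) * b n\<close>, so
  the telescoping series converges uniformly by the M-test.\<close>

lemma uniform_limit_prodinf_of_summable:
  fixes a :: "nat \<Rightarrow> 's \<Rightarrow> complex"
  assumes a: "\<And>n x. x \<in> X \<Longrightarrow> norm (a n x - 1) \<le> b n" and b: "summable b"
  shows "\<And>x. x \<in> X \<Longrightarrow> convergent_prod (\<lambda>n. a n x)"
    and "uniform_limit X (\<lambda>N x. \<Prod>n<N. a n x) (\<lambda>x. prodinf (\<lambda>n. a n x)) sequentially"
proof -
  show conv: "convergent_prod (\<lambda>n. a n x)" if "x \<in> X" for x
  proof -
    have "summable (\<lambda>n. norm (a n x - 1))"
      using a[OF that] by (intro summable_comparison_test'[OF b]) auto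
    thus ?thesis
      by (intro abs_convergent_prod_imp_convergent_prod) (simp add: abs_convergent_prod_conv_summable)
  qed
  show "uniform_limit X (\<lambda>N x. \<Prod>n<N. a n x) (\<lambda>x. prodinf (\<lambda>n. a n x)) sequentially"
  proof (cases "X = {}")
    case False
    then obtain x0 where "x0 \<in> X" by blast
    \<comment> \<open>Nonnegativity of \<open>b\<close> is read off at a point of \<open>X\<close>,
      hence the separate case of empty \<open>X\<close>.\<close>
    hence b0: "b n \<ge> 0" for n using a[of x0 n] norm_ge_zero order.trans by blast
    define p where "p N x = (\<Prod>n<N. a n x)" for N x
    have p_bound: "norm (p N x) \<le> exp (suminf b)" if "x \<in> X" for N x
    proof -
      have "norm (p N x) = (\<Prod>n<N. norm (a n x))" by (simp add: p_def prod_norm)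
      also have "\<dots> \<le> (\<Prod>n<N. 1 + b n)"
      proof (intro prod_mono conjI norm_ge_zero)
        fix n show "norm (a n x) \<le> 1 + b n"
          using a[OF that, of n] norm_triangle_ineq[of "a n x - 1" 1] by simp
      qed
      also have "\<dots> \<le> exp (\<Sum>n<N. b n)" by (rule prod_le_exp_sum) (use b0 in auto)
      also have "\<dots> \<le> exp (suminf b)" using b b0 by (simp add: sum_le_suminf)
      finally show ?thesis .
    qed
    have step: "norm (p (Suc n) x - p n x) \<le> exp (suminf b) * b n" if "x \<in> X" for n x
    proof -
      have "p (Suc n) x - p n x = p n x * (a n x - 1)" by (simp add: p_def algebra_simps)
      thus ?thesis using p_bound[OF that, of n] a[OF that, of n] by (simp add: norm_mult mult_mono)
    qed
    have "uniform_limit X (\<lambda>N x. \<Sum>n<N. p (Suc n) x - p n x) (\<lambda>x. suminf (\<lambda>n. p (Suc n) x - p n x)) sequentially"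
      using step b by (intro Weierstrass_m_test[where M = "\<lambda>n. exp (suminf b) * b n"] summable_mult)
    hence "uniform_limit X (\<lambda>N x. 1 + (\<Sum>n<N. p (Suc n) x - p n x)) (\<lambda>x. 1 + suminf (\<lambda>n. p (Suc n) x - p n x)) sequentially"
      by (intro uniform_limit_add uniform_limit_const)
    moreover have "1 + (\<Sum>n<N. p (Suc n) x - p n x) = p N x" for N x
      using sum_lessThan_telescope[of "\<lambda>n. p n x" N] by (simp add: p_def del: sum_lessThan_telescope prod.lessThan_Suc)
    ultimately have lim: "uniform_limit X p (\<lambda>x. 1 + suminf (\<lambda>n. p (Suc n) x - p n x)) sequentially"
      by simp
    have "1 + suminf (\<lambda>n. p (Suc n) x - p n x) = prodinf (\<lambda>n. a n x)" if "x \<in> X" for x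
    proof (rule LIMSEQ_unique)
      show "(\<lambda>N. p N x) \<longlonglongrightarrow> 1 + suminf (\<lambda>n. p (Suc n) x - p n x)"
        by (rule tendsto_uniform_limitI[OF lim that])
      show "(\<lambda>N. p N x) \<longlonglongrightarrow> prodinf (\<lambda>n. a n x)"
        unfolding p_def using convergent_prod_LIMSEQ[OF conv[OF that]]
        by (subst LIMSEQ_lessThan_iff_atMost)
    qed
    thus ?thesis using lim unfolding uniform_limit_iff p_def[symmetric] by simp
  qed auto
qed

definition euler_deg :: "'a::{finite,field_gcd} itself \<Rightarrow> nat \<Rightarrow> nat \<Rightarrow> (nat \<Rightarrow> complex) \<Rightarrow> complex" where
  "euler_deg _ k n z = (\<Prod>P\<in>{P \<in> mon_irr. degree P = n}. euler_factor k z (P :: 'a poly))"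

lemma finite_mon_irr_deg: "finite {P \<in> (mon_irr :: 'a::{finite,field_gcd} poly set). degree P = n}"
  and card_mon_irr_deg: "card {P \<in> (mon_irr :: 'a poly set). degree P = n} \<le> CARD('a) ^ n"
proof -
  have sub: "{P \<in> (mon_irr :: 'a poly set). degree P = n} \<subseteq> monics_deg n"
    by (auto simp: mon_irr_def monics_deg_def)
  show "finite {P \<in> (mon_irr :: 'a poly set). degree P = n}"
    by (rule finite_subset[OF sub finite_monics_deg])
  show "card {P \<in> (mon_irr :: 'a poly set). degree P = n} \<le> CARD('a) ^ n"
    using card_mono[OF finite_monics_deg sub] by (simp add: card_monics_deg)
qed

text \<open>There are at most \<open>q^n\<close> primes of degree \<open>n\<close>, each with a
  factor within \<open>C q^(-5n/4)\<close> of 1; the total \<open>C q^(-n/4)\<close> is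
  geometric.\<close>

lemma euler_deg_bound:
  "\<exists>b. summable b \<and> (\<forall>n. \<forall>z\<in>polydisc k (1/12). norm (euler_deg TYPE('a::{finite,field_gcd}) k n z - 1) \<le> b n)"
proof -
  define q where "q = real CARD('a)"
  have q: "q \<ge> 2" using card_field_ge_2[where ?'a = 'a] by (simp add: q_def)
  obtain C where C: "C \<ge> 0" "\<And>z P. z \<in> polydisc k (1/12) \<Longrightarrow> P \<in> (mon_irr :: 'a poly set) \<Longrightarrow>
      norm (euler_factor k z P - 1) \<le> C * pabs P powr (-5/4)"
    using euler_factor_bound[of k, where ?'a = 'a] by blast
  define c where "c = q powr (-1/4)"
  have c: "0 < c" "c < 1"
  proof -
    have "q powr (-1/4) < q powr 0" using q by (intro powr_less_mono) auto
    thus "0 < c" "c < 1" using q by (auto simp: c_def)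
  qed
  have "norm (euler_deg TYPE('a) k n z - 1) \<le> C * exp C * c ^ n" if z: "z \<in> polydisc k (1/12)" for n z
  proof -
    let ?P = "{P \<in> (mon_irr :: 'a poly set). degree P = n}"
    define x where "x = (\<Sum>P\<in>?P. norm (euler_factor k z P - 1))"
    have "x \<le> (\<Sum>P\<in>?P. C * (q ^ n) powr (-5/4))"
      unfolding x_def using C(2)[OF z] by (intro sum_mono) (auto simp: pabs_def q_def)
    also have "\<dots> \<le> q ^ n * (C * (q ^ n) powr (-5/4))"
      using card_mon_irr_deg[of n, where ?'a = 'a] C(1) unfolding sum_constant q_def
      by (intro mult_right_mono) (auto simp flip: of_nat_power)
    also have "\<dots> = C * c ^ n"
    proof -
      have "q ^ n * (q ^ n) powr (-5/4) = (q ^ n) powr (1 + (-5/4))"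
        using q by (subst powr_add) auto
      also have "\<dots> = c ^ n"
        using q by (simp add: c_def powr_realpow[symmetric] powr_powr mult.commute)
      finally show ?thesis by (simp add: mult_ac)
    qed
    finally have x: "x \<le> C * c ^ n" .
    also have "\<dots> \<le> C" using c C(1) by (intro mult_left_le power_le_one) auto
    finally have xC: "x \<le> C" .
    have x0: "x \<ge> 0" unfolding x_def by (intro sum_nonneg) auto
    have "norm (euler_deg TYPE('a) k n z - 1) = norm ((\<Prod>P\<in>?P. 1 + (euler_factor k z P - 1)) - 1)"
      by (simp add: euler_deg_def)
    also have "\<dots> \<le> (\<Prod>P\<in>?P. 1 + norm (euler_factor k z P - 1)) - 1"
      by (rule norm_prod_minus_1_le)
    also have "\<dots> \<le> exp x - 1"
      unfolding x_def by (intro diff_right_mono prod_le_exp_sum) auto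
    \<comment> \<open>Together with \<open>x \<le> C\<close> this turns the exponential bound into
      one that is linear in \<open>x\<close>.\<close>
    also have "exp x - 1 \<le> x * exp x"
    proof -
      have "1 - x \<le> exp (- x)" using exp_ge_add_one_self[of "-x"] by simp
      hence "(1 - x) * exp x \<le> exp (- x) * exp x" by (intro mult_right_mono) auto
      thus ?thesis by (simp add: exp_minus algebra_simps)
    qed
    also have "\<dots> \<le> (C * c ^ n) * exp C"
      using x xC x0 by (intro mult_mono) auto
    finally show ?thesis by (simp add: mult_ac)
  qed
  moreover have "summable (\<lambda>n. C * exp C * c ^ n)"
    using c by (intro summable_mult summable_geometric) auto
  ultimately show ?thesis by blast
qed

text \<open>Powers of \<open>|P|\<close> are exponentials of linear forms. The inverses are
  geometric series, since their arguments are bounded by \<open>|P|^(-5/12) < 1\<close> on the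
  polydisc.\<close>

lemma euler_factor_poly_approx:
  assumes P: "(P :: 'a::{finite,field_gcd} poly) \<in> mon_irr"
  shows "poly_approx k (1/12) (\<lambda>z. euler_factor k z P)"
proof -
  define N where "N = pabs P"
  have N: "N \<ge> 2" using pabs_ge_2[OF P] by (simp add: N_def)
  have pw: "complex_of_real N powr w = exp (w * of_real (ln N))" for w
    using N by (simp add: powr_def Ln_of_real)
  have half: "poly_approx k (1/12) (\<lambda>z. complex_of_real N powr (-1/2 - z j))" if "j \<in> {1..k}" for j
    unfolding pw using that
    by (intro poly_approx_exp poly_approx_mult poly_approx_diff poly_approx_const poly_approx_coord)
  have bound: "norm (complex_of_real N powr (-1/2 - z j)) \<le> N powr (-5/12)"
    if "j \<in> {1..k}" "z \<in> polydisc k (1/12)" for j z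
  proof -
    have "norm (z j) \<le> 1/12" using that by (auto simp: polydisc_def)
    hence "-1/2 - Re (z j) \<le> -5/12" using abs_Re_le_cmod[of "z j"] by linarith
    hence "N powr (-1/2 - Re (z j)) \<le> N powr (-5/12)" using N by (intro powr_mono) auto
    thus ?thesis using N by (simp add: norm_powr_real_powr)
  qed
  have "N powr (-5/12) < N powr 0" using N by (intro powr_less_mono) auto
  hence R: "N powr (-5/12) < 1" using N by simp
  have inv: "poly_approx k (1/12) (\<lambda>z. inverse (1 - complex_of_real N powr (-1/2 - z j)))" if "j \<in> {1..k}" for j
    using that by (intro poly_approx_inverse_1_minus[OF half bound R])
  have "poly_approx k (1/12) (\<lambda>z. inverse (1 - (- 1) * complex_of_real N powr (-1/2 - z j)))" if "j \<in> {1..k}" for j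
    using that bound
    by (intro poly_approx_inverse_1_minus[OF poly_approx_mult[OF poly_approx_const half] _ R]) (auto simp: norm_mult)
  hence inv': "poly_approx k (1/12) (\<lambda>z. inverse (1 + complex_of_real N powr (-1/2 - z j)))" if "j \<in> {1..k}" for j
    using that by simp
  have "poly_approx k (1/12) (\<lambda>z. complex_of_real N powr (-1 - z i - z j))" if "j \<in> {1..k}" "i \<in> {1..j}" for i j
    unfolding pw using that
    by (intro poly_approx_exp poly_approx_mult poly_approx_diff poly_approx_const poly_approx_coord) auto
  thus ?thesis
    unfolding euler_factor_def N_def[symmetric] using inv inv'
    by (intro poly_approx_mult poly_approx_prod poly_approx_diff poly_approx_add poly_approx_const)
qed

lemma eulerA_conv: "z \<in> polydisc k (1/12) \<Longrightarrow> convergent_prod (\<lambda>n. euler_deg TYPE('a::{finite,field_gcd}) k n z)"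
  and eulerA_poly_approx: "poly_approx k (1/12) (eulerA TYPE('a) k)"
proof -
  obtain b where b: "summable b"
    "\<And>n z. z \<in> polydisc k (1/12) \<Longrightarrow> norm (euler_deg TYPE('a) k n z - 1) \<le> b n"
    using euler_deg_bound[of k, where ?'a = 'a] by blast
  show "convergent_prod (\<lambda>n. euler_deg TYPE('a) k n z)" if "z \<in> polydisc k (1/12)"
    by (rule uniform_limit_prodinf_of_summable(1)[of "polydisc k (1/12)" "euler_deg TYPE('a) k" b])
       (use b that in auto)
  have "uniform_limit (polydisc k (1/12)) (\<lambda>N z. \<Prod>n<N. euler_deg TYPE('a) k n z)
      (\<lambda>z. prodinf (\<lambda>n. euler_deg TYPE('a) k n z)) sequentially"
    by (rule uniform_limit_prodinf_of_summable(2)[of "polydisc k (1/12)" "euler_deg TYPE('a) k" b])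
       (use b in auto)
  hence "poly_approx k (1/12) (\<lambda>z. prodinf (\<lambda>n. euler_deg TYPE('a) k n z))"
    by (rule poly_approx_uniform_limit)
       (auto simp: euler_deg_def intro!: poly_approx_prod euler_factor_poly_approx)
  thus "poly_approx k (1/12) (eulerA TYPE('a) k)"
    by (simp add: eulerA_def[abs_def] euler_deg_def)
qed

text \<open>Needed to divide by the leading constant. At \<open>z = 0\<close> every factor is a
  positive real, and \<open>convergent_prod\<close> rules out convergence to \<open>0\<close> when
  no factor vanishes.\<close>

lemma eulerA_0_nonzero: "eulerA TYPE('a::{finite,field_gcd}) k (\<lambda>_. 0) \<noteq> 0"
proof -
  have "euler_factor k (\<lambda>_. 0) P \<noteq> 0" if P: "(P :: 'a poly) \<in> mon_irr" for P
  proof -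
    define N where "N = pabs P"
    have N: "N \<ge> 2" using pabs_ge_2[OF P] by (simp add: N_def)
    have m1: "complex_of_real N powr (-1) = of_real (N powr (-1))"
      and mh: "complex_of_real N powr (-1/2) = of_real (N powr (-1/2))"
      using N powr_of_real[of N "-1"] powr_of_real[of N "-1/2"] by auto
    have "N powr (-1/2) < N powr 0" "N powr (-1) < N powr 0"
      using N by (intro powr_less_mono; simp)+
    hence lt: "N powr (-1/2) < 1" "N powr (-1) < 1" using N by auto
    define F where "F = (\<Prod>j=1..k. \<Prod>i=1..j. 1 - N powr (-1)) *
      ((1/2) * ((\<Prod>j=1..k. inverse (1 - N powr (-1/2))) + (\<Prod>j=1..k. inverse (1 + N powr (-1/2)))) + 1 / N) *
      inverse (1 + 1 / N)"
    have "F > 0" unfolding F_def using lt N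
      by (intro mult_pos_pos add_pos_pos prod_pos ballI) (auto intro!: add_pos_pos)
    moreover have "euler_factor k (\<lambda>_. 0) P = of_real F"
      unfolding euler_factor_def F_def N_def[symmetric] using m1 mh by simp
    ultimately show ?thesis by simp
  qed
  hence "euler_deg TYPE('a) k n (\<lambda>_. 0) \<noteq> 0" for n
    using finite_mon_irr_deg[of n, where ?'a = 'a] by (auto simp: euler_deg_def)
  moreover have "convergent_prod (\<lambda>n. euler_deg TYPE('a) k n (\<lambda>_. 0))"
    by (rule eulerA_conv) (simp add: polydisc_def)
  ultimately have "prodinf (\<lambda>n. euler_deg TYPE('a) k n (\<lambda>_. 0)) \<noteq> 0"
    by (intro prodinf_nonzero)
  thus ?thesis by (simp add: eulerA_def euler_deg_def)
qed

subsection \<open>Determinants\<close>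

text \<open>Passing from monomials to another monic basis multiplies the matrix by a unitriangular
  one. Monomials give the expansion of \<open>vandermonde\<close>, falling factorials the
  determinant of inverse factorials.\<close>

lemma vandermonde_monic_basis:
  fixes p :: "nat \<Rightarrow> 'a::idom poly" and x :: "nat \<Rightarrow> 'a"
  assumes deg: "\<And>j. j < k \<Longrightarrow> degree (p j) = j" and lc: "\<And>j. j < k \<Longrightarrow> lead_coeff (p j) = 1"
  shows "(\<Sum>\<sigma> | \<sigma> permutes {0..<k}. of_int (sign \<sigma>) * (\<Prod>i<k. poly (p (\<sigma> i)) (x i))) =
    (\<Prod>j<k. \<Prod>i<j. x j - x i)"
proof -
  define M where "M p = mat k k (\<lambda>(i, j). poly (p j) (x i))" for p :: "nat \<Rightarrow> 'a poly"
  define V where "V = mat k k (\<lambda>(i, j). x i ^ j)"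
  have M_carrier: "M p \<in> carrier_mat k k" for p
    by (simp add: M_def)
  have V_carrier: "V \<in> carrier_mat k k"
    by (simp add: V_def)
  have det_M: "Determinant.det (M p) = Determinant.det V"
    if deg: "\<And>j. j < k \<Longrightarrow> degree (p j) = j" and lc: "\<And>j. j < k \<Longrightarrow> lead_coeff (p j) = 1" for p
  proof -
    define C where "C = mat k k (\<lambda>(i, j). coeff (p j) i)"
    have C_carrier: "C \<in> carrier_mat k k"
      by (simp add: C_def)
    have "M p = V * C"
    proof (rule eq_matI)
      fix i j assume "i < dim_row (V * C)" "j < dim_col (V * C)"
      hence ij: "i < k" "j < k" by (auto simp: V_def C_def)
      have "poly (p j) (x i) = (\<Sum>l\<le>j. coeff (p j) l * x i ^ l)"
        using deg[OF ij(2)] by (simp add: poly_altdef)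
      also have "\<dots> = (\<Sum>l = 0..<k. x i ^ l * coeff (p j) l)"
        using ij deg[OF ij(2)] by (intro sum.mono_neutral_cong_left) (auto simp: coeff_eq_0)
      finally show "M p $$ (i, j) = (V * C) $$ (i, j)"
        using ij by (simp add: M_def V_def C_def scalar_prod_def)
    qed (auto simp: M_def V_def C_def)
    moreover have "Determinant.det C = 1"
    proof -
      have "upper_triangular C"
        using deg by (auto simp: C_def upper_triangular_def coeff_eq_0)
      hence "Determinant.det C = prod_list (diag_mat C)"
        by (rule det_upper_triangular[OF _ C_carrier])
      also have "\<dots> = (\<Prod>i = 0..<k. C $$ (i, i))"
        using C_carrier by (simp add: prod_list_diag_prod)
      also have "\<dots> = 1"
        using deg lc by (intro prod.neutral) (auto simp: C_def)
      finally show ?thesis .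
    qed
    ultimately show ?thesis
      using det_mult[OF V_carrier C_carrier] by simp
  qed
  \<comment> \<open>In the Newton basis the matrix is triangular, which evaluates the determinant.\<close>
  define nb where "nb j = (\<Prod>l<j. [:- x l, 1:])" for j
  have nb_deg: "degree (nb j) = j" for j
    unfolding nb_def by (subst degree_prod_eq_sum_degree) auto
  have nb_lc: "lead_coeff (nb j) = 1" for j
    unfolding nb_def lead_coeff_prod by simp
  have "Determinant.det (M nb) = prod_list (diag_mat (M nb))"
    by (rule det_lower_triangular[OF _ M_carrier]) (auto simp: M_def nb_def poly_prod)
  also have "\<dots> = (\<Prod>j<k. \<Prod>i<j. x j - x i)"
    unfolding prod_list_diag_prod by (simp add: M_def nb_def poly_prod atLeast0LessThan)
  finally have "Determinant.det (M p) = (\<Prod>j<k. \<Prod>i<j. x j - x i)"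
    using det_M[of p] det_M[of nb] deg lc nb_deg nb_lc by simp
  moreover have "Determinant.det (M p) =
      (\<Sum>\<sigma> | \<sigma> permutes {0..<k}. of_int (sign \<sigma>) * (\<Prod>i<k. poly (p (\<sigma> i)) (x i)))"
    unfolding det_def'[OF M_carrier]
  proof (rule sum.cong[OF refl], rule arg_cong2[where f = "(*)"])
    fix \<sigma> assume "\<sigma> \<in> {\<sigma>. \<sigma> permutes {0..<k}}"
    hence "\<sigma> i < k" if "i < k" for i
      using that permutes_in_image[of \<sigma> "{0..<k}" i] by auto
    thus "(\<Prod>i = 0..<k. M p $$ (i, \<sigma> i)) = (\<Prod>i<k. poly (p (\<sigma> i)) (x i))"
      unfolding atLeast0LessThan by (intro prod.cong) (auto simp: M_def)
  qed (auto simp: sign_def)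
  ultimately show ?thesis by simp
qed

text \<open>Substituting \<open>\<tau> = \<rho> \<circ> \<sigma>\<close> makes the inner sum the
  same determinant for each of the \<open>k!\<close> permutations \<open>\<sigma>\<close>. This is
  the combinatorial core of Andreief's identity for integrals of a product of two
  determinants.\<close>

lemma sum_sign_pairs:
  fixes M :: "nat \<Rightarrow> nat \<Rightarrow> 'a::{comm_ring_1,ring_char_0}"
  shows "(\<Sum>\<sigma> | \<sigma> permutes {0..<k}. \<Sum>\<tau> | \<tau> permutes {0..<k}.
      of_int (sign \<sigma>) * of_int (sign \<tau>) * (\<Prod>j<k. M (\<sigma> j) (\<tau> j))) =
    fact k * (\<Sum>\<rho> | \<rho> permutes {0..<k}. of_int (sign \<rho>) * (\<Prod>i<k. M i (\<rho> i)))"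
proof -
  let ?P = "{\<sigma>. \<sigma> permutes {0..<k}}"
  have "(\<Sum>\<tau>\<in>?P. of_int (sign \<sigma>) * of_int (sign \<tau>) * (\<Prod>j<k. M (\<sigma> j) (\<tau> j))) =
     (\<Sum>\<rho>\<in>?P. of_int (sign \<rho>) * (\<Prod>i<k. M i (\<rho> i)))" if \<sigma>: "\<sigma> permutes {0..<k}" for \<sigma>
  proof -
    have perm: "permutation \<rho>" if "\<rho> permutes {0..<k}" for \<rho>
      using that permutation_permutes by blast
    have "(\<Sum>\<tau>\<in>?P. of_int (sign \<sigma>) * of_int (sign \<tau>) * (\<Prod>j<k. M (\<sigma> j) (\<tau> j))) =
      (\<Sum>\<rho>\<in>?P. of_int (sign \<sigma>) * of_int (sign (\<rho> \<circ> \<sigma>)) * (\<Prod>j<k. M (\<sigma> j) ((\<rho> \<circ> \<sigma>) j)))"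
      by (rule sum_permutations_compose_right[OF \<sigma>])
    also have "\<dots> = (\<Sum>\<rho>\<in>?P. of_int (sign \<rho>) * (\<Prod>i<k. M i (\<rho> i)))"
    proof (rule sum.cong[OF refl])
      fix \<rho> assume \<rho>: "\<rho> \<in> ?P"
      have "sign (\<rho> \<circ> \<sigma>) = sign \<rho> * sign \<sigma>"
        using perm \<rho> \<sigma> by (intro sign_compose) auto
      moreover have "sign \<sigma> * sign \<sigma> = 1" by (simp add: sign_def)
      hence "of_int (sign \<sigma>) * of_int (sign \<sigma>) = (1 :: 'a)"
        by (metis of_int_mult of_int_1)
      ultimately have s: "of_int (sign \<sigma>) * of_int (sign (\<rho> \<circ> \<sigma>)) = (of_int (sign \<rho>) :: 'a)"
        by (simp add: mult_ac)
      have "(\<Prod>j\<in>{0..<k}. M (\<sigma> j) (\<rho> (\<sigma> j))) = (\<Prod>i\<in>{0..<k}. M i (\<rho> i))"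
        by (rule prod.reindex_bij_betw[OF permutes_imp_bij[OF \<sigma>]])
      thus "of_int (sign \<sigma>) * of_int (sign (\<rho> \<circ> \<sigma>)) * (\<Prod>j<k. M (\<sigma> j) ((\<rho> \<circ> \<sigma>) j)) =
          of_int (sign \<rho>) * (\<Prod>i<k. M i (\<rho> i))"
        using s by (simp add: atLeast0LessThan)
    qed
    finally show ?thesis .
  qed
  hence "(\<Sum>\<sigma>\<in>?P. \<Sum>\<tau>\<in>?P. of_int (sign \<sigma>) * of_int (sign \<tau>) * (\<Prod>j<k. M (\<sigma> j) (\<tau> j))) =
      (\<Sum>\<sigma>\<in>?P. \<Sum>\<rho>\<in>?P. of_int (sign \<rho>) * (\<Prod>i<k. M i (\<rho> i)))"
    by (rule sum.cong[OF refl]) simp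
  also have "\<dots> = fact k * (\<Sum>\<rho>\<in>?P. of_int (sign \<rho>) * (\<Prod>i<k. M i (\<rho> i)))"
    using card_permutations[of "{0..<k}" k] by simp
  finally show ?thesis .
qed


text \<open>The value \<open>0\<close> for \<open>j > n\<close> matches the zero entries of the
  matrix of inverse factorials.\<close>

lemma poly_falling_factorial:
  "poly (\<Prod>l<j. [:- of_nat l, 1:]) (of_nat n) =
    (if j \<le> n then fact n / fact (n - j) else (0 :: complex))"
proof (induction j)
  case (Suc j)
  show ?case
  proof (cases "Suc j \<le> n")
    case True
    have f: "fact (n - j) = of_nat (n - j) * (fact (n - Suc j) :: complex)"
      using True Suc_diff_Suc[of j n] fact_Suc[of "n - Suc j", where ?'a = complex] by simp
    have nz: "of_nat (n - j) \<noteq> (0 :: complex)"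
      using True by simp
    have "poly (\<Prod>l<Suc j. [:- of_nat l, 1:]) (of_nat n) =
        poly (\<Prod>l<j. [:- of_nat l, 1:]) (of_nat n) * (of_nat n - of_nat j :: complex)"
      by (simp add: poly_prod algebra_simps)
    also have "(of_nat n - of_nat j :: complex) = of_nat (n - j)"
      using True by (simp add: of_nat_diff)
    also have "poly (\<Prod>l<j. [:- of_nat l, 1:]) (of_nat n) = (fact n / fact (n - j) :: complex)"
      using Suc True by simp
    also have "fact n / fact (n - j) * of_nat (n - j) = (fact n / fact (n - Suc j) :: complex)"
      unfolding f using nz by simp
    finally show ?thesis
      using True by (simp del: prod.lessThan_Suc)
  next
    case False
    thus ?thesis
      using Suc by (cases "j = n") auto
  qed
qed simp

lemma sum_lessThan_nat: "(\<Sum>j<k. j) = k * (k - 1) div (2 :: nat)"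
proof (induction k)
  case (Suc k)
  show ?case
  proof (cases k)
    case (Suc m)
    have "even (k * m)" by (simp add: Suc)
    moreover have "Suc k * k = k * m + 2 * k" by (simp add: Suc algebra_simps)
    ultimately show ?thesis using Suc.IH Suc by auto
  qed simp
qed simp

text \<open>With \<open>n i = 2 k - 1 - 2 i\<close>, taking \<open>1 / (n i)!\<close> out of row
  \<open>i\<close> leaves falling factorials of \<open>n i\<close>, whose determinant is the
  Vandermonde product of the nodes \<open>n i\<close>.\<close>

lemma sum_sign_inverse_factorials:
  "(\<Sum>\<rho> | \<rho> permutes {0..<k}. of_int (sign \<rho>) * (\<Prod>i<k.
      if 2 * i + \<rho> i < 2 * k then inverse (fact (2 * k - 1 - (2 * i + \<rho> i))) else (0 :: complex))) =
    (-1) ^ (k * (k - 1) div 2) * 2 ^ (k * (k + 1) div 2) * (\<Prod>j=1..k. fact j / fact (2 * j))"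
proof -
  define n where "n i = 2 * k - 1 - 2 * i" for i
  define ff :: "nat \<Rightarrow> complex poly" where "ff j = (\<Prod>l<j. [:- of_nat l, 1:])" for j
  have ff_deg: "degree (ff j) = j" for j
    unfolding ff_def by (subst degree_prod_eq_sum_degree) auto
  have ff_lc: "lead_coeff (ff j) = 1" for j
    unfolding ff_def lead_coeff_prod by simp
  have entry: "(if 2 * i + j < 2 * k then inverse (fact (2 * k - 1 - (2 * i + j))) else 0) =
      inverse (fact (n i)) * poly (ff j) (of_nat (n i))" if "i < k" for i j
  proof -
    have "2 * i + j < 2 * k \<longleftrightarrow> j \<le> n i" "n i - j = 2 * k - 1 - (2 * i + j)"
      using that by (auto simp: n_def)
    thus ?thesis
      by (auto simp: ff_def poly_falling_factorial field_simps)
  qed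
  have "(\<Sum>\<rho> | \<rho> permutes {0..<k}. of_int (sign \<rho>) * (\<Prod>i<k.
      if 2 * i + \<rho> i < 2 * k then inverse (fact (2 * k - 1 - (2 * i + \<rho> i))) else (0 :: complex))) =
     (\<Sum>\<rho> | \<rho> permutes {0..<k}. (\<Prod>i<k. inverse (fact (n i))) *
        (of_int (sign \<rho>) * (\<Prod>i<k. poly (ff (\<rho> i)) (of_nat (n i)))))"
    by (intro sum.cong) (auto simp: entry prod.distrib)
  also have "\<dots> = (\<Prod>i<k. inverse (fact (n i))) * (\<Prod>j<k. \<Prod>i<j. of_nat (n j) - of_nat (n i))"
    unfolding sum_distrib_left[symmetric]
    by (subst vandermonde_monic_basis) (auto simp: ff_deg ff_lc[unfolded ff_deg])
  \<comment> \<open>The nodes are equally spaced: \<open>n j - n i = -2 (j - i)\<close>.\<close>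
  also have "(\<Prod>j<k. \<Prod>i<j. of_nat (n j) - of_nat (n i)) = (\<Prod>j<k. (-2) ^ j * fact j :: complex)"
  proof (rule prod.cong[OF refl])
    fix j assume "j \<in> {..<k}"
    hence "of_nat (n j) - of_nat (n i) = - 2 * (of_nat (j - i) :: complex)" if "i < j" for i
      using that by (simp add: n_def of_nat_diff algebra_simps)
    hence "(\<Prod>i<j. of_nat (n j) - of_nat (n i)) = (\<Prod>i<j. - 2 * (of_nat (j - i) :: complex))"
      by (intro prod.cong) auto
    also have "\<dots> = (-2) ^ j * (\<Prod>i<j. of_nat (j - i))"
      unfolding prod.distrib by simp
    also have "(\<Prod>i<j. of_nat (j - i) :: complex) = (\<Prod>i<j. of_nat (Suc (j - Suc i)))"
      by (intro prod.cong) (auto simp: Suc_diff_Suc)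
    also have "\<dots> = (\<Prod>i<j. of_nat (Suc i))"
      by (rule prod.nat_diff_reindex)
    also have "\<dots> = fact j"
      by (simp add: fact_prod_Suc atLeast0LessThan)
    finally show "(\<Prod>i<j. of_nat (n j) - of_nat (n i)) = (-2) ^ j * (fact j :: complex)" .
  qed
  also have "(\<Prod>i<k. inverse (fact (n i)) :: complex) = (\<Prod>i<k. inverse (fact (2 * (k - Suc i) + 1)))"
    by (intro prod.cong arg_cong[where f = "\<lambda>m. inverse (fact m)"] refl) (auto simp: n_def)
  also have "\<dots> = (\<Prod>i<k. inverse (fact (2 * i + 1)))"
    by (rule prod.nat_diff_reindex)
  \<comment> \<open>Uses \<open>j! / (2j+1)! = 2 (j+1)! / (2j+2)!\<close>, which shifts the index to
    the range \<open>1..k\<close>.\<close>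
  also have "(\<Prod>i<k. inverse (fact (2 * i + 1))) * (\<Prod>j<k. (-2) ^ j * fact j) =
     (\<Prod>j<k. (-1 :: complex) ^ j) * (\<Prod>j<k. 2 ^ j * 2 * (fact (Suc j) / fact (2 * Suc j)))"
    unfolding prod.distrib[symmetric]
  proof (intro prod.cong refl)
    fix j :: nat
    have gen: "inverse a * (u * v * b) = u * (v * 2 * (s * b / (2 * s * a)))" if "s \<noteq> 0" "a \<noteq> 0"
      for s a u v b :: complex
      using that by (simp add: field_simps)
    have "fact (2 * Suc j) = (2 * of_nat (Suc j)) * (fact (2 * j + 1) :: complex)"
      by simp
    moreover have "(of_nat (Suc j) :: complex) \<noteq> 0"
      using of_nat_neq_0 by blast
    moreover have "(-2 :: complex) ^ j = (-1) ^ j * 2 ^ j"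
      by (metis mult_minus1 power_mult_distrib)
    ultimately show "inverse (fact (2 * j + 1)) * ((-2) ^ j * fact j) =
        (-1 :: complex) ^ j * (2 ^ j * 2 * (fact (Suc j) / fact (2 * Suc j)))"
      using gen[of "of_nat (Suc j)" "fact (2 * j + 1)" "(-1) ^ j" "2 ^ j" "fact j"]
      by (simp only: fact_Suc[of j] fact_nonzero not_False_eq_True of_nat_mult of_nat_fact simp_thms)
  qed
  also have "(\<Prod>j<k. (-1 :: complex) ^ j) = (-1) ^ (k * (k - 1) div 2)"
    unfolding power_sum[symmetric] sum_lessThan_nat ..
  also have "(\<Prod>j<k. 2 ^ j * 2 * (fact (Suc j) / fact (2 * Suc j)) :: complex) =
      2 ^ (k * (k + 1) div 2) * (\<Prod>j=1..k. fact j / fact (2 * j))"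
  proof -
    have "(\<Prod>j<k. 2 ^ j * 2 :: complex) = 2 ^ (\<Sum>j<k. j + 1)"
      by (simp add: power_sum mult.commute)
    also have "(\<Sum>j<k. j + 1) = k * (k + 1) div 2"
      using sum_lessThan_nat[of "Suc k"] unfolding sum.distrib by (simp add: mult.commute)
    finally have "(\<Prod>j<k. 2 ^ j * 2 :: complex) = 2 ^ (k * (k + 1) div 2)" .
    moreover have "(\<Prod>j=1..k. fact j / fact (2 * j) :: complex) = (\<Prod>j<k. fact (Suc j) / fact (2 * Suc j))"
      unfolding One_nat_def prod.atLeast1_atMost_eq ..
    ultimately show ?thesis
      by (simp only: prod.distrib)
  qed
  finally show ?thesis by (simp only: mult.assoc)
qed

subsection \<open>The integrand on a small torus\<close>

text \<open>The value at \<open>0\<close> is the residue of the zeta function at \<open>1\<close>,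
  since \<open>1 - q^(-w)\<close> behaves like \<open>w log q\<close>.\<close>

definition zeta_reg :: "'a::{finite,field_gcd} itself \<Rightarrow> complex \<Rightarrow> complex" where
  "zeta_reg T w = (if w = 0 then 1 / of_real (ln (real CARD('a))) else w * zetaA T (1 + w))"

lemma card_powr: "(of_nat CARD('a::{finite,field_gcd}) :: complex) powr w = exp (w * of_real (ln (real CARD('a))))"
  using card_field_ge_2[where ?'a = 'a] Ln_of_real[of "real CARD('a)"] by (simp add: powr_def)

text \<open>It is the reciprocal of \<open>(1 - q^(-w)) / w\<close>, whose removable singularity has
  the value \<open>log q \<noteq> 0\<close>; a small disc avoids the other zeros of
  \<open>1 - q^(-w)\<close>.\<close>

lemma zeta_reg_holomorphic: "\<exists>\<delta>>0. zeta_reg TYPE('a::{finite,field_gcd}) holomorphic_on ball 0 \<delta>"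
proof -
  define l where "l = complex_of_real (ln (real CARD('a)))"
  have l0: "l \<noteq> 0" using card_field_ge_2[where ?'a = 'a] by (simp add: l_def)
  define f where "f w = 1 - exp (- w * l)" for w
  have f_hol: "f holomorphic_on UNIV" unfolding f_def by (intro holomorphic_intros)
  have d: "deriv f 0 = l"
    unfolding f_def by (rule DERIV_imp_deriv) (auto intro!: derivative_eq_intros)
  have f0: "f 0 = 0" by (simp add: f_def)
  define \<psi> where "\<psi> w = (if w = 0 then l else f w / w)" for w
  have \<psi>_hol: "\<psi> holomorphic_on UNIV"
  proof -
    have "\<psi> = (\<lambda>w. if w = 0 then deriv f 0 else (f w - f 0) / (w - 0))"
      by (simp add: \<psi>_def fun_eq_iff d f0)
    thus ?thesis using pole_lemma[OF f_hol, of 0] by simp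
  qed
  have "isCont \<psi> 0"
    using holomorphic_on_imp_continuous_on[OF \<psi>_hol] by (simp add: continuous_on_eq_continuous_at)
  then obtain \<delta> where \<delta>: "\<delta> > 0" "\<And>w. dist 0 w < \<delta> \<Longrightarrow> \<psi> w \<noteq> 0"
    using continuous_at_avoid[of 0 \<psi> 0] l0 by (auto simp: \<psi>_def)
  have "(\<lambda>w. inverse (\<psi> w)) holomorphic_on ball 0 \<delta>"
    using \<delta>(2) by (intro holomorphic_on_inverse holomorphic_on_subset[OF \<psi>_hol]) auto
  moreover have "inverse (\<psi> w) = zeta_reg TYPE('a) w" for w
    by (simp add: \<psi>_def zeta_reg_def zetaA_def card_powr f_def l_def inverse_eq_divide)
  ultimately show ?thesis using \<delta>(1) by (auto cong: holomorphic_cong)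
qed

text \<open>\<open>Gfun\<close> with the poles at \<open>z i + z j = 0\<close> removed and the
  powers of \<open>Xfac\<close> written as exponentials, with which the principal powers agree near
  \<open>0\<close>.\<close>

definition Greg :: "'a::{finite,field_gcd} itself \<Rightarrow> nat \<Rightarrow> (nat \<Rightarrow> complex) \<Rightarrow> complex" where
  "Greg T k z = eulerA T k z * (\<Prod>j=1..k. exp (- (z j) / 2 * of_real (ln (real CARD('a))))) *
     (\<Prod>j=1..k. \<Prod>i=1..j. zeta_reg T (z i + z j))"

lemma Greg_poly_approx:
  "\<exists>\<rho>>0. \<rho> \<le> 1 / ln (real CARD('a::{finite,field_gcd})) \<and> poly_approx k \<rho> (Greg TYPE('a) k)"
proof -
  have lq: "ln (real CARD('a)) > 0" using card_field_ge_2[where ?'a = 'a] by simp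
  obtain \<delta> where \<delta>: "\<delta> > 0" "zeta_reg TYPE('a) holomorphic_on ball 0 \<delta>"
    using zeta_reg_holomorphic by blast
  \<comment> \<open>\<open>1/12\<close> serves the Euler product, \<open>\<delta> / 3\<close> keeps
    \<open>z i + z j\<close> in the disc of \<open>zeta_reg\<close>, and \<open>1 / ln q\<close>
    secures the branch of the power in \<open>integrand_eq\<close>.\<close>
  define \<rho> where "\<rho> = Min {1/12, \<delta> / 3, 1 / ln (real CARD('a))}"
  have \<rho>: "\<rho> > 0" "\<rho> \<le> 1/12" "\<rho> \<le> \<delta> / 3" "\<rho> \<le> 1 / ln (real CARD('a))"
    using lq \<delta>(1) by (auto simp: \<rho>_def)
  have "poly_approx k \<rho> (\<lambda>z. zeta_reg TYPE('a) (z i + z j))" if "j \<in> {1..k}" "i \<in> {1..j}" for i j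
  proof (rule poly_approx_compose_holomorphic[OF \<delta>(2)])
    show "2 * \<rho> < \<delta>" using \<rho> \<delta>(1) by linarith
    show "poly_approx k \<rho> (\<lambda>z. z i + z j)"
      using that by (intro poly_approx_add poly_approx_coord) auto
    fix z assume z: "z \<in> polydisc k \<rho>"
    have "norm (z i) \<le> \<rho>" "norm (z j) \<le> \<rho>" using z that by (auto simp: polydisc_def)
    thus "norm (z i + z j) \<le> 2 * \<rho>" using norm_triangle_ineq[of "z i" "z j"] by linarith
  qed
  moreover have "poly_approx k \<rho> (\<lambda>z. exp (- (z j) / 2 * of_real (ln (real CARD('a)))))" if "j \<in> {1..k}" for j
    using poly_approx_exp[OF poly_approx_mult[OF poly_approx_const[of k \<rho> "- (of_real (ln (real CARD('a))) / 2)"]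
      poly_approx_coord[OF that]]] by (simp add: mult_ac)
  moreover have "poly_approx k \<rho> (eulerA TYPE('a) k)"
    by (rule poly_approx_mono[OF eulerA_poly_approx \<rho>(2)])
  ultimately have "poly_approx k \<rho> (Greg TYPE('a) k)"
    unfolding Greg_def[abs_def] by (intro poly_approx_mult poly_approx_prod)
  thus ?thesis using \<rho> by blast
qed

lemma prod_interval_split: "(\<Prod>i=1..j. f i) = (\<Prod>i=1..<j. f i) * (f j :: 'b::comm_monoid_mult)" if "j \<ge> (1 :: nat)"
proof -
  have "{1..j} = insert j {1..<j}" using that by auto
  thus ?thesis by (simp add: mult.commute)
qed

text \<open>
  At \<open>z i + z j = 0\<close> the junk value \<open>zetaA T 1 = 0\<close> is harmless: both sides vanish there.
\<close>
lemma zeta_vandermonde: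
  assumes "\<And>j. j \<in> {1..k} \<Longrightarrow> z j \<noteq> 0"
  shows "(\<Prod>j=1..k. \<Prod>i=1..j. zetaA T (1 + z i + z j)) * (vandermonde k (\<lambda>j. (z j)\<^sup>2))\<^sup>2 =
    (\<Prod>j=1..k. \<Prod>i=1..j. zeta_reg T (z i + z j)) * (vandermonde k (\<lambda>j. (z j)\<^sup>2) * vandermonde k z) /
    (2 ^ k * (\<Prod>j=1..k. z j))"
proof -
  have reg: "zetaA T (1 + w) = zeta_reg T w / w" if "w \<noteq> 0" for w
    using that by (simp add: zeta_reg_def)
  \<comment> \<open>One factor \<open>z i + z j\<close> cancels the pole, leaving one difference of
    squares and one plain difference. The diagonal pairs have no such factor and leave
    \<open>1 / (2 z j)\<close>.\<close>
  have off: "zetaA T (1 + z i + z j) * ((z j)\<^sup>2 - (z i)\<^sup>2)\<^sup>2 =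
      zeta_reg T (z i + z j) * (((z j)\<^sup>2 - (z i)\<^sup>2) * (z j - z i))" for i j
  proof (cases "z i + z j = 0")
    case True
    hence "z j = - z i" by (simp add: add_eq_0_iff)
    thus ?thesis by simp
  next
    case False
    have "(z j)\<^sup>2 - (z i)\<^sup>2 = (z j - z i) * (z i + z j)" by (simp add: power2_eq_square algebra_simps)
    thus ?thesis using False reg[OF False] by (simp add: add.assoc power2_eq_square)
  qed
  have diag: "zetaA T (1 + z j + z j) = zeta_reg T (z j + z j) / (2 * z j)" if "j \<in> {1..k}" for j
    using reg[of "z j + z j"] assms[OF that] by (simp add: add.assoc)
  have "(\<Prod>j=1..k. \<Prod>i=1..j. zetaA T (1 + z i + z j)) * (vandermonde k (\<lambda>j. (z j)\<^sup>2))\<^sup>2 =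
     (\<Prod>j=1..k. (\<Prod>i=1..<j. zetaA T (1 + z i + z j) * ((z j)\<^sup>2 - (z i)\<^sup>2)\<^sup>2) * zetaA T (1 + z j + z j))"
    unfolding vandermonde_def prod_power_distrib prod.distrib[symmetric]
    by (intro prod.cong refl, subst prod_interval_split) (auto simp: prod.distrib mult_ac)
  also have "\<dots> = (\<Prod>j=1..k. (\<Prod>i=1..<j. zeta_reg T (z i + z j) * (((z j)\<^sup>2 - (z i)\<^sup>2) * (z j - z i))) *
      (zeta_reg T (z j + z j) / (2 * z j)))"
    by (intro prod.cong refl arg_cong2[where f = "(*)"] off diag)
  also have "\<dots> = (\<Prod>j=1..k. (\<Prod>i=1..j. zeta_reg T (z i + z j)) *
     ((\<Prod>i=1..<j. (z j)\<^sup>2 - (z i)\<^sup>2) * (\<Prod>i=1..<j. z j - z i)) / (2 * z j))"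
    by (intro prod.cong refl, subst prod_interval_split[of _ "\<lambda>i. zeta_reg T (z i + z _)"]) (auto simp: prod.distrib mult_ac)
  also have "\<dots> = (\<Prod>j=1..k. \<Prod>i=1..j. zeta_reg T (z i + z j)) * (vandermonde k (\<lambda>j. (z j)\<^sup>2) * vandermonde k z) /
    (2 ^ k * (\<Prod>j=1..k. z j))"
    unfolding vandermonde_def by (simp add: prod_dividef prod.distrib)
  finally show ?thesis .
qed

definition vdm_kernel :: "nat \<Rightarrow> complex \<Rightarrow> (nat \<Rightarrow> complex) \<Rightarrow> complex" where
  "vdm_kernel k c z = vandermonde k (\<lambda>j. (z j)\<^sup>2) * vandermonde k z * exp (c * (\<Sum>j=1..k. z j))"

lemma integrand_eq:
  fixes x :: real
  assumes k: "k \<ge> 1" and r: "0 < r" "r \<le> 1 / ln (real CARD('a::{finite,field_gcd}))" and z: "z \<in> torus k r"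
  shows "Gfun TYPE('a) k z * (vandermonde k (\<lambda>j. (z j)\<^sup>2))\<^sup>2 / (\<Prod>j=1..k. z j ^ (2 * k - 1)) *
       of_nat CARD('a) powr (complex_of_real x / 2 * (\<Sum>j=1..k. z j)) =
     1 / 2 ^ k * (Greg TYPE('a) k z * vdm_kernel k (of_real (x * ln (real CARD('a)) / 2)) z / (\<Prod>j=1..k. z j ^ (2 * k)))"
proof -
  define l where "l = ln (real CARD('a))"
  have l: "l > 0" using card_field_ge_2[where ?'a = 'a] by (simp add: l_def)
  have z0: "z j \<noteq> 0" if "j \<in> {1..k}" for j using z r that by (auto simp: torus_def)
  \<comment> \<open>As \<open>|z j| \<le> 1 / log q\<close>, the imaginary part of
    \<open>z j log q\<close> is at most 1 in modulus, hence below pi, and the principal logarithm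
    inverts the exponential.\<close>
  have X: "Xfac TYPE('a) (1/2 + z j) powr (-1/2) = exp (- (z j) / 2 * of_real l)" if "j \<in> {1..k}" for j
  proof -
    have "norm (z j) = r" using z that by (simp add: torus_def)
    hence "\<bar>Im (z j)\<bar> \<le> 1 / l" using abs_Im_le_cmod[of "z j"] r(2) by (simp add: l_def)
    hence "\<bar>Im (z j)\<bar> * l \<le> 1" using l by (simp add: field_simps)
    hence "\<bar>Im (z j * of_real l)\<bar> \<le> 1" using l by (simp add: abs_mult)
    hence "- pi < Im (z j * of_real l)" "Im (z j * of_real l) \<le> pi" using pi_gt3 by linarith+
    hence "Ln (exp (z j * of_real l)) = z j * of_real l" by (rule Ln_exp)
    moreover have "Xfac TYPE('a) (1/2 + z j) = exp (z j * of_real l)"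
      by (simp add: Xfac_def card_powr l_def)
    ultimately show ?thesis by (simp add: powr_def mult_ac)
  qed
  have pk: "(\<Prod>j=1..k. z j ^ (2 * k)) = (\<Prod>j=1..k. z j ^ (2 * k - 1)) * (\<Prod>j=1..k. z j)"
  proof -
    have "Suc (2 * k - 1) = 2 * k" using k by simp
    thus ?thesis unfolding prod.distrib[symmetric] power_Suc2[symmetric] by simp
  qed
  have "Gfun TYPE('a) k z * (vandermonde k (\<lambda>j. (z j)\<^sup>2))\<^sup>2 =
      eulerA TYPE('a) k z * (\<Prod>j=1..k. exp (- (z j) / 2 * of_real l)) *
      ((\<Prod>j=1..k. \<Prod>i=1..j. zetaA TYPE('a) (1 + z i + z j)) * (vandermonde k (\<lambda>j. (z j)\<^sup>2))\<^sup>2)"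
    unfolding Gfun_def using X by (simp add: mult_ac)
  also have "\<dots> = Greg TYPE('a) k z * (vandermonde k (\<lambda>j. (z j)\<^sup>2) * vandermonde k z) / (2 ^ k * (\<Prod>j=1..k. z j))"
    by (subst zeta_vandermonde) (use z0 in \<open>auto simp: Greg_def l_def\<close>)
  finally have G: "Gfun TYPE('a) k z * (vandermonde k (\<lambda>j. (z j)\<^sup>2))\<^sup>2 =
     Greg TYPE('a) k z * (vandermonde k (\<lambda>j. (z j)\<^sup>2) * vandermonde k z) / (2 ^ k * (\<Prod>j=1..k. z j))" .
  have E: "of_nat CARD('a) powr (complex_of_real x / 2 * (\<Sum>j=1..k. z j)) =
      exp (of_real (x * ln (real CARD('a)) / 2) * (\<Sum>j=1..k. z j))"
    unfolding card_powr by (simp add: mult_ac)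
  show ?thesis unfolding G E pk vdm_kernel_def by (simp add: mult_ac)
qed

subsection \<open>The exact value of the main term\<close>

lemma vandermonde_expansion:
  "vandermonde k w = (\<Sum>\<sigma> | \<sigma> permutes {0..<k}. of_int (sign \<sigma>) * (\<Prod>i<k. w (Suc i) ^ \<sigma> i))"
proof -
  have "vandermonde k w = (\<Prod>j<k. \<Prod>i=1..<Suc j. w (Suc j) - w i)"
    unfolding vandermonde_def One_nat_def prod.atLeast1_atMost_eq ..
  also have "\<dots> = (\<Prod>j<k. \<Prod>i<j. w (Suc j) - w (Suc i))"
    by (simp only: One_nat_def prod.atLeast_Suc_lessThan_Suc_shift atLeast0LessThan o_def)
  also have "\<dots> = (\<Sum>\<sigma> | \<sigma> permutes {0..<k}. of_int (sign \<sigma>) * (\<Prod>i<k. poly (monom 1 (\<sigma> i)) (w (Suc i))))"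
    by (rule vandermonde_monic_basis[symmetric]) (auto simp: degree_monom_eq)
  finally show ?thesis by (simp add: poly_monom)
qed

text \<open>\<open>T\<close> counts the pairs \<open>i < j\<close>; the two Vandermonde products
  have total degree \<open>3 T\<close>, against \<open>2 k k\<close> in the denominator.\<close>

lemma triangular_exponents:
  fixes k :: nat
  defines "T \<equiv> k * (k - 1) div 2"
  shows "k * (k + 1) div 2 = T + k" "2 * k * k = 4 * T + 2 * k" "(\<Sum>i<k. i) = T"
proof -
  have 2: "2 * T = k * (k - 1)" unfolding T_def by (cases k) auto
  have "k * (k + 1) = 2 * (T + k)" using 2 by (cases k) (auto simp: algebra_simps)
  thus "k * (k + 1) div 2 = T + k" by simp
  show "2 * k * k = 4 * T + 2 * k" using 2 by (cases k) (auto simp: algebra_simps)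
  show "(\<Sum>i<k. i) = T" unfolding T_def by (rule sum_lessThan_nat)
qed

text \<open>After expanding both Vandermonde products each term splits into one-variable residues,
  and \<open>sum_sign_pairs\<close> collapses the double sum. Every permutation yields the same
  power of \<open>c\<close>, with exponent \<open>k (2 k - 1) - 3 T = T + k\<close>.\<close>

lemma vdm_kernel_has_iter_integral:
  assumes r: "r > 0" and c: "c \<noteq> 0"
  shows "has_iter_integral r k (\<lambda>z. vdm_kernel k c z / (\<Prod>j=1..k. z j ^ (2 * k)))
    ((2 * of_real pi * \<i>) ^ k * fact k * c ^ (k * (k + 1) div 2) *
     ((-1) ^ (k * (k - 1) div 2) * 2 ^ (k * (k + 1) div 2) * (\<Prod>j=1..k. fact j / fact (2 * j))))"
proof -
  let ?P = "{\<sigma>. \<sigma> permutes {0..<k}}"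
  define T where "T = k * (k - 1) div 2"
  note exps = triangular_exponents[of k, folded T_def]
  define w where "w i j = (if 2 * i + j < 2 * k then inverse (fact (2 * k - 1 - (2 * i + j))) else (0 :: complex))" for i j
  define M where "M i j = 2 * of_real pi * \<i> *
     (if 2 * i + j < 2 * k then c ^ (2 * k - 1 - (2 * i + j)) * inverse (fact (2 * k - 1 - (2 * i + j))) else 0)" for i j
  \<comment> \<open>Since \<open>c \<noteq> 0\<close>, the power of \<open>c\<close> separates from
    the factorial, also at the zero entries, where the exponent would be negative.\<close>
  have M: "M i j = 2 * of_real pi * \<i> * c ^ (2 * k - 1) * inverse c ^ (2 * i + j) * w i j" for i j
  proof (cases "2 * i + j < 2 * k")
    case True
    hence "c ^ (2 * k - 1 - (2 * i + j)) = c ^ (2 * k - 1) * inverse c ^ (2 * i + j)"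
      using c by (subst power_diff) (auto simp: power_inverse field_simps)
    thus ?thesis using True by (simp add: M_def w_def)
  qed (simp add: M_def w_def)
  define summand where "summand \<sigma> \<tau> z = of_int (sign \<sigma>) * of_int (sign \<tau>) *
     (\<Prod>j=1..k. z j ^ (2 * \<sigma> (j - 1) + \<tau> (j - 1)) * exp (c * z j) / z j ^ (2 * k))"
    for \<sigma> \<tau> :: "nat \<Rightarrow> nat" and z :: "nat \<Rightarrow> complex"
  have kernel_eq: "vdm_kernel k c z / (\<Prod>j=1..k. z j ^ (2 * k)) = (\<Sum>\<sigma>\<in>?P. \<Sum>\<tau>\<in>?P. summand \<sigma> \<tau> z)" for z
  proof -
    have "exp (c * (\<Sum>j=1..k. z j)) / (\<Prod>j=1..k. z j ^ (2 * k)) = (\<Prod>j<k. exp (c * z (Suc j)) / z (Suc j) ^ (2 * k))"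
      unfolding One_nat_def prod.atLeast1_atMost_eq sum.atLeast1_atMost_eq sum_distrib_left
      by (simp add: exp_sum prod_dividef)
    moreover have "vandermonde k (\<lambda>j. (z j)\<^sup>2) * vandermonde k z =
      (\<Sum>\<sigma>\<in>?P. \<Sum>\<tau>\<in>?P. of_int (sign \<sigma>) * of_int (sign \<tau>) * (\<Prod>i<k. z (Suc i) ^ (2 * \<sigma> i + \<tau> i)))"
      unfolding vandermonde_expansion sum_product
      by (intro sum.cong refl) (simp add: power_add prod.distrib mult_ac flip: power_mult)
    ultimately have "vdm_kernel k c z / (\<Prod>j=1..k. z j ^ (2 * k)) =
      (\<Sum>\<sigma>\<in>?P. \<Sum>\<tau>\<in>?P. of_int (sign \<sigma>) * of_int (sign \<tau>) * (\<Prod>i<k. z (Suc i) ^ (2 * \<sigma> i + \<tau> i))) *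
      (\<Prod>j<k. exp (c * z (Suc j)) / z (Suc j) ^ (2 * k))"
      unfolding vdm_kernel_def times_divide_eq_right[symmetric] by simp
    also have "\<dots> = (\<Sum>\<sigma>\<in>?P. \<Sum>\<tau>\<in>?P. summand \<sigma> \<tau> z)"
      unfolding sum_distrib_right
    proof (intro sum.cong refl)
      fix \<sigma> \<tau> :: "nat \<Rightarrow> nat"
      have "summand \<sigma> \<tau> z = of_int (sign \<sigma>) * of_int (sign \<tau>) *
         (\<Prod>j<k. z (Suc j) ^ (2 * \<sigma> j + \<tau> j) * exp (c * z (Suc j)) / z (Suc j) ^ (2 * k))"
        unfolding summand_def One_nat_def prod.atLeast1_atMost_eq by simp
      also have "\<dots> = of_int (sign \<sigma>) * of_int (sign \<tau>) * (\<Prod>i<k. z (Suc i) ^ (2 * \<sigma> i + \<tau> i)) *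
        (\<Prod>j<k. exp (c * z (Suc j)) / z (Suc j) ^ (2 * k))"
        unfolding mult.assoc prod.distrib[symmetric] times_divide_eq_right ..
      finally show "of_int (sign \<sigma>) * of_int (sign \<tau>) * (\<Prod>i<k. z (Suc i) ^ (2 * \<sigma> i + \<tau> i)) *
        (\<Prod>j<k. exp (c * z (Suc j)) / z (Suc j) ^ (2 * k)) = summand \<sigma> \<tau> z" ..
    qed
    finally show ?thesis .
  qed
  have "has_iter_integral r k (\<lambda>z. \<Sum>\<sigma>\<in>?P. \<Sum>\<tau>\<in>?P. summand \<sigma> \<tau> z)
     (\<Sum>\<sigma>\<in>?P. \<Sum>\<tau>\<in>?P. of_int (sign \<sigma>) * of_int (sign \<tau>) * (\<Prod>j=1..k. M (\<sigma> (j - 1)) (\<tau> (j - 1))))"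
    unfolding summand_def M_def
    by (intro has_iter_integral_sum has_iter_integral_cmult has_iter_integral_prod has_contour_integral_power_exp r)
  moreover have "(\<Sum>\<sigma>\<in>?P. \<Sum>\<tau>\<in>?P. of_int (sign \<sigma>) * of_int (sign \<tau>) * (\<Prod>j=1..k. M (\<sigma> (j - 1)) (\<tau> (j - 1)))) =
      (2 * of_real pi * \<i>) ^ k * fact k * c ^ (T + k) * ((-1) ^ T * 2 ^ (T + k) * (\<Prod>j=1..k. fact j / fact (2 * j)))"
  proof -
    have "(\<Sum>\<sigma>\<in>?P. \<Sum>\<tau>\<in>?P. of_int (sign \<sigma>) * of_int (sign \<tau>) * (\<Prod>j=1..k. M (\<sigma> (j - 1)) (\<tau> (j - 1)))) =
      (\<Sum>\<sigma>\<in>?P. \<Sum>\<tau>\<in>?P. of_int (sign \<sigma>) * of_int (sign \<tau>) * (\<Prod>j<k. M (\<sigma> j) (\<tau> j)))"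
      unfolding One_nat_def prod.atLeast1_atMost_eq by simp
    also have "\<dots> = fact k * (\<Sum>\<rho>\<in>?P. of_int (sign \<rho>) * (\<Prod>i<k. M i (\<rho> i)))"
      by (rule sum_sign_pairs)
    also have "(\<Sum>\<rho>\<in>?P. of_int (sign \<rho>) * (\<Prod>i<k. M i (\<rho> i))) =
        (\<Sum>\<rho>\<in>?P. (2 * of_real pi * \<i>) ^ k * c ^ (T + k) * (of_int (sign \<rho>) * (\<Prod>i<k. w i (\<rho> i))))"
    proof (intro sum.cong refl)
      fix \<rho> assume "\<rho> \<in> ?P"
      hence "\<rho> permutes {0..<k}" by simp
      from sum.permute[OF this, of "\<lambda>i. i"] have "(\<Sum>i<k. \<rho> i) = T"
        using exps(3) by (simp add: atLeast0LessThan o_def)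
      hence e: "(\<Sum>i<k. 2 * i + \<rho> i) = 3 * T"
        using exps(3) by (simp add: sum.distrib sum_distrib_left[symmetric])
      have "(\<Prod>i<k. M i (\<rho> i)) = (2 * of_real pi * \<i>) ^ k * ((c ^ (2 * k - 1)) ^ k * inverse c ^ (3 * T)) * (\<Prod>i<k. w i (\<rho> i))"
        unfolding M prod.distrib e[symmetric] power_sum by (simp add: power_mult_distrib)
      also have "(c ^ (2 * k - 1)) ^ k * inverse c ^ (3 * T) = c ^ (T + k)"
      proof -
        have "(2 * k - 1) * k = 3 * T + (T + k)"
          using exps(2) by (cases k) (auto simp: algebra_simps)
        hence "(c ^ (2 * k - 1)) ^ k = c ^ (3 * T) * c ^ (T + k)"
          by (simp only: power_mult[symmetric] power_add)
        thus ?thesis using c by (simp add: power_inverse)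
      qed
      finally show "of_int (sign \<rho>) * (\<Prod>i<k. M i (\<rho> i)) =
         (2 * of_real pi * \<i>) ^ k * c ^ (T + k) * (of_int (sign \<rho>) * (\<Prod>i<k. w i (\<rho> i)))"
        by (simp add: mult_ac)
    qed
    also have "\<dots> = (2 * of_real pi * \<i>) ^ k * c ^ (T + k) * (\<Sum>\<rho>\<in>?P. of_int (sign \<rho>) * (\<Prod>i<k. w i (\<rho> i)))"
      by (rule sum_distrib_left[symmetric])
    also have "(\<Sum>\<rho>\<in>?P. of_int (sign \<rho>) * (\<Prod>i<k. w i (\<rho> i))) =
        (-1) ^ T * 2 ^ (T + k) * (\<Prod>j=1..k. fact j / fact (2 * j))"
      unfolding w_def sum_sign_inverse_factorials exps(1) T_def[symmetric] ..
    finally show ?thesis by (simp add: mult_ac)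
  qed
  ultimately show ?thesis unfolding kernel_eq exps(1) T_def[symmetric] by simp
qed


subsection \<open>The leading term of the polynomial\<close>

lemma poly_approx_vdm_kernel: "poly_approx k \<rho> (vdm_kernel k c)"
  unfolding vdm_kernel_def[abs_def] vandermonde_def
  by (intro poly_approx_mult poly_approx_prod poly_approx_diff poly_approx_power poly_approx_exp
      poly_approx_sum poly_approx_const poly_approx_coord) auto

lemma norm_vandermonde_le:
  assumes "\<And>j. j \<in> {1..k} \<Longrightarrow> norm (w j) \<le> b"
  shows "norm (vandermonde k w) \<le> (2 * b) ^ (k * (k - 1) div 2)"
proof -
  have "norm (vandermonde k w) = (\<Prod>j=1..k. \<Prod>i=1..<j. norm (w j - w i))"
    by (simp add: vandermonde_def prod_norm)
  also have "\<dots> \<le> (\<Prod>j=1..k. \<Prod>i=1..<j. 2 * b)"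
  proof (intro prod_mono conjI prod_nonneg norm_ge_zero)
    fix i j assume "j \<in> {1..k}" "i \<in> {1..<j}"
    hence "norm (w j) \<le> b" "norm (w i) \<le> b" by (auto intro!: assms)
    thus "norm (w j - w i) \<le> 2 * b" using norm_triangle_ineq4[of "w j" "w i"] by linarith
  qed
  also have "\<dots> = (\<Prod>j<k. (2 * b) ^ j)"
    unfolding One_nat_def prod.atLeast1_atMost_eq by simp
  also have "\<dots> = (2 * b) ^ (k * (k - 1) div 2)"
    unfolding power_sum[symmetric] sum_lessThan_nat ..
  finally show ?thesis .
qed

lemma norm_vdm_kernel_le:
  assumes r: "r \<ge> 0" and z: "z \<in> torus k r"
  defines "T \<equiv> k * (k - 1) div 2"
  shows "norm (vdm_kernel k c z) \<le> 4 ^ T * r ^ (3 * T) * exp (norm c * (real k * r))"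
proof -
  have zr: "norm (z j) = r" if "j \<in> {1..k}" for j using z that by (simp add: torus_def)
  have "norm (vdm_kernel k c z) \<le> (2 * r\<^sup>2) ^ T * (2 * r) ^ T * exp (norm c * (real k * r))"
    unfolding vdm_kernel_def norm_mult T_def
  proof (intro mult_mono norm_vandermonde_le)
    have "norm (\<Sum>j=1..k. z j) \<le> (\<Sum>j=1..k. norm (z j))" by (rule norm_sum)
    also have "\<dots> = real k * r" using zr by simp
    finally have "norm (c * (\<Sum>j=1..k. z j)) \<le> norm c * (real k * r)"
      unfolding norm_mult by (intro mult_left_mono) auto
    thus "norm (exp (c * (\<Sum>j=1..k. z j))) \<le> exp (norm c * (real k * r))"
      using norm_exp[of "c * (\<Sum>j=1..k. z j)"] by (meson exp_le_cancel_iff order.trans)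
  qed (use zr r in \<open>auto simp: norm_power\<close>)
  also have "(2 * r\<^sup>2) ^ T * (2 * r) ^ T = 4 ^ T * r ^ (3 * T)"
    unfolding power_mult_distrib[symmetric] power_mult
    by (simp add: power2_eq_square power3_eq_cube mult_ac)
  finally show ?thesis .
qed

text \<open>A value common to all small radii makes the description in \<open>Qpol\<close> well
  defined. As \<open>\<rho>\<close> is chosen before \<open>x\<close>, the radius may later depend
  on \<open>x\<close>.\<close>

lemma Qpol_integral:
  assumes k: "k \<ge> 1"
  shows "\<exists>\<rho>>0. \<exists>v. poly_approx k \<rho> (Greg TYPE('a::{finite,field_gcd}) k) \<and>
    (\<forall>x r. 0 < r \<and> r \<le> \<rho> \<longrightarrow> has_iter_integral r k
       (\<lambda>z. Greg TYPE('a) k z * vdm_kernel k (of_real (x * ln (real CARD('a)) / 2)) z / (\<Prod>j=1..k. z j ^ (2 * k))) (v x)) \<and>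
    (\<forall>x. Qpol TYPE('a) k x = (-1) ^ (k * (k - 1) div 2) / (fact k * (2 * of_real pi * \<i>) ^ k) * v x)"
proof -
  obtain \<rho> where \<rho>: "\<rho> > 0" "\<rho> \<le> 1 / ln (real CARD('a))" "poly_approx k \<rho> (Greg TYPE('a) k)"
    using Greg_poly_approx[of k, where ?'a = 'a] by blast
  have "\<forall>x. \<exists>v. \<forall>r. 0 < r \<and> r \<le> \<rho> \<longrightarrow> has_iter_integral r k
       (\<lambda>z. Greg TYPE('a) k z * vdm_kernel k (of_real (x * ln (real CARD('a)) / 2)) z / (\<Prod>j=1..k. z j ^ (2 * k))) v"
    by (intro allI poly_approx_has_iter_integral poly_approx_mult poly_approx_vdm_kernel \<rho>)
  from choice[OF this] obtain v where v: "\<And>x r. 0 < r \<Longrightarrow> r \<le> \<rho> \<Longrightarrow> has_iter_integral r k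
       (\<lambda>z. Greg TYPE('a) k z * vdm_kernel k (of_real (x * ln (real CARD('a)) / 2)) z / (\<Prod>j=1..k. z j ^ (2 * k))) (v x)"
    by blast
  have "Qpol TYPE('a) k x = (-1) ^ (k * (k - 1) div 2) / (fact k * (2 * of_real pi * \<i>) ^ k) * v x" for x
  proof -
    let ?c = "(-1) ^ (k * (k - 1) div 2) / (fact k * (2 * of_real pi * \<i>) ^ k) * v x"
    have "Q_radius TYPE('a) k r x = ?c" if r: "0 < r" "r \<le> \<rho>" for r
    proof -
      have "has_iter_integral r k (\<lambda>z. Gfun TYPE('a) k z * (vandermonde k (\<lambda>j. (z j)\<^sup>2))\<^sup>2 / (\<Prod>j=1..k. z j ^ (2 * k - 1)) *
         of_nat CARD('a) powr (complex_of_real x / 2 * (\<Sum>j=1..k. z j))) (1 / 2 ^ k * v x)"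
        by (rule has_iter_integral_cong[OF r(1) has_iter_integral_cmult[OF v[OF r]]])
           (rule integrand_eq[symmetric, OF k r(1)], use r \<rho> in auto)
      from iter_circle_integral_unique[OF r(1) this] show ?thesis
        unfolding Q_radius_def by simp
    qed
    hence ev: "\<forall>\<^sub>F r in at_right 0. Q_radius TYPE('a) k r x = ?c"
      using \<rho>(1) unfolding eventually_at_right_field by (intro exI[of _ \<rho>]) auto
    show ?thesis unfolding Qpol_def
    proof (rule the_equality)
      show "\<forall>\<^sub>F r in at_right 0. Q_radius TYPE('a) k r x = ?c" by (rule ev)
      fix c assume "\<forall>\<^sub>F r in at_right 0. Q_radius TYPE('a) k r x = c"
      \<comment> \<open>\<open>at_right 0\<close> is not the trivial filter, so two eventual values
        coincide.\<close>
      hence "\<forall>\<^sub>F r :: real in at_right 0. c = ?c" using ev by eventually_elim simp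
      thus "c = ?c" by simp
    qed
  qed
  thus ?thesis using \<rho> v by blast
qed

text \<open>Each of the \<open>k (k + 1) / 2\<close> pairs \<open>i \<le> j\<close> contributes the
  residue \<open>1 / log q\<close>.\<close>

lemma Greg_0:
  "Greg TYPE('a::{finite,field_gcd}) k (\<lambda>_. 0) =
     eulerA TYPE('a) k (\<lambda>_. 0) / of_real (ln (real CARD('a))) ^ (k * (k + 1) div 2)"
proof -
  have "(\<Sum>j=1..k. j) = k * (k + 1) div 2"
    using sum_lessThan_nat[of "Suc k"] by (simp add: atLeast0AtMost[symmetric] lessThan_Suc_atMost mult.commute
      sum.atLeast_Suc_atMost[of 0])
  hence "(\<Prod>j=1..k. \<Prod>i=1..j. inverse l) = inverse l ^ (k * (k + 1) div 2)" for l :: complex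
    by (simp add: power_sum[symmetric])
  thus ?thesis
    by (simp add: Greg_def zeta_reg_def inverse_eq_divide power_divide)
qed

text \<open>On \<open>|z j| = r = 1 / x\<close> the exponential is bounded, as
  \<open>|c| k r = k log q / 2\<close>. The kernel gives \<open>r^(3 T)\<close>, the circles
  \<open>r^k\<close>, the denominator \<open>r^(-2 k k)\<close>; so replacing \<open>g(z)\<close> by
  \<open>g(0)\<close> costs a small multiple of \<open>x^(T + k)\<close>, the order of the exact
  main term.\<close>

lemma Qpol_asymptotics:
  assumes k: "k \<ge> 1"
  shows "((\<lambda>x. Qpol TYPE('a::{finite,field_gcd}) k x / of_real x ^ (k * (k + 1) div 2)) \<longlongrightarrow>
    eulerA TYPE('a) k (\<lambda>_. 0) * (\<Prod>j=1..k. fact j / fact (2 * j))) at_top"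
proof -
  define T where "T = k * (k - 1) div 2"
  define n where "n = T + k"
  define l where "l = ln (real CARD('a))"
  note exps = triangular_exponents[of k, folded T_def, folded n_def]
  have l: "l > 0" using card_field_ge_2[where ?'a = 'a] by (simp add: l_def)
  define pr :: complex where "pr = (\<Prod>j=1..k. fact j / fact (2 * j))"
  define g where "g = Greg TYPE('a) k"
  define K where "K x = vdm_kernel k (of_real (x * l / 2))" for x
  obtain \<rho> v where \<rho>: "\<rho> > 0" "poly_approx k \<rho> g"
    and v: "\<And>x r. 0 < r \<Longrightarrow> r \<le> \<rho> \<Longrightarrow> has_iter_integral r k (\<lambda>z. g z * K x z / (\<Prod>j=1..k. z j ^ (2 * k))) (v x)"
    and Q: "\<And>x. Qpol TYPE('a) k x = (-1) ^ T / (fact k * (2 * of_real pi * \<i>) ^ k) * v x"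
    using Qpol_integral[OF k, where ?'a = 'a] unfolding g_def K_def l_def T_def by blast
  define m where "m = (2 * of_real pi * \<i>) ^ k * fact k * (of_real l / 2) ^ n * ((-1) ^ T * 2 ^ n * pr)"
  have main: "has_iter_integral r k (\<lambda>z. K x z / (\<Prod>j=1..k. z j ^ (2 * k))) (m * of_real x ^ n)"
    if "r > 0" "x > 0" for r x
  proof -
    have c: "complex_of_real (x * l / 2) \<noteq> 0" using that l by simp
    have "complex_of_real (x * l / 2) ^ n = of_real x ^ n * (of_real l / 2) ^ n"
      by (simp add: power_mult_distrib power_divide)
    thus ?thesis
      using vdm_kernel_has_iter_integral[OF that(1) c, of k]
      unfolding exps(1) T_def[symmetric] K_def m_def pr_def by (simp add: mult_ac)
  qed
  define g0 where "g0 = g (\<lambda>_. 0)"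
  define C where "C = 4 ^ T * exp (l / 2 * real k) * (2 * pi) ^ k"
  have C: "C > 0" by (simp add: C_def)
  have lim: "((\<lambda>x. v x / of_real x ^ n) \<longlongrightarrow> g0 * m) at_top"
  proof (rule tendstoI)
    fix e :: real assume e: "e > 0"
    define \<epsilon> where "\<epsilon> = e / (2 * C)"
    have \<epsilon>: "\<epsilon> > 0" using e C by (simp add: \<epsilon>_def)
    obtain \<delta> where \<delta>: "\<delta> > 0" "\<And>z. z \<in> polydisc k \<delta> \<Longrightarrow> norm (g z - g0) < \<epsilon>"
      using poly_approx_continuous_0[OF \<rho>(2,1) \<epsilon>] unfolding g0_def by blast
    \<comment> \<open>\<open>x \<ge> 1 / \<rho>\<close> puts the torus of radius
      \<open>1 / x\<close> where the integral formula holds, and \<open>x \<ge> 1 / \<delta>\<close>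
      puts it where \<open>g\<close> is close to \<open>g0\<close>.\<close>
    have "dist (v x / of_real x ^ n) (g0 * m) < e" if x: "x \<ge> max 1 (max (1 / \<rho>) (1 / \<delta>))" for x
    proof -
      define r where "r = 1 / x"
      have x0: "x > 0" using x by simp
      have r: "r > 0" "r \<le> \<rho>" "r \<le> \<delta>"
        using x x0 \<rho>(1) \<delta>(1) by (auto simp: r_def field_simps)
      define B where "B = \<epsilon> * (4 ^ T * r ^ (3 * T) * exp (l / 2 * real k)) / r ^ (2 * k * k)"
      have "has_iter_integral r k (\<lambda>z. g z * K x z / (\<Prod>j=1..k. z j ^ (2 * k)) - g0 * (K x z / (\<Prod>j=1..k. z j ^ (2 * k))))
          (v x - g0 * (m * of_real x ^ n))"
        by (intro has_iter_integral_diff has_iter_integral_cmult v main r x0)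
      hence "norm (v x - g0 * (m * of_real x ^ n)) \<le> B * (2 * pi * r) ^ k"
      proof (rule has_iter_integral_bound[OF r(1), rotated])
        show "B \<ge> 0" using r(1) \<epsilon> by (simp add: B_def)
        fix z assume z: "z \<in> torus k r"
        have nz: "norm (\<Prod>j=1..k. z j ^ (2 * k)) = r ^ (2 * k * k)"
          using z by (simp add: prod_norm[symmetric] norm_power torus_def power_mult)
        have "norm (K x z) \<le> 4 ^ T * r ^ (3 * T) * exp (norm (complex_of_real (x * l / 2)) * (real k * r))"
          unfolding K_def T_def by (rule norm_vdm_kernel_le) (use r z in auto)
        also have "norm (complex_of_real (x * l / 2)) * (real k * r) = l / 2 * real k"
          using x0 l by (simp add: r_def norm_mult norm_divide)
        finally have Kb: "norm (K x z) \<le> 4 ^ T * r ^ (3 * T) * exp (l / 2 * real k)" .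
        have "norm (g z - g0) \<le> \<epsilon>"
          using \<delta>(2)[of z] z r(3) by (auto simp: torus_def polydisc_def less_imp_le)
        hence "norm (g z - g0) * norm (K x z) \<le> \<epsilon> * (4 ^ T * r ^ (3 * T) * exp (l / 2 * real k))"
          using \<epsilon> by (intro mult_mono Kb) auto
        hence "norm (g z - g0) * norm (K x z) / r ^ (2 * k * k) \<le> B"
          unfolding B_def using r(1) by (intro divide_right_mono) auto
        moreover have "g z * K x z / (\<Prod>j=1..k. z j ^ (2 * k)) - g0 * (K x z / (\<Prod>j=1..k. z j ^ (2 * k))) =
            (g z - g0) * K x z / (\<Prod>j=1..k. z j ^ (2 * k))"
          by (simp add: diff_divide_distrib left_diff_distrib)
        ultimately show "norm (g z * K x z / (\<Prod>j=1..k. z j ^ (2 * k)) - g0 * (K x z / (\<Prod>j=1..k. z j ^ (2 * k)))) \<le> B"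
          by (simp only: norm_divide norm_mult nz)
      qed
      also have "B * (2 * pi * r) ^ k = \<epsilon> * C * x ^ n"
      proof -
        have "2 * k * k = 3 * T + k + n" using exps(2) by (simp add: n_def)
        hence "r ^ (2 * k * k) = r ^ (3 * T) * r ^ k * r ^ n" by (simp only: power_add)
        hence "B * (2 * pi * r) ^ k = \<epsilon> * C / r ^ n"
          using r(1) by (simp add: B_def C_def power_mult_distrib field_simps)
        thus ?thesis by (simp add: r_def power_divide)
      qed
      finally have "norm (v x - g0 * (m * of_real x ^ n)) \<le> e / 2 * x ^ n"
        using C by (simp add: \<epsilon>_def)
      moreover have "v x / of_real x ^ n - g0 * m = (v x - g0 * (m * of_real x ^ n)) / of_real x ^ n"
        using x0 by (simp add: diff_divide_distrib)
      ultimately have "norm (v x / of_real x ^ n - g0 * m) \<le> e / 2"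
        using x0 by (simp add: norm_divide norm_power divide_le_eq)
      thus ?thesis using e by (simp add: dist_norm)
    qed
    thus "\<forall>\<^sub>F x in at_top. dist (v x / of_real x ^ n) (g0 * m) < e"
      unfolding eventually_at_top_linorder by blast
  qed
  have "((\<lambda>x. (-1) ^ T / (fact k * (2 * of_real pi * \<i>) ^ k) * (v x / of_real x ^ n)) \<longlongrightarrow>
      (-1) ^ T / (fact k * (2 * of_real pi * \<i>) ^ k) * (g0 * m)) at_top"
    by (intro tendsto_mult tendsto_const lim)
  also have "(\<lambda>x. (-1) ^ T / (fact k * (2 * of_real pi * \<i>) ^ k) * (v x / of_real x ^ n)) =
      (\<lambda>x. Qpol TYPE('a) k x / of_real x ^ n)"
    unfolding Q by simp
  also have "(-1) ^ T / (fact k * (2 * of_real pi * \<i>) ^ k) * (g0 * m) = eulerA TYPE('a) k (\<lambda>_. 0) * pr"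
  proof -
    have sgn: "(-1 :: complex) ^ T * (-1) ^ T = 1" by (simp flip: power_mult_distrib)
    have pi: "(2 * of_real pi * \<i>) ^ k \<noteq> (0 :: complex)" by simp
    \<comment> \<open>The \<open>2 ^ n\<close> of the determinant cancels the \<open>2 ^ n\<close>
      below \<open>l ^ n\<close>; the remaining \<open>l ^ n\<close> cancels the residues in
      \<open>Greg_0\<close>.\<close>
    have "(of_real l / 2) ^ n * 2 ^ n = (of_real l ^ n :: complex)"
      by (simp add: power_divide)
    hence "(-1) ^ T / (fact k * (2 * of_real pi * \<i>) ^ k) * m = ((-1) ^ T * (-1) ^ T) * (of_real l ^ n * pr)"
      using pi by (simp add: m_def field_simps)
    hence "(-1) ^ T / (fact k * (2 * of_real pi * \<i>) ^ k) * (g0 * m) = g0 * (of_real l ^ n * pr)"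
      unfolding sgn by (simp only: mult.left_commute[of _ g0] mult_1)
    also have "g0 * (of_real l ^ n * pr) = eulerA TYPE('a) k (\<lambda>_. 0) * pr"
      unfolding g0_def g_def Greg_0 exps(1) l_def[symmetric] using l by simp
    finally show ?thesis .
  qed
  finally show ?thesis unfolding exps(1) pr_def .
qed

subsection \<open>The asymptotic formula\<close>

theorem theorem6p2:
  fixes \<xi> :: "'a::{finite,field_gcd}" and k :: nat
  assumes q_power_of_2: "\<exists>m\<ge>1. CARD('a) = 2 ^ m"
    and xi: "\<xi> \<notin> {x\<^sup>2 + x | x. True}"
    and k: "k \<ge> 1"
    and moment: "\<exists>\<epsilon> :: nat \<Rightarrow> complex. \<epsilon> \<longlonglongrightarrow> 0 \<and>
      (\<forall>\<^sub>F g in sequentially.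
         (\<Sum>u\<in>setI \<xi> (g + 1). Lfun (1/2) u ^ k) =
         (\<Sum>u\<in>setI \<xi> (g + 1). Qpol TYPE('a) k (2 * real g + 1) * (1 + \<epsilon> g)))"
  shows "(\<lambda>g. \<Sum>u\<in>setI \<xi> (g + 1). Lfun (1/2) u ^ k) \<sim>[sequentially]
    (\<lambda>g. 2 ^ (k * (k + 1) div 2 + 1) * (of_nat CARD('a) ^ (2 * g + 1) / zetaA TYPE('a) 2) *
         of_nat g ^ (k * (k + 1) div 2) * eulerA TYPE('a) k (\<lambda>_. 0) *
         (\<Prod>j=1..k. fact j / fact (2 * j)))"
proof -
  define n where "n = k * (k + 1) div 2"
  define L where "L = eulerA TYPE('a) k (\<lambda>_. 0) * (\<Prod>j=1..k. fact j / fact (2 * j))"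
  define q where "q = CARD('a)"
  have q2: "q \<ge> 2" unfolding q_def by (rule card_field_ge_2)
  have L0: "L \<noteq> 0" using eulerA_0_nonzero[of k, where ?'a = 'a] by (simp add: L_def)
  obtain \<epsilon> :: "nat \<Rightarrow> complex" where \<epsilon>: "\<epsilon> \<longlonglongrightarrow> 0"
    and eq: "\<forall>\<^sub>F g in sequentially. (\<Sum>u\<in>setI \<xi> (g + 1). Lfun (1/2) u ^ k) =
         (\<Sum>u\<in>setI \<xi> (g + 1). Qpol TYPE('a) k (2 * real g + 1) * (1 + \<epsilon> g))"
    using moment by blast
  \<comment> \<open>\<open>0 = 0^2 + 0\<close>, so \<open>\<xi>\<close> differs from
    \<open>0\<close> and the two constant terms in \<open>setG\<close> are distinct.\<close>
  have "\<xi> \<noteq> 0"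
  proof
    assume "\<xi> = 0"
    hence "\<xi> = 0\<^sup>2 + 0" by simp
    thus False using xi by blast
  qed
  note card = card_setI[OF this, folded q_def]
  \<comment> \<open>\<open>1 / zeta(2) = 1 - 1/q\<close>, so this is half the cardinality of the
    family.\<close>
  have zeta: "of_nat q ^ (2 * g + 1) / zetaA TYPE('a) 2 = of_nat ((q - 1) * q ^ (2 * g))" for g
  proof -
    have "(of_nat CARD('a) :: complex) powr (1 - 2) = inverse (of_nat q)"
      by (simp add: powr_minus q_def)
    hence "of_nat q ^ (2 * g + 1) / zetaA TYPE('a) 2 = of_nat q ^ (2 * g + 1) * (1 - inverse (of_nat q))"
      by (simp add: zetaA_def divide_inverse)
    also have "\<dots> = (of_nat q - 1) * of_nat q ^ (2 * g)"
      using q2 by (simp add: field_simps)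
    finally show ?thesis using q2 by (simp add: of_nat_diff)
  qed
  have x: "filterlim (\<lambda>g. 2 * real g + 1) at_top sequentially"
    by real_asymp
  define F where "F g = Qpol TYPE('a) k (2 * real g + 1) / of_real (2 * real g + 1) ^ n" for g
  have F: "F \<longlonglongrightarrow> L"
    unfolding F_def L_def n_def by (rule filterlim_compose[OF Qpol_asymptotics[OF k] x])
  \<comment> \<open>\<open>Qpol\<close> grows like \<open>(2 g + 1)^n\<close>, the claim is in terms
    of \<open>(2 g)^n = 2^n g^n\<close>; their ratio tends to 1.\<close>
  have ratio: "(\<lambda>g. complex_of_real ((2 * real g + 1) / (2 * real g))) \<longlonglongrightarrow> of_real 1"
    by (intro tendsto_of_real) real_asymp
  have "(\<lambda>g. F g * complex_of_real ((2 * real g + 1) / (2 * real g)) ^ n * (1 + \<epsilon> g) / L) \<longlonglongrightarrow>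
      L * of_real 1 ^ n * (1 + 0) / L"
    by (intro tendsto_intros F ratio \<epsilon> L0)
  hence lim: "(\<lambda>g. F g * complex_of_real ((2 * real g + 1) / (2 * real g)) ^ n * (1 + \<epsilon> g) / L) \<longlonglongrightarrow> 1"
    using L0 by simp
  show ?thesis
  proof (rule asymp_equivI', rule Lim_transform_eventually[OF lim])
    show "\<forall>\<^sub>F g in sequentially. F g * complex_of_real ((2 * real g + 1) / (2 * real g)) ^ n * (1 + \<epsilon> g) / L =
      (\<Sum>u\<in>setI \<xi> (g + 1). Lfun (1/2) u ^ k) /
      (2 ^ (k * (k + 1) div 2 + 1) * (of_nat CARD('a) ^ (2 * g + 1) / zetaA TYPE('a) 2) *
         of_nat g ^ (k * (k + 1) div 2) * eulerA TYPE('a) k (\<lambda>_. 0) * (\<Prod>j=1..k. fact j / fact (2 * j)))"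
      using eq eventually_gt_at_top[of 0]
    proof eventually_elim
      case (elim g)
      define c :: complex where "c = of_nat ((q - 1) * q ^ (2 * g))"
      have c0: "c \<noteq> 0" using q2 by (simp add: c_def)
      define X where "X = complex_of_real (2 * real g + 1)"
      have X0: "X \<noteq> 0" by (simp add: X_def add_eq_0_iff del: of_real_add)
      \<comment> \<open>The summand does not involve \<open>u\<close>, so the assumed right-hand
        side is the cardinality \<open>2 c\<close> times it.\<close>
      have "(\<Sum>u\<in>setI \<xi> (g + 1). Lfun (1/2) u ^ k) = 2 * c * (F g * X ^ n * (1 + \<epsilon> g))"
        unfolding elim(1) using card[of g] X0 by (simp add: c_def F_def X_def)
      moreover have "2 ^ (k * (k + 1) div 2 + 1) * (of_nat CARD('a) ^ (2 * g + 1) / zetaA TYPE('a) 2) *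
         of_nat g ^ (k * (k + 1) div 2) * eulerA TYPE('a) k (\<lambda>_. 0) * (\<Prod>j=1..k. fact j / fact (2 * j)) =
         2 * c * (2 * of_nat g) ^ n * L"
        using zeta[of g] unfolding c_def L_def n_def[symmetric] q_def[symmetric] by (simp add: power_mult_distrib mult_ac)
      moreover have "complex_of_real ((2 * real g + 1) / (2 * real g)) ^ n = X ^ n / (2 * of_nat g) ^ n"
        by (simp add: X_def power_divide)
      ultimately show ?case using c0 L0 elim(2) by (simp add: field_simps)
    qed
  qed
qed

end
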